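(* Let $p(n)$ be the partition function, $u_n=\dfrac{p(n+1)p(n-1)}{p(n)^2}$, and $\mu(n)=\frac{\pi}{6}\sqrt{24n-1}$. With $x=\mu(n-1)$, $y=\mu(n)$, $z=\mu(n+1)$, let $$f(n)=e^{x-2y+z}\,\frac{(x^{10}-x^9-1)\,y^{24}\,(z^{10}-z^9-1)}{x^{12}\,(y^{10}-y^9+1)^2\,z^{12}}.$$ For $0<t<1$ let $$Q(t)=\frac{3t+2\sqrt{(1-t)^3}-2}{t^2}.$$ Then for all integers $n\geq 85$, $$f(n)+\frac{110}{\mu(n-1)^5}<Q(u_n).$$
   Context: $p(n)$ denotes the number of partitions of the positive integer $n$; for $n\geq 85$ one has $0<u_n<1$, so $Q(u_n)$ is defined. *)

theory Defs
  imports "HOL-Analysis.Analysis" "HOL-Library.Multiset"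
begin

text \<open>A partition of \<open>n\<close> is a multiset of positive integers with sum \<open>n\<close>.\<close>

definition partitions :: "nat \<Rightarrow> nat multiset set" where
  "partitions n = {M. (\<forall>k\<in>#M. k > 0) \<and> \<Sum>\<^sub># M = n}"

definition partition_p :: "nat \<Rightarrow> nat" where
  "partition_p n = card (partitions n)"

text \<open>Since \<open>card\<close> of an infinite set is 0, finiteness is needed for \<open>partition_p\<close> to be the count.\<close>

lemma finite_partitions: "finite (partitions n)"
proof -
  have "partitions n \<subseteq> mset ` {xs. set xs \<subseteq> {..n} \<and> length xs \<le> n}"
  proof
    fix M assume M: "M \<in> partitions n"
    obtain xs where xs: "M = mset xs" by (metis ex_mset)
    have pos: "\<forall>k\<in>set xs. k > 0" and s: "sum_list xs = n"
      using M xs by (auto simp: partitions_def sum_mset_sum_list)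
    have "length xs \<le> sum_list xs"
      using pos by (induction xs) auto
    moreover have "set xs \<subseteq> {..n}"
      using s member_le_sum_list by auto
    ultimately show "M \<in> mset ` {xs. set xs \<subseteq> {..n} \<and> length xs \<le> n}"
      using xs s by auto
  qed
  thus ?thesis
    by (rule finite_subset) (simp add: finite_lists_length_le)
qed

definition u_ratio :: "nat \<Rightarrow> real" where
  "u_ratio n = real (partition_p (n + 1)) * real (partition_p (n - 1)) / (real (partition_p n))\<^sup>2"

definition mu :: "nat \<Rightarrow> real" where
  "mu n = pi / 6 * sqrt (24 * real n - 1)"

definition f_fun :: "nat \<Rightarrow> real" where
  "f_fun n = (let x = mu (n - 1); y = mu n; z = mu (n + 1) in
     exp (x - 2 * y + z) *
       (((x ^ 10 - x ^ 9 - 1) * y ^ 24 * (z ^ 10 - z ^ 9 - 1)) /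
        (x ^ 12 * (y ^ 10 - y ^ 9 + 1)\<^sup>2 * z ^ 12)))"

text \<open>Meaningful for \<open>0 < t < 1\<close>.\<close>

definition Q_fun :: "real \<Rightarrow> real" where
  "Q_fun t = (3 * t + 2 * sqrt ((1 - t) ^ 3) - 2) / t\<^sup>2"

end

theory Submission
  imports Defs "HOL-Complex_Analysis.Complex_Analysis" "HOL-Probability.Probability" "HOL-Real_Asymp.Real_Asymp"
begin

text \<open>
  Since \<open>Q(1 - s) = 1 - s + 2 s\<^sup>3\<^sup>/\<^sup>2 + O(s\<^sup>2)\<close>, while \<open>f(n)\<close> agrees with \<open>u\<^sub>n\<close> up to a tiny error and
  \<open>1 - u\<^sub>n\<close> has order \<open>\<mu>(n)\<^sup>-\<^sup>3\<close>, the term \<open>2 s\<^sup>3\<^sup>/\<^sup>2\<close> dominates \<open>110/\<mu>\<^sup>5\<close>; what is needed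
  is \<open>p(n)\<close> with a relative error of order \<open>\<mu>\<^sup>-\<^sup>5\<close>.

  The generating function \<open>F(w) = \<Sum> p(k) e\<^sup>-\<^sup>k\<^sup>w\<close> satisfies
  \<open>F(w) = (w/2\<pi>)\<^sup>1\<^sup>/\<^sup>2 exp(\<pi>\<^sup>2/6w - w/24) F(4\<pi>\<^sup>2/w)\<close>. By Euler's pentagonal number theorem this is
  the transformation law of a theta function with a character modulo 12, which arises as the limit of a
  root-of-unity filter applied to the binomial coefficients. The coefficient integral of \<open>F\<close> over the
  whole segment from \<open>t - \<i>\<pi>\<close> to \<open>t + \<i>\<pi>\<close>, \<open>t = \<mu>/(2n - 1/12)\<close>, can be estimated with this single
  transformation: the factor \<open>F(4\<pi>\<^sup>2/w) - 1\<close> costs at most \<open>e\<^sup>\<mu>\<^sup>/\<^sup>8\<close>, so no minor arcs occur, and the main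
  part has an elementary primitive in terms of \<open>\<integral> exp z\<^sup>2\<close>. This gives
  \<open>p(n)\<close> up to \<open>3 e\<^sup>5\<^sup>\<mu>\<^sup>/\<^sup>8\<close>, which suffices for \<open>n > 800\<close>. For \<open>85 \<le> n \<le> 800\<close> the partition numbers are
  computed from the pentagonal recurrence and the inequality is reduced to one between integers.
\<close>

section \<open>Partitions and the pentagonal number theorem\<close>

text \<open>The narrow margin shapes the proof. With \<open>s = 1 - u\<close>, of order
  \<open>mu^(-3)\<close>, the gain \<open>2 * s * sqrt s\<close> has order \<open>mu^(-9/2)\<close>,
  only a factor \<open>sqrt mu\<close> above the losses of order \<open>mu^(-5)\<close>, and this
  factor is about 5 at \<open>n = 85\<close>. Hence \<open>f\<close> is bounded with explicit
  constants down to order \<open>mu^(-6)\<close>, and the error of \<open>p(n)\<close> needs an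
  explicit constant as well. The threshold 800 is set by the contour integral: its relative error,
  of order \<open>mu^2 * exp (- 3 * mu / 8)\<close>, must fall below \<open>55 / mu^5\<close>, which
  the constants used here just allow at \<open>mu = 145/2\<close>, reached at
  \<open>n = 800\<close>. Below the threshold the upper bound for \<open>f\<close> stays analytic,
  as it is valid from \<open>n = 85\<close> on; only \<open>u\<close> is replaced by a rational
  number computed from the actual partition numbers. On the way to the theta function a finite
  character sum takes the part of Poisson summation, so that only a dominated passage to the limit
  remains.\<close>

definition bounded_partitions :: "nat \<Rightarrow> nat \<Rightarrow> nat multiset set" where
  "bounded_partitions k n = {M \<in> partitions n. \<forall>x\<in>#M. x \<le> k}"

definition partition_pb :: "nat \<Rightarrow> nat \<Rightarrow> nat" where
  "partition_pb k n = card (bounded_partitions k n)"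

lemma finite_bounded_partitions: "finite (bounded_partitions k n)"
  unfolding bounded_partitions_def using finite_partitions by simp

lemma partition_pb_0: "partition_pb 0 n = (if n = 0 then 1 else 0)"
proof -
  have "bounded_partitions 0 n = (if n = 0 then {{#}} else {})"
  proof (rule set_eqI)
    fix M
    have "M \<in> bounded_partitions 0 n \<longleftrightarrow> M = {#} \<and> n = 0"
    proof
      assume M: "M \<in> bounded_partitions 0 n"
      then have "x \<notin># M" for x
        by (auto simp: bounded_partitions_def partitions_def)
      then have "M = {#}" by (meson multiset_nonemptyE)
      with M show "M = {#} \<and> n = 0" by (simp add: bounded_partitions_def partitions_def)
    qed (simp add: bounded_partitions_def partitions_def)
    then show "M \<in> bounded_partitions 0 n \<longleftrightarrow> M \<in> (if n = 0 then {{#}} else {})" by simp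
  qed
  then show ?thesis by (simp add: partition_pb_def)
qed

text \<open>Coefficientwise form of \<open>P (Suc k) * (1 - q ^ Suc k) = P k\<close> for the
  truncated partition products: a partition that contains \<open>Suc k\<close> arises by adding one
  copy of \<open>Suc k\<close>. Both the formal and the real version of the product rest on
  it.\<close>

lemma partition_pb_Suc:
  "partition_pb (Suc k) n
     = partition_pb k n + (if Suc k \<le> n then partition_pb (Suc k) (n - Suc k) else 0)"
proof -
  let ?B = "if Suc k \<le> n then add_mset (Suc k) ` bounded_partitions (Suc k) (n - Suc k) else {}"
  have mem: "M \<in> bounded_partitions (Suc k) n \<longleftrightarrow> M \<in> bounded_partitions k n \<or> M \<in> ?B" for M
  proof (cases "Suc k \<in># M")
    case True
    then obtain N where N: "M = add_mset (Suc k) N" by (metis mset_add)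
    have "M \<in> bounded_partitions (Suc k) n \<longleftrightarrow> Suc k \<le> n \<and> N \<in> bounded_partitions (Suc k) (n - Suc k)"
      by (auto simp: N bounded_partitions_def partitions_def)
    moreover have "M \<notin> bounded_partitions k n"
      using True by (force simp: bounded_partitions_def)
    moreover have "M \<in> ?B \<longleftrightarrow> Suc k \<le> n \<and> N \<in> bounded_partitions (Suc k) (n - Suc k)"
      by (auto simp: N)
    ultimately show ?thesis by simp
  next
    case False
    then have "M \<notin> ?B" by auto
    moreover have "x \<le> Suc k \<longleftrightarrow> x \<le> k" if "x \<in># M" for x
      using that False by (metis le_Suc_eq)
    then have "M \<in> bounded_partitions (Suc k) n \<longleftrightarrow> M \<in> bounded_partitions k n"
      by (auto simp: bounded_partitions_def)
    ultimately show ?thesis by simp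
  qed
  then have eq: "bounded_partitions (Suc k) n = bounded_partitions k n \<union> ?B"
    by (intro set_eqI) (simp only: mem Un_iff)
  have disj: "bounded_partitions k n \<inter> ?B = {}"
    by (auto simp: bounded_partitions_def)
  have "card (bounded_partitions (Suc k) n) = card (bounded_partitions k n) + card ?B"
    unfolding eq by (rule card_Un_disjoint) (use disj finite_bounded_partitions in auto)
  moreover have "card ?B = (if Suc k \<le> n then partition_pb (Suc k) (n - Suc k) else 0)"
    by (auto simp: partition_pb_def intro!: card_image inj_onI)
  ultimately show ?thesis by (simp add: partition_pb_def)
qed

lemma partition_pb_eq: "n \<le> k \<Longrightarrow> partition_pb k n = partition_p n"
proof -
  assume nk: "n \<le> k"
  have "x \<le> n" if "M \<in> partitions n" "x \<in># M" for M x
    using that by (auto simp: partitions_def sum_mset.remove)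
  then have "bounded_partitions k n = partitions n"
    using nk by (fastforce simp: bounded_partitions_def)
  then show ?thesis by (simp add: partition_pb_def partition_p_def)
qed

lemma partition_pb_le: "partition_pb k n \<le> partition_p n"
  unfolding partition_pb_def partition_p_def
  by (rule card_mono[OF finite_partitions]) (auto simp: bounded_partitions_def)

lemma partition_p_0: "partition_p 0 = 1"
  using partition_pb_eq[of 0 0] by (simp add: partition_pb_0)

definition pent_partial :: "'a::comm_ring_1 \<Rightarrow> nat \<Rightarrow> 'a" where
  "pent_partial q n = 1 + (\<Sum>s=1..n. (-1)^s * (q^(s*(3* s-1) div 2) + q^(s*(3* s+1) div 2)))"

text \<open>Shanks' finite form of the pentagonal number theorem; \<open>P k\<close> stands for the
  inverse of \<open>(1 - q) ... (1 - q^k)\<close>. An arbitrary integral domain is allowed because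
  the identity serves twice: for formal power series, where it yields the recurrence for
  \<open>p(n)\<close>, and for real \<open>q\<close>, where it yields a limit. The induction
  multiplies the sum for \<open>n + 1\<close> by \<open>1 - q^(n+1)\<close> and subtracts the sum
  for \<open>n\<close>; the difference telescopes and leaves two new pentagonal powers.\<close>

lemma shanks_identity:
  fixes q :: "'a::idom" and P :: "nat \<Rightarrow> 'a"
  assumes P0: "P 0 = 1" and PS: "\<And>k. P (Suc k) * (1 - q ^ Suc k) = P k"
    and nz: "\<And>k. q ^ Suc k \<noteq> 1"
  shows "(\<Sum>s\<le>n. (-1)^s * P s * q^(s*n + s*(s+1) div 2)) = pent_partial q n * P n"
proof (induction n)
  case 0
  then show ?case by (simp add: P0 pent_partial_def)
next
  case (Suc n)
  define N where "N = Suc n"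
  define S where "S = (\<lambda>n. \<Sum>s\<le>n. (-1)^s * P s * q^(s*n + s*(s+1) div 2))"
  define A where "A = (\<lambda>s. (-1)^s * P s * q^((s+1)*N + s*(s+1) div 2))"
  have tri: "Suc s * (Suc s + 1) div 2 = s * (s+1) div 2 + Suc s" for s :: nat
  proof -
    have "Suc s * (Suc s + 1) = s * (s+1) + Suc s * 2" by simp
    then show ?thesis by (metis div_mult_self1 zero_neq_numeral add.commute)
  qed
  have pent1: "N * N + n * (n+1) div 2 = N * (3 * N - 1) div 2"
  proof -
    have "N * (3 * N - 1) = n*(n+1) + (N * N) * 2" by (simp add: N_def algebra_simps)
    then show ?thesis by (metis div_mult_self1 zero_neq_numeral add.commute)
  qed
  have pent2: "N * N + N * (N+1) div 2 = N * (3 * N + 1) div 2"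
  proof -
    have "N * (3 * N + 1) = N*(N+1) + (N * N) * 2" by (simp add: algebra_simps)
    then show ?thesis by (metis div_mult_self1 zero_neq_numeral add.commute)
  qed
  \<comment> \<open>The relation \<open>P (s - 1) = P s * (1 - q^s)\<close> turns the difference of
    corresponding summands into a difference of consecutive values of \<open>A\<close>.\<close>
  have step: "(-1)^s * P s * q^(s*N + s*(s+1) div 2) * (1 - q^N) - (-1)^s * P s * q^(s*n + s*(s+1) div 2)
      = (if s = 0 then 0 else A (s-1)) - A s" for s
  proof (cases s)
    case 0
    then show ?thesis by (simp add: A_def P0 algebra_simps)
  next
    case (Suc r)
    have e1: "q^(s*n + s*(s+1) div 2) = q^((r+1)*N + r*(r+1) div 2)"
    proof -
      have "s*n + s*(s+1) div 2 = (r+1)*N + r*(r+1) div 2"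
        unfolding Suc tri N_def by (simp add: algebra_simps)
      then show ?thesis by simp
    qed
    have e2: "q^(s*N + s*(s+1) div 2) = q^((r+1)*N + r*(r+1) div 2) * q ^ Suc r"
    proof -
      have "s*N + s*(s+1) div 2 = (r+1)*N + r*(r+1) div 2 + Suc r"
        unfolding Suc tri by (simp add: algebra_simps)
      then show ?thesis by (simp only: power_add)
    qed
    have "q^((s+1)*N + s*(s+1) div 2) = q^(s*N + s*(s+1) div 2) * q ^ N"
      by (simp add: power_add[symmetric] algebra_simps)
    then have "A s = (-1)^s * P s * q^(s*N + s*(s+1) div 2) * q^N"
      by (simp add: A_def mult.assoc)
    moreover have "A r = (-1)^r * (P s * (1 - q ^ Suc r)) * q^((r+1)*N + r*(r+1) div 2)"
      unfolding A_def Suc PS ..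
    ultimately show ?thesis
      unfolding e1 e2 using Suc by (simp add: algebra_simps)
  qed
  have tele: "(\<Sum>s\<le>m. (if s = 0 then 0 else A (s-1)) - A s) = - A m" for m
    by (induction m) auto
  define b where "b = (\<lambda>s. (-1)^s * P s * q^(s*N + s*(s+1) div 2))"
  define c where "c = (\<lambda>s. (-1)^s * P s * q^(s*n + s*(s+1) div 2))"
  \<comment> \<open>The last summand \<open>b N\<close> has no partner in \<open>S n\<close>;
    together with the end \<open>- A n\<close> of the telescope it supplies the powers whose
    exponents are computed in \<open>pent1\<close> and \<open>pent2\<close>.\<close>
  have "S N = sum b {..n} + b N" unfolding S_def b_def N_def by (simp only: sum.atMost_Suc)
  moreover have "S n = sum c {..n}" unfolding S_def c_def ..
  ultimately have "S N * (1 - q^N) - S n = (\<Sum>s\<le>n. b s * (1 - q^N) - c s) + b N * (1 - q^N)"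
    by (simp add: distrib_right sum_distrib_right[symmetric] sum_subtractf)
  also have "\<dots> = - A n + (-1)^N * (P N * (1 - q^N)) * q^(N*N + N*(N+1) div 2)"
    unfolding b_def c_def step tele by (simp only: mult_ac)
  also have "P N * (1 - q^N) = P n" unfolding N_def by (rule PS)
  also have "- A n = (-1)^N * P n * q^(N*N + n*(n+1) div 2)"
    by (simp add: A_def N_def)
  finally have "S N * (1 - q^N) = S n + (-1)^N * (q^(N*(3*N-1) div 2) + q^(N*(3*N+1) div 2)) * P n"
    unfolding pent1 pent2 by (simp add: algebra_simps)
  also have "S n = pent_partial q n * P n" using Suc.IH by (simp add: S_def)
  also have "pent_partial q n * P n + (-1)^N * (q^(N*(3*N-1) div 2) + q^(N*(3*N+1) div 2)) * P n
      = pent_partial q N * P n"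
    by (simp add: pent_partial_def N_def algebra_simps)
  also have "P n = P N * (1 - q^N)" unfolding N_def by (rule PS[symmetric])
  finally have "S N * (1 - q^N) = pent_partial q N * P N * (1 - q^N)" by (simp add: mult.assoc)
  moreover have "1 - q^N \<noteq> 0" using nz[of n] by (simp add: N_def)
  ultimately have "S N = pent_partial q N * P N" by simp
  then show ?case by (simp add: S_def N_def)
qed

text \<open>Compare the coefficients of \<open>q^n\<close> in Shanks' identity of the same index
  \<open>n\<close>: on the left every summand with \<open>s > 0\<close> has order above
  \<open>n\<close>, and \<open>s = 0\<close> contributes the constant 1, whose coefficient is zero
  because \<open>n > 0\<close>.\<close>

lemma partition_pentagonal:
  assumes "n > 0"
  shows "int (partition_p n) = (\<Sum>s=1..n. (-1)^(s+1) *
     ((if s*(3* s-1) div 2 \<le> n then int (partition_p (n - s*(3* s-1) div 2)) else 0)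
      + (if s*(3* s+1) div 2 \<le> n then int (partition_p (n - s*(3* s+1) div 2)) else 0)))"
proof -
  define P :: "nat \<Rightarrow> int fps" where "P = (\<lambda>k. Abs_fps (\<lambda>n. int (partition_pb k n)))"
  have P0: "P 0 = 1"
    by (rule fps_ext) (simp add: P_def partition_pb_0)
  have PS: "P (Suc k) * (1 - fps_X ^ Suc k) = P k" for k
  proof (rule fps_ext)
    fix m
    have "fps_nth (P (Suc k) * (1 - fps_X ^ Suc k)) m = fps_nth (P (Suc k)) m
        - (if m < Suc k then 0 else fps_nth (P (Suc k)) (m - Suc k))"
      unfolding right_diff_distrib fps_sub_nth fps_X_power_mult_right_nth by simp
    also have "\<dots> = fps_nth (P k) m"
      using partition_pb_Suc[of k m] by (simp add: P_def)
    finally show "fps_nth (P (Suc k) * (1 - fps_X ^ Suc k)) m = fps_nth (P k) m" .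
  qed
  have nz: "(fps_X :: int fps) ^ Suc k \<noteq> 1" for k
  proof
    assume "(fps_X :: int fps) ^ Suc k = 1"
    then have "fps_nth ((fps_X :: int fps) ^ Suc k) 0 = fps_nth 1 0" by simp
    then show False by simp
  qed
  have "(\<Sum>s\<le>n. (-1)^s * P s * fps_X^(s*n + s*(s+1) div 2)) = pent_partial fps_X n * P n"
    by (rule shanks_identity[OF P0 PS nz])
  then have eq: "fps_nth (\<Sum>s\<le>n. (-1)^s * P s * fps_X^(s*n + s*(s+1) div 2)) n
      = fps_nth (pent_partial fps_X n * P n) n" by simp
  have sgn: "fps_nth ((-1)^s * f) m = (-1)^s * fps_nth f m" for s m and f :: "int fps"
    by (cases "even s") auto
  have "fps_nth (\<Sum>s\<le>n. (-1)^s * P s * fps_X^(s*n + s*(s+1) div 2)) n = 0"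
    unfolding fps_sum_nth
  proof (rule sum.neutral, rule ballI)
    fix s assume "s \<in> {..n}"
    show "fps_nth ((-1)^s * P s * fps_X^(s*n + s*(s+1) div 2)) n = 0"
    proof (cases s)
      case 0
      then show ?thesis using assms by (simp add: P0)
    next
      case (Suc r)
      have "2 \<le> s * (s+1)" by (simp add: Suc)
      then have "1 \<le> s * (s+1) div 2" by linarith
      moreover have "n \<le> s * n" by (simp add: Suc)
      ultimately have "n < s*n + s*(s+1) div 2" by linarith
      then show ?thesis unfolding fps_X_power_mult_right_nth by simp
    qed
  qed
  with eq have "0 = fps_nth (pent_partial fps_X n * P n) n" by simp
  also have "\<dots> = fps_nth (P n) n + (\<Sum>s=1..n. (-1)^s * (fps_nth (fps_X^(s*(3* s-1) div 2) * P n) n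
        + fps_nth (fps_X^(s*(3* s+1) div 2) * P n) n))"
    by (simp add: pent_partial_def distrib_right sum_distrib_right fps_sum_nth sgn mult.assoc)
  also have "fps_nth (P n) n = int (partition_p n)" by (simp add: P_def partition_pb_eq)
  also have "(\<Sum>s=1..n. (-1)^s * (fps_nth (fps_X^(s*(3 * s-1) div 2) * P n) n
        + fps_nth (fps_X^(s*(3 * s+1) div 2) * P n) n)) = - (\<Sum>s=1..n. (-1)^(s+1) *
     ((if s*(3 * s-1) div 2 \<le> n then int (partition_p (n - s*(3 * s-1) div 2)) else 0)
      + (if s*(3 * s+1) div 2 \<le> n then int (partition_p (n - s*(3 * s+1) div 2)) else 0)))"
    unfolding sum_negf[symmetric]
    by (intro sum.cong refl) (simp add: fps_X_power_mult_nth P_def partition_pb_eq not_less)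
  finally show ?thesis by simp
qed

section \<open>Euler products and the generating function for real arguments\<close>

definition euler_prod :: "real \<Rightarrow> nat \<Rightarrow> real" where
  "euler_prod q k = (\<Prod>j=1..k. 1 / (1 - q ^ j))"

lemma euler_prod_0 [simp]: "euler_prod q 0 = 1"
  by (simp add: euler_prod_def)

lemma euler_prod_Suc: "euler_prod q (Suc k) = euler_prod q k / (1 - q ^ Suc k)"
  by (simp add: euler_prod_def)

text \<open>Once convergence is known, the recurrence gives
  \<open>(1 - q ^ Suc k) * suminf a = suminf b\<close>. Convergence comes from the same recurrence
  on partial sums: \<open>sum a {..N}\<close> is at most the previous product plus
  \<open>q ^ Suc k\<close> times itself.\<close>

lemma partition_pb_sums:
  assumes q: "0 \<le> q" "q < 1"
  shows "(\<lambda>n. real (partition_pb k n) * q ^ n) sums euler_prod q k"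
proof (induction k)
  case 0
  have "(\<lambda>n. real (partition_pb 0 n) * q ^ n) = (\<lambda>n. if n = 0 then 1 else 0)"
    by (auto simp: partition_pb_0 fun_eq_iff)
  then show ?case using sums_single[of 0 "\<lambda>_. 1::real"] by simp
next
  case (Suc k)
  define a where "a = (\<lambda>n. real (partition_pb (Suc k) n) * q ^ n)"
  define b where "b = (\<lambda>n. real (partition_pb k n) * q ^ n)"
  have b: "b sums euler_prod q k" using Suc by (simp add: b_def)
  have qk: "q ^ Suc k < 1" using q power_Suc_less_one[of q k] by (cases "q = 0") auto
  have a0: "a n \<ge> 0" and b0: "b n \<ge> 0" for n using q by (simp_all add: a_def b_def)
  have rec: "a n = b n + (if Suc k \<le> n then q ^ Suc k * a (n - Suc k) else 0)" for n
  proof (cases "Suc k \<le> n")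
    case True
    then have "q ^ n = q ^ Suc k * q ^ (n - Suc k)" by (metis le_add_diff_inverse power_add)
    then show ?thesis using True partition_pb_Suc[of k n]
      by (simp add: a_def b_def algebra_simps del: power_Suc)
  qed (use partition_pb_Suc[of k n] in \<open>simp add: a_def b_def\<close>)
  have a_shift: "a (n + Suc k) = b (n + Suc k) + q ^ Suc k * a n" for n
    using rec[of "n + Suc k"] by simp
  have "summable a"
  proof (rule bounded_imp_summable[OF a0])
    fix N
    have "sum a {..N} = sum b {..N} + (\<Sum>n\<le>N. if Suc k \<le> n then q ^ Suc k * a (n - Suc k) else 0)"
      by (simp add: rec[of _] sum.distrib[symmetric])
    also have "(\<Sum>n\<le>N. if Suc k \<le> n then q ^ Suc k * a (n - Suc k) else 0)
        = (\<Sum>n\<in>{Suc k..N}. q ^ Suc k * a (n - Suc k))"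
      by (simp add: sum.If_cases Int_def atLeastAtMost_def atMost_def atLeast_def conj_commute del: power_Suc)
    also have "\<dots> \<le> (\<Sum>n\<le>N. q ^ Suc k * a n)"
    proof -
      have "(\<Sum>n\<in>{Suc k..N}. q ^ Suc k * a (n - Suc k)) = (\<Sum>n\<in>(\<lambda>n. n - Suc k) ` {Suc k..N}. q ^ Suc k * a n)"
        by (subst sum.reindex) (auto simp: inj_on_def)
      also have "\<dots> \<le> (\<Sum>n\<le>N. q ^ Suc k * a n)"
        by (rule sum_mono2) (use a0 q in auto)
      finally show ?thesis .
    qed
    also have "sum b {..N} \<le> euler_prod q k"
      using sum_le_suminf[of b "{..N}"] b b0 by (auto simp: sums_iff)
    finally have "sum a {..N} \<le> euler_prod q k + q ^ Suc k * sum a {..N}"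
      by (simp only: sum_distrib_left)
    then have "sum a {..N} * (1 - q ^ Suc k) \<le> euler_prod q k"
      by (simp add: algebra_simps del: power_Suc)
    then show "sum a {..N} \<le> euler_prod q k / (1 - q ^ Suc k)"
      using qk by (simp add: pos_le_divide_eq)
  qed
  have "suminf a = suminf b + q ^ Suc k * suminf a"
  proof -
    have "suminf a = (\<Sum>n. a (n + Suc k)) + sum a {..<Suc k}"
      by (rule suminf_split_initial_segment[OF \<open>summable a\<close>])
    also have "sum a {..<Suc k} = sum b {..<Suc k}"
      by (rule sum.cong) (auto simp: rec[of _])
    also have "(\<Sum>n. a (n + Suc k)) = (\<Sum>n. b (n + Suc k)) + (\<Sum>n. q ^ Suc k * a n)"
      unfolding a_shift by (rule suminf_add[symmetric])
        (rule summable_ignore_initial_segment summable_mult sums_summable[OF b] \<open>summable a\<close>)+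
    also have "(\<Sum>n. q ^ Suc k * a n) = q ^ Suc k * suminf a"
      by (rule suminf_mult[OF \<open>summable a\<close>])
    finally show ?thesis
      using suminf_split_initial_segment[OF sums_summable[OF b], of "Suc k"] by linarith
  qed
  then have "suminf a * (1 - q ^ Suc k) = euler_prod q k"
    using b by (simp add: sums_iff algebra_simps del: power_Suc)
  then have "suminf a = euler_prod q (Suc k)"
    using qk by (simp add: euler_prod_Suc field_simps del: power_Suc)
  with \<open>summable a\<close> show ?case by (simp add: sums_iff a_def)
qed

lemma euler_prod_pos:
  assumes "0 \<le> q" "q < 1" shows "euler_prod q k > 0"
proof -
  have "q ^ j < 1" if "j \<in> {1..k}" for j
    using assms that by (cases "q = 0") (auto intro: power_less_one_iff[THEN iffD2] simp: power_0_left)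
  then show ?thesis unfolding euler_prod_def by (intro prod_pos) auto
qed

text \<open>Take logarithms and expand them. Summing the geometric series over \<open>j\<close>
  first leaves at most \<open>1 / (m * (exp (m * s) - 1)) <= 1 / (m^2 * s)\<close> as the
  \<open>m\<close>-th term, and the sum over \<open>m\<close> is Euler's \<open>pi^2 / 6\<close>
  divided by \<open>s\<close>.\<close>

lemma euler_prod_le:
  assumes s: "s > 0"
  shows "euler_prod (exp (-s)) k \<le> exp (pi\<^sup>2 / (6 * s))"
proof -
  define q where "q = exp (-s)"
  have q: "0 < q" "q < 1" using s by (auto simp: q_def)
  have qj: "q ^ j < 1" if "j \<in> {1..k}" for j
    using q that by (auto intro: power_less_one_iff[THEN iffD2])
  have A: "(\<lambda>m. \<Sum>j=1..k. (q ^ j) ^ m / real m) sums (\<Sum>j=1..k. - ln (1 - q ^ j))"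
  proof (rule sums_sum)
    fix j assume j: "j \<in> {1..k}"
    have "(\<lambda>n. - ((- (- (q ^ j))) ^ n) / real n) sums ln (1 + (- (q ^ j)))"
      by (rule ln_series') (use qj[OF j] q in auto)
    from sums_minus[OF this] show "(\<lambda>m. (q ^ j) ^ m / real m) sums - ln (1 - q ^ j)" by simp
  qed
  have B: "(\<lambda>m. 1 / ((real m)\<^sup>2 * s)) sums (pi\<^sup>2 / (6 * s))"
  proof -
    have "(\<lambda>n. 1 / (real (Suc n))\<^sup>2) sums (pi\<^sup>2 / 6)"
      using inverse_squares_sums by (simp add: add.commute)
    then have "(\<lambda>n. 1 / (real n)\<^sup>2) sums (pi\<^sup>2 / 6)"
      by (subst (asm) sums_Suc_iff) simp
    from sums_divide[OF this, of s] show ?thesis by simp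
  qed
  have C: "(\<Sum>j=1..k. (q ^ j) ^ m / real m) \<le> 1 / ((real m)\<^sup>2 * s)" for m
  proof (cases "m = 0")
    case False
    define y where "y = real m * s"
    have y: "y > 0" using False s by (simp add: y_def)
    have x: "q ^ m = exp (-y)" by (simp add: q_def y_def exp_of_nat_mult[symmetric])
    have x01: "0 < exp (-y)" "exp (-y) < 1" using y by auto
    have "(\<Sum>j=1..k. (q ^ j) ^ m) = (\<Sum>j=1..k. exp (-y) ^ j)"
      by (simp add: power_mult[symmetric] mult.commute[of _ m] x[symmetric])
    also have "\<dots> = (exp (-y) - exp (-y) ^ Suc k) / (1 - exp (-y))"
    proof -
      have "(\<Sum>j=1..k. r ^ j) * (1 - r) = r - r ^ Suc k" for r :: real
      proof (induction k)
        case (Suc k)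
        have "(\<Sum>j=1..Suc k. r ^ j) * (1 - r) = (\<Sum>j=1..k. r ^ j) * (1 - r) + r ^ Suc k * (1 - r)"
          by (simp add: distrib_right)
        also have "\<dots> = r - r ^ Suc (Suc k)" unfolding Suc by (simp add: algebra_simps)
        finally show ?case .
      qed simp
      then show ?thesis using x01 by (simp add: eq_divide_eq del: power_Suc)
    qed
    also have "\<dots> \<le> exp (-y) / (1 - exp (-y))"
      using x01 by (intro divide_right_mono) auto
    also have "\<dots> \<le> 1 / y"
    proof -
      have "exp (-y) * (1 + y) \<le> exp (-y) * exp y"
        using exp_ge_add_one_self[of y] by (intro mult_left_mono) auto
      then show ?thesis using x01 y by (simp add: field_simps exp_minus_inverse)
    qed
    finally have "(\<Sum>j=1..k. (q ^ j) ^ m) / real m \<le> 1 / y / real m"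
      using False by (intro divide_right_mono) auto
    then show ?thesis by (simp add: sum_divide_distrib[symmetric] y_def power2_eq_square mult_ac)
  qed simp
  have "(\<Sum>j=1..k. - ln (1 - q ^ j)) \<le> pi\<^sup>2 / (6 * s)"
    by (rule sums_le[OF C A B])
  then have "exp (\<Sum>j=1..k. - ln (1 - q ^ j)) \<le> exp (pi\<^sup>2 / (6 * s))" by simp
  also have "exp (\<Sum>j=1..k. - ln (1 - q ^ j)) = euler_prod q k"
    unfolding euler_prod_def exp_sum[OF finite_atLeastAtMost]
    by (intro prod.cong) (use qj in \<open>auto simp: exp_minus field_simps\<close>)
  finally show ?thesis by (simp add: q_def)
qed

definition partition_gf :: "real \<Rightarrow> real" where
  "partition_gf q = (\<Sum>n. real (partition_p n) * q ^ n)"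

lemma partition_partial_sum_le:
  assumes "s > 0"
  shows "(\<Sum>n\<le>N. real (partition_p n) * exp (-s) ^ n) \<le> euler_prod (exp (-s)) N"
proof -
  have "(\<Sum>n\<le>N. real (partition_p n) * exp (-s) ^ n) = (\<Sum>n\<le>N. real (partition_pb N n) * exp (-s) ^ n)"
    by (intro sum.cong) (auto simp: partition_pb_eq)
  also have "\<dots> \<le> euler_prod (exp (-s)) N"
    using partition_pb_sums[of "exp (-s)" N] assms
    by (intro sum_le_suminf[THEN order_trans]) (auto simp: sums_iff)
  finally show ?thesis .
qed

lemma summable_partition_exp:
  assumes "s > 0"
  shows "summable (\<lambda>n. real (partition_p n) * exp (-s) ^ n)"
  by (rule bounded_imp_summable[OF _ order_trans[OF partition_partial_sum_le[OF assms] euler_prod_le[OF assms]]])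
     auto

lemma partition_gf_le:
  assumes "s > 0"
  shows "partition_gf (exp (-s)) \<le> exp (pi\<^sup>2 / (6 * s))"
  unfolding partition_gf_def
  by (rule LIMSEQ_le_const2[OF summable_LIMSEQ'[OF summable_partition_exp[OF assms]]])
     (use order_trans[OF partition_partial_sum_le[OF assms] euler_prod_le[OF assms]] in blast)

lemma euler_prod_le_gf:
  assumes "s > 0"
  shows "euler_prod (exp (-s)) k \<le> partition_gf (exp (-s))"
proof -
  have "euler_prod (exp (-s)) k = (\<Sum>n. real (partition_pb k n) * exp (-s) ^ n)"
    using partition_pb_sums[of "exp (-s)" k] assms by (simp add: sums_iff)
  also have "\<dots> \<le> partition_gf (exp (-s))"
    unfolding partition_gf_def
    using partition_pb_sums[of "exp (-s)" k] assms summable_partition_exp[OF assms]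
    by (intro suminf_le) (auto simp: sums_iff partition_pb_le intro!: mult_right_mono)
  finally show ?thesis .
qed

text \<open>A squeeze: the product over \<open>j <= N\<close> lies between the partial sum up to
  \<open>N\<close>, whose partitions have no part above \<open>N\<close> anyway, and the full
  sum.\<close>

lemma euler_prod_tendsto:
  assumes "s > 0"
  shows "euler_prod (exp (-s)) \<longlonglongrightarrow> partition_gf (exp (-s))"
proof (rule tendsto_sandwich)
  show "(\<lambda>N. \<Sum>n\<le>N. real (partition_p n) * exp (-s) ^ n) \<longlonglongrightarrow> partition_gf (exp (-s))"
    using summable_LIMSEQ'[OF summable_partition_exp[OF assms]] by (simp add: partition_gf_def)
qed (use partition_partial_sum_le[OF assms] euler_prod_le_gf[OF assms] in auto)

lemma partition_gf_ge_1:
  assumes "s > 0" shows "partition_gf (exp (-s)) \<ge> 1"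
  using euler_prod_le_gf[OF assms, of 0] by simp

text \<open>In Shanks' identity for real \<open>q\<close> each of the \<open>n\<close> summands of
  positive index carries at least the factor \<open>q^n\<close>, so the left side differs from 1 by
  at most \<open>G * (n * q^n)\<close>, which tends to 0.\<close>

lemma pent_partial_tendsto:
  assumes s: "s > 0"
  shows "pent_partial (exp (-s)) \<longlonglongrightarrow> 1 / partition_gf (exp (-s))"
proof -
  define q where "q = exp (-s)"
  have q: "0 < q" "q < 1" using s by (auto simp: q_def)
  have qk: "q ^ Suc k < 1" for k using q by (intro power_Suc_less_one) auto
  define G where "G = partition_gf q"
  have G: "G \<ge> 1" unfolding G_def q_def by (rule partition_gf_ge_1[OF s])
  have id: "(\<Sum>r\<le>n. (-1)^r * euler_prod q r * q^(r*n + r*(r+1) div 2)) = pent_partial q n * euler_prod q n" for n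
  proof (rule shanks_identity)
    fix k show "euler_prod q (Suc k) * (1 - q ^ Suc k) = euler_prod q k" "q ^ Suc k \<noteq> 1"
      using qk[of k] by (simp_all add: euler_prod_Suc del: power_Suc)
  qed simp
  have bound: "\<bar>pent_partial q n * euler_prod q n - 1\<bar> \<le> G * (real n * q ^ n)" for n
  proof -
    define c where "c = (\<lambda>r. (-1)^r * euler_prod q r * q^(r*n + r*(r+1) div 2))"
    have "pent_partial q n * euler_prod q n = sum c {..n}" using id by (simp only: c_def)
    also have "\<dots> = 1 + sum c {1..n}"
      by (simp add: sum.atMost_shift sum.atLeast1_atMost_eq c_def lessThan_Suc_atMost atMost_atLeast0
           sum.atLeast_Suc_atMost)
    finally have "\<bar>pent_partial q n * euler_prod q n - 1\<bar> = \<bar>sum c {1..n}\<bar>" by simp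
    also have "\<dots> \<le> (\<Sum>r=1..n. \<bar>c r\<bar>)" by (rule sum_abs)
    also have "\<dots> \<le> (\<Sum>r=1..n. G * q ^ n)"
    proof (rule sum_mono)
      fix r assume r: "r \<in> {1..n}"
      then have "n \<le> r*n + r*(r+1) div 2" by (cases r) auto
      then have "q^(r*n + r*(r+1) div 2) \<le> q ^ n" using q by (intro power_decreasing) auto
      moreover have "0 < euler_prod q r" "euler_prod q r \<le> G"
        using q euler_prod_pos[of q r] euler_prod_le_gf[OF s, of r] by (auto simp: G_def q_def)
      ultimately have "euler_prod q r * q^(r*n + r*(r+1) div 2) \<le> G * q ^ n"
        using q by (intro mult_mono) auto
      then show "\<bar>c r\<bar> \<le> G * q ^ n"
        using q \<open>0 < euler_prod q r\<close> by (simp add: c_def abs_mult power_abs)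
    qed
    also have "\<dots> = G * (real n * q ^ n)" by simp
    finally show ?thesis .
  qed
  have "(\<lambda>n. G * (real n * q ^ n)) \<longlonglongrightarrow> G * 0"
    by (intro tendsto_intros powser_times_n_limit_0) (use q in auto)
  then have lim0: "(\<lambda>n. G * (real n * q ^ n)) \<longlonglongrightarrow> 0" by simp
  have "(\<lambda>n. pent_partial q n * euler_prod q n - 1) \<longlonglongrightarrow> 0"
    by (rule Lim_null_comparison[OF always_eventually lim0]) (simp only: bound real_norm_def simp_thms)
  then have "(\<lambda>n. pent_partial q n * euler_prod q n) \<longlonglongrightarrow> 1"
    by (rule LIM_zero_cancel)
  moreover have "euler_prod q \<longlonglongrightarrow> G" unfolding G_def q_def by (rule euler_prod_tendsto[OF s])
  ultimately have "(\<lambda>n. pent_partial q n * euler_prod q n / euler_prod q n) \<longlonglongrightarrow> 1 / G"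
    using G by (intro tendsto_divide) auto
  then show ?thesis
    using euler_prod_pos[of q] q by (simp add: G_def q_def less_imp_neq[THEN not_sym])
qed

section \<open>A theta function transformation\<close>

text \<open>The even primitive character modulo 12. It encodes the signs of the pentagonal series:
  for \<open>g = s * (3 * s - 1) div 2\<close> and \<open>g = s * (3 * s + 1) div 2\<close> the
  number \<open>24 * g + 1\<close> is the square of \<open>6 * s - 1\<close> and of
  \<open>6 * s + 1\<close>, and at both of these the character equals \<open>(-1)^s\<close>.\<close>

definition chi12 :: "nat \<Rightarrow> real" where
  "chi12 n = (if n mod 12 \<in> {1, 11} then 1 else if n mod 12 \<in> {5, 7} then -1 else 0)"

lemma chi12_simps [simp]:
  "chi12 0 = 0" "chi12 (12 * l + c) = chi12 c" "chi12 (c + 12 * l) = chi12 c" "chi12 (6 * m) = 0"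
proof -
  have "(6 * m) mod 12 = 6 * (m mod 2)" using mult_mod_right[of 6 m 2] by simp
  moreover have "m mod 2 = 0 \<or> m mod 2 = 1" by auto
  ultimately show "chi12 (6 * m) = 0" by (auto simp: chi12_def)
qed (simp_all add: chi12_def)

lemma abs_chi12_le: "\<bar>chi12 n\<bar> \<le> 1"
  by (simp add: chi12_def)

lemma chi12_symmetric:
  assumes "k \<le> 12 * m" shows "chi12 (12 * m - k) = chi12 k"
proof -
  have "(12 * m - k + k) mod 12 = 0" using assms by simp
  then have *: "((12 * m - k) mod 12 + k mod 12) mod 12 = 0" by (simp only: mod_add_eq)
  define a b where "a = (12 * m - k) mod 12" and "b = k mod 12"
  have ab: "a < 12" "b < 12" by (simp_all add: a_def b_def)
  from * obtain c where c: "a + b = 12 * c" unfolding a_def b_def by (metis mod_0_imp_dvd dvdE)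
  with ab have "c = 0 \<or> c = 1" by linarith
  with c have "a = 0 \<and> b = 0 \<or> a + b = 12" by auto
  then show ?thesis unfolding chi12_def a_def[symmetric] b_def[symmetric] by auto
qed

lemma cos_sin_2pi_nat: "cos (2 * pi * real j) = 1" "sin (2 * pi * real j) = 0"
  using cos_2npi[of j] sin_2npi[of j] by (simp_all only: mult_ac)

text \<open>Closed form of the Gauss sum of \<open>chi12\<close>: the left side is the sum of
  \<open>chi12 c * cos (pi * c * j / 6)\<close> over a period of \<open>c\<close>. It has period 12
  in \<open>j\<close>, and one of the sines vanishes when 2 or 3 divides \<open>j\<close>, which
  leaves the residues 1, 5, 7 and 11.\<close>

lemma sin_sin_chi12: "4 * sin (pi * real j / 2) * sin (pi * real j / 3) = sqrt 12 * chi12 j"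
proof -
  define a b where "a = j div 12" and "b = j mod 12"
  have j: "real j = 12 * real a + real b"
    unfolding a_def b_def by (metis mult_div_mod_eq of_nat_add of_nat_mult of_nat_numeral)
  have per: "sin (y + real k * (2 * pi)) = sin y" for y :: real and k
  proof (induction k)
    case (Suc k)
    have "sin (y + real (Suc k) * (2 * pi)) = sin ((y + real k * (2 * pi)) + 2 * pi)"
      by (rule arg_cong[of _ _ sin]) (simp add: algebra_simps)
    then show ?case by (simp only: sin_periodic Suc)
  qed simp
  have "pi * real j / 2 = pi * real b / 2 + real (3 * a) * (2 * pi)"
       "pi * real j / 3 = pi * real b / 3 + real (2 * a) * (2 * pi)"
    by (simp_all add: j field_simps)
  then have s: "sin (pi * real j / 2) = sin (pi * real b / 2)"
    "sin (pi * real j / 3) = sin (pi * real b / 3)"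
    by (simp_all only: per)
  have q: "sqrt 12 = 2 * sqrt 3" by (simp add: real_sqrt_mult[of 4 3, simplified])
  have s2: "sin (pi * real (2 * c) / 2) = 0" for c :: nat by (simp add: mult.commute)
  have s3: "sin (pi * real (3 * c) / 3) = 0" for c :: nat by (simp add: mult.commute)
  have c: "chi12 j = chi12 b" by (simp add: chi12_def b_def)
  have b1: "sin (pi / 2) = 1" "sin (pi / 3) = sqrt 3 / 2" by (simp_all add: sin_60)
  have b5: "sin (pi * 5 / 2) = 1" "sin (pi * 5 / 3) = - (sqrt 3 / 2)"
  proof -
    have "sin (pi * 5 / 2) = sin (pi / 2 + 2 * pi)" by (rule arg_cong[of _ _ sin]) (simp add: field_simps)
    then show "sin (pi * 5 / 2) = 1" by (simp only: sin_periodic b1)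
    have "sin (pi * 5 / 3) = sin (- (pi / 3) + 2 * pi)" by (rule arg_cong[of _ _ sin]) (simp add: field_simps)
    then show "sin (pi * 5 / 3) = - (sqrt 3 / 2)" by (simp only: sin_periodic sin_minus b1)
  qed
  have b7: "sin (pi * 7 / 2) = - 1" "sin (pi * 7 / 3) = sqrt 3 / 2"
  proof -
    have "sin (pi * 7 / 2) = sin ((- (pi / 2) + 2 * pi) + 2 * pi)" by (rule arg_cong[of _ _ sin]) (simp add: field_simps)
    then show "sin (pi * 7 / 2) = - 1" by (simp only: sin_periodic sin_minus b1)
    have "sin (pi * 7 / 3) = sin (pi / 3 + 2 * pi)" by (rule arg_cong[of _ _ sin]) (simp add: field_simps)
    then show "sin (pi * 7 / 3) = sqrt 3 / 2" by (simp only: sin_periodic b1)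
  qed
  have b11: "sin (pi * 11 / 2) = - 1" "sin (pi * 11 / 3) = - (sqrt 3 / 2)"
  proof -
    have "sin (pi * 11 / 2) = sin (((- (pi / 2) + 2 * pi) + 2 * pi) + 2 * pi)" by (rule arg_cong[of _ _ sin]) (simp add: field_simps)
    then show "sin (pi * 11 / 2) = - 1" by (simp only: sin_periodic sin_minus b1)
    have "sin (pi * 11 / 3) = sin ((- (pi / 3) + 2 * pi) + 2 * pi)" by (rule arg_cong[of _ _ sin]) (simp add: field_simps)
    then show "sin (pi * 11 / 3) = - (sqrt 3 / 2)" by (simp only: sin_periodic sin_minus b1)
  qed
  have v: "chi12 (Suc 0) = 1" "chi12 5 = -1" "chi12 7 = -1" "chi12 11 = 1" by (simp_all add: chi12_def)
  have "b < 12" by (simp add: b_def)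
  then have "2 dvd b \<or> 3 dvd b \<or> b = 1 \<or> b = 5 \<or> b = 7 \<or> b = 11" by presburger
  then consider "2 dvd b" | "3 dvd b" | "b = 1" | "b = 5" | "b = 7" | "b = 11" by blast
  then show ?thesis
  proof cases
    case 1
    then obtain c where "b = 2 * c" by blast
    moreover have "chi12 (2 * c) = 0" unfolding chi12_def by (auto; presburger)
    ultimately show ?thesis by (simp only: s c s2)
  next
    case 2
    then obtain c where "b = 3 * c" by blast
    moreover have "chi12 (3 * c) = 0" unfolding chi12_def by (auto; presburger)
    ultimately show ?thesis by (simp only: s c s3)
  qed (simp_all add: s c v q b1 b5 b7 b11)
qed

text \<open>A root-of-unity filter. Writing \<open>k = 12 * l + c\<close> splits off the geometric
  sum of the \<open>w^l\<close>, where \<open>w\<close> is an \<open>m\<close>-th root of unity that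
  equals 1 exactly when \<open>m\<close> divides \<open>r\<close>; in that case the ordinary Gauss
  sum at \<open>r div m\<close> remains.\<close>

lemma chi12_gauss_sum:
  assumes m: "m > 0"
  shows "(\<Sum>k<12*m. chi12 k * cos (pi * real k * real r / (6 * real m)))
       = (if m dvd r then real m * sqrt 12 * chi12 (r div m) else 0)"
proof -
  define z where "z = cis (pi * real r / (6 * real m))"
  define w where "w = z ^ 12"
  have zk: "z ^ k = cis (pi * real k * real r / (6 * real m))" for k
    by (simp add: z_def Complex.DeMoivre mult_ac)
  have wm: "w ^ m = 1"
  proof -
    have "w ^ m = z ^ (12 * m)" by (simp add: w_def power_mult)
    also have "\<dots> = cis (2 * pi * real r)"
      unfolding zk using m by (intro arg_cong[of _ _ cis]) (simp add: field_simps)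
    also have "\<dots> = 1" by (simp add: complex_eq_iff cos_sin_2pi_nat)
    finally show ?thesis .
  qed
  have "(\<Sum>k<12*m. of_real (chi12 k) * z ^ k)
      = (\<Sum>l<m. \<Sum>k\<in>{l*12..<l*12+12}. of_real (chi12 k) * z ^ k)"
    by (simp add: sum.nat_group mult.commute)
  also have "\<dots> = (\<Sum>l<m. \<Sum>c<12. of_real (chi12 c) * z ^ (12 * l + c))"
  proof (rule sum.cong[OF refl])
    fix l
    have "(\<Sum>k\<in>{l*12..<l*12+12}. of_real (chi12 k) * z ^ k)
       = (\<Sum>k\<in>{0+l*12..<12+l*12}. of_real (chi12 k) * z ^ k)" by (simp add: add.commute)
    also have "\<dots> = (\<Sum>c\<in>{0..<12}. of_real (chi12 (c + l * 12)) * z ^ (c + l * 12))"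
      by (rule sum.shift_bounds_nat_ivl)
    also have "\<dots> = (\<Sum>c<12. of_real (chi12 c) * z ^ (12 * l + c))"
      by (rule sum.cong) (auto simp: add.commute mult.commute[of _ 12])
    finally show "(\<Sum>k\<in>{l*12..<l*12+12}. of_real (chi12 k) * z ^ k)
       = (\<Sum>c<12. of_real (chi12 c) * z ^ (12 * l + c))" .
  qed
  also have "\<dots> = (\<Sum>l<m. w ^ l) * (\<Sum>c<12. of_real (chi12 c) * z ^ c)"
  proof -
    have "z ^ (12 * l + c) = w ^ l * z ^ c" for l c by (simp only: power_add power_mult w_def)
    then show ?thesis unfolding sum_product by (intro sum.cong refl) (simp add: mult_ac)
  qed
  also have "(\<Sum>c<12. of_real (chi12 c) * z ^ c) = z - z ^ 5 - z ^ 7 + z ^ 11"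
  proof -
    have "sum g {..<12} = g 0 + g 1 + g 2 + g 3 + g 4 + g 5 + g 6 + g 7 + g 8 + g 9 + g 10 + g 11"
      for g :: "nat \<Rightarrow> complex" by (simp add: eval_nat_numeral)
    moreover have "chi12 0 = 0" "chi12 1 = 1" "chi12 2 = 0" "chi12 3 = 0" "chi12 4 = 0" "chi12 5 = -1"
      "chi12 6 = 0" "chi12 7 = -1" "chi12 8 = 0" "chi12 9 = 0" "chi12 10 = 0" "chi12 11 = 1"
      by (simp_all add: chi12_def)
    ultimately show ?thesis by (simp only: of_real_0 of_real_1 of_real_minus) simp
  qed
  finally have eq: "(\<Sum>k<12*m. of_real (chi12 k) * z ^ k) = (\<Sum>l<m. w ^ l) * (z - z ^ 5 - z ^ 7 + z ^ 11)" .
  have "(\<Sum>k<12*m. chi12 k * cos (pi * real k * real r / (6 * real m)))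
      = Re (\<Sum>k<12*m. of_real (chi12 k) * z ^ k)"
    by (simp add: zk)
  also have "\<dots> = Re ((\<Sum>l<m. w ^ l) * (z - z ^ 5 - z ^ 7 + z ^ 11))" by (simp only: eq)
  also have "\<dots> = (if m dvd r then real m * sqrt 12 * chi12 (r div m) else 0)"
  proof (cases "m dvd r")
    case True
    then obtain j where r: "r = m * j" by blast
    have zj: "z ^ k = cis (pi * real k * real j / 6)" for k
      unfolding zk r using m by (simp add: mult.assoc)
    have "w = cis (2 * pi * real j)" unfolding w_def zj by (intro arg_cong[of _ _ cis]) simp
    then have "w = 1" by (simp add: complex_eq_iff cos_sin_2pi_nat)
    then have s: "(\<Sum>l<m. w ^ l) = of_nat m" by simp
    define x where "x = pi * real j / 6"
    have "Re (z - z ^ 5 - z ^ 7 + z ^ 11) = cos x - cos (5 * x) - cos (7 * x) + cos (11 * x)"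
      using zj[of 1] zj[of 5] zj[of 7] zj[of 11] by (simp add: x_def mult_ac)
    also have "cos (7 * x) = cos (5 * x)"
    proof -
      have "7 * x = - (5 * x) + 2 * pi * real j" by (simp add: x_def field_simps)
      then have "cos (7 * x) = cos (- (5 * x) + 2 * pi * real j)" by (rule arg_cong)
      also have "\<dots> = cos (5 * x)" unfolding cos_add by (simp add: cos_sin_2pi_nat)
      finally show ?thesis .
    qed
    also have "cos (11 * x) = cos x"
    proof -
      have "11 * x = - x + 2 * pi * real j" by (simp add: x_def field_simps)
      then have "cos (11 * x) = cos (- x + 2 * pi * real j)" by (rule arg_cong)
      also have "\<dots> = cos x" unfolding cos_add by (simp add: cos_sin_2pi_nat)
      finally show ?thesis .
    qed
    also have "cos x - cos (5 * x) - cos (5 * x) + cos x = 4 * sin (3 * x) * sin (2 * x)"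
    proof -
      have "cos (3 * x - 2 * x) - cos (3 * x + 2 * x) = 2 * (sin (3 * x) * sin (2 * x))"
        unfolding cos_add cos_diff by simp
      then show ?thesis by simp
    qed
    also have "3 * x = pi * real j / 2" by (simp add: x_def)
    also have "2 * x = pi * real j / 3" by (simp add: x_def)
    also note sin_sin_chi12
    finally show ?thesis using True m by (simp add: s r)
  next
    case False
    have "w \<noteq> 1"
    proof
      assume "w = 1"
      moreover have "w = cis (2 * pi * real r / real m)"
        unfolding w_def zk by (intro arg_cong[of _ _ cis]) simp
      ultimately have "cos (2 * pi * real r / real m) = 1" by (simp add: complex_eq_iff cos_sin_2pi_nat)
      then obtain i :: int where "2 * pi * real r / real m = i * 2 * pi" using cos_one_2pi_int by auto
      then have "2 * pi * real r = 2 * pi * (real m * of_int i)" using m by (simp add: field_simps)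
      then have "real r = real m * of_int i" by simp
      then have "int r = int m * i" by (metis of_int_eq_iff of_int_mult of_int_of_nat_eq)
      then have "int m dvd int r" by simp
      then show False using False by simp
    qed
    then have "(\<Sum>l<m. w ^ l) = 0" using wm by (simp add: sum_gp_strict)
    then show ?thesis using False by simp
  qed
  finally show ?thesis .
qed

text \<open>Binomial expansion of \<open>(cis x + cis (- x)) ^ (2 * n)\<close>, with the terms
  symmetric about the middle one paired.\<close>

lemma two_cos_power:
  "(2 * cos x) ^ (2 * n) = real (2 * n choose n) + 2 * (\<Sum>r=1..n. real (2 * n choose (n + r)) * cos (2 * x * real r))"
proof -
  define f where "f = (\<lambda>i. real (2 * n choose i) * cos (2 * x * (real i - real n)))"
  have "of_real ((2 * cos x) ^ (2 * n)) = (cis x + cis (- x)) ^ (2 * n)"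
    by (simp add: complex_eq_iff flip: of_real_power)
       (simp add: cis.ctr complex_eq_iff)?
  also have "\<dots> = (\<Sum>i\<le>2*n. of_nat (2 * n choose i) * cis x ^ i * cis (- x) ^ (2 * n - i))"
    by (rule binomial_ring)
  finally have "(2 * cos x) ^ (2 * n) = Re (\<Sum>i\<le>2*n. of_nat (2 * n choose i) * cis x ^ i * cis (- x) ^ (2 * n - i))"
    by (metis Re_complex_of_real)
  also have "\<dots> = (\<Sum>i\<le>2*n. f i)"
    unfolding Re_sum
  proof (rule sum.cong[OF refl])
    fix i assume "i \<in> {..2*n}"
    then have "cis x ^ i * cis (- x) ^ (2 * n - i) = cis (2 * x * (real i - real n))"
      unfolding Complex.DeMoivre cis_mult by (intro arg_cong[of _ _ cis]) (simp add: of_nat_diff algebra_simps)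
    then have E: "of_nat (2 * n choose i) * cis x ^ i * cis (- x) ^ (2 * n - i)
        = of_real (real (2 * n choose i)) * cis (2 * x * (real i - real n))" by (simp add: mult.assoc)
    show "Re (of_nat (2 * n choose i) * cis x ^ i * cis (- x) ^ (2 * n - i)) = f i"
      unfolding E by (simp add: f_def)
  qed
  also have "{..2*n} = {..<n} \<union> ({n} \<union> {n<..2*n})" by auto
  also have "(\<Sum>i\<in>{..<n} \<union> ({n} \<union> {n<..2*n}). f i) = sum f {..<n} + (f n + sum f {n<..2*n})"
    by (subst sum.union_disjoint; auto)+
  also have "sum f {n<..2*n} = (\<Sum>r=1..n. real (2 * n choose (n + r)) * cos (2 * x * real r))"
    by (rule sum.reindex_bij_witness[of _ "\<lambda>r. n + r" "\<lambda>i. i - n"]) (auto simp: f_def of_nat_diff)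
  also have "sum f {..<n} = (\<Sum>r=1..n. real (2 * n choose (n + r)) * cos (2 * x * real r))"
  proof (rule sum.reindex_bij_witness[of _ "\<lambda>r. n - r" "\<lambda>i. n - i"])
    fix i assume i: "i \<in> {..<n}"
    then have "2 * n choose (n + (n - i)) = 2 * n choose i"
      using binomial_symmetric[of i "2 * n"] by (simp add: mult_2)
    moreover have "2 * x * real (n - i) = - (2 * x * (real i - real n))"
      using i by (simp add: of_nat_diff algebra_simps)
    then have "cos (2 * x * real (n - i)) = cos (2 * x * (real i - real n))" by (simp only: cos_minus)
    ultimately show "real (2 * n choose (n + (n - i))) * cos (2 * x * real (n - i)) = f i"
      by (simp only: f_def)
  qed auto
  also have "f n = real (2 * n choose n)" by (simp add: f_def)
  finally show ?thesis by simp
qed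

text \<open>A finite precursor of the theta transformation: among the cosines of
  \<open>two_cos_power\<close> the Gauss sum keeps only the frequencies \<open>r = m * j\<close> and
  attaches the character to them again. The sum over \<open>12 * m\<close> points is twice the one
  over \<open>6 * m\<close> points, by the reflection that takes \<open>k\<close> to
  \<open>12 * m - k\<close>.\<close>

lemma chi12_cos_power_sum:
  assumes m: "m > 0"
  shows "(\<Sum>k<6*m. chi12 k * cos (pi * real k / (12 * real m)) ^ (2 * n))
       = real m * sqrt 12 / 4 ^ n * (\<Sum>j. chi12 j * real (2 * n choose (n + m * j)))"
proof -
  define F where "F = (\<lambda>k. chi12 k * (2 * cos (pi * real k / (12 * real m))) ^ (2 * n))"
  have F0: "F 0 = 0" "F (6 * m) = 0" by (simp_all add: F_def)
  \<comment> \<open>The cosine changes sign under the reflection, which the even exponent hides, and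
    \<open>chi12\<close> is even.\<close>
  have sym: "F (12 * m - k) = F k" if "k \<le> 12 * m" for k
  proof -
    have "pi * real (12 * m - k) / (12 * real m) = pi - pi * real k / (12 * real m)"
      using that m by (simp add: of_nat_diff field_simps)
    then have "cos (pi * real (12 * m - k) / (12 * real m)) = - cos (pi * real k / (12 * real m))"
      by (simp only: cos_pi_minus)
    then show ?thesis using chi12_symmetric[OF that] by (simp add: F_def)
  qed
  have "sum F {..<12*m} = sum F ({..<6*m} \<union> ({6*m} \<union> {6*m<..<12*m}))"
    by (rule arg_cong[of _ _ "sum F"]) (use m in auto)
  also have "\<dots> = sum F {..<6*m} + sum F {6*m<..<12*m}"
    by (subst sum.union_disjoint; auto simp: F0)+
  also have "sum F {6*m<..<12*m} = sum F {0<..<6*m}"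
    by (rule sum.reindex_bij_witness[of _ "\<lambda>k. 12*m - k" "\<lambda>k. 12*m - k"]) (use m in \<open>auto simp: sym\<close>)
  also have "\<dots> = sum F {..<6*m}"
    by (rule sum.mono_neutral_left) (auto simp: F0)
  finally have 1: "sum F {..<12*m} = 2 * sum F {..<6*m}" by simp
  have G: "(\<Sum>k<12*m. chi12 k * cos (2 * (pi * real k / (12 * real m)) * real r))
      = (if m dvd r then real m * sqrt 12 * chi12 (r div m) else 0)" for r
    unfolding chi12_gauss_sum[OF m, symmetric]
    by (intro sum.cong refl arg_cong[of _ _ "(*) _"] arg_cong[of _ _ cos]) (simp add: field_simps)
  have G0: "(\<Sum>k<12*m. chi12 k) = 0" using G[of 0] by simp
  have "sum F {..<12*m} = (\<Sum>k<12*m. chi12 k * real (2 * n choose n)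
     + 2 * (\<Sum>r=1..n. real (2 * n choose (n + r)) * (chi12 k * cos (2 * (pi * real k / (12 * real m)) * real r))))"
    unfolding F_def two_cos_power
    by (intro sum.cong refl) (simp add: distrib_left sum_distrib_left mult_ac)
  also have "\<dots> = (\<Sum>k<12*m. chi12 k) * real (2 * n choose n)
     + 2 * (\<Sum>r=1..n. real (2 * n choose (n + r)) *
         (\<Sum>k<12*m. chi12 k * cos (2 * (pi * real k / (12 * real m)) * real r)))"
    unfolding sum.distrib sum_distrib_right[symmetric] sum_distrib_left[symmetric]
    by (subst sum.swap) (simp only: sum_distrib_left)
  also have "\<dots> = 2 * (\<Sum>r=1..n. if m dvd r then real (2 * n choose (n + r)) * (real m * sqrt 12 * chi12 (r div m)) else 0)"
    unfolding G G0 by (simp add: if_distrib cong: if_cong)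
  also have "(\<Sum>r=1..n. if m dvd r then real (2 * n choose (n + r)) * (real m * sqrt 12 * chi12 (r div m)) else 0)
      = (\<Sum>r\<in>{r\<in>{1..n}. m dvd r}. real (2 * n choose (n + r)) * (real m * sqrt 12 * chi12 (r div m)))"
    by (rule sum.inter_filter[symmetric]) simp
  also have "\<dots> = (\<Sum>j\<in>{1..n div m}. real (2 * n choose (n + m * j)) * (real m * sqrt 12 * chi12 j))"
    by (rule sum.reindex_bij_witness[of _ "\<lambda>j. m * j" "\<lambda>r. r div m"])
       (use m in \<open>auto simp: div_le_mono less_eq_div_iff_mult_less_eq mult.commute Suc_le_eq dvd_def\<close>)
  also have "\<dots> = real m * sqrt 12 * (\<Sum>j\<in>{1..n div m}. chi12 j * real (2 * n choose (n + m * j)))"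
    by (simp add: sum_distrib_left mult_ac)
  also have "(\<Sum>j\<in>{1..n div m}. chi12 j * real (2 * n choose (n + m * j)))
      = (\<Sum>j. chi12 j * real (2 * n choose (n + m * j)))"
  proof (rule suminf_finite[symmetric])
    fix j assume "j \<notin> {1..n div m}"
    then have "j = 0 \<or> n < m * j"
      using m by (auto simp: not_le Suc_le_eq div_less_iff_less_mult mult.commute)
    then show "chi12 j * real (2 * n choose (n + m * j)) = 0"
      by (auto simp: binomial_eq_0)
  qed simp
  finally have 2: "sum F {..<12*m} = 2 * (real m * sqrt 12 * (\<Sum>j. chi12 j * real (2 * n choose (n + m * j))))" .
  have "sum F {..<6*m} = 4 ^ n * (\<Sum>k<6*m. chi12 k * cos (pi * real k / (12 * real m)) ^ (2 * n))"
  proof -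
    have "(2 * c) ^ (2 * n) = 4 ^ n * c ^ (2 * n)" for c :: real
    proof -
      have "(2 * c) ^ (2 * n) = (4 * c\<^sup>2) ^ n" by (simp only: power_mult) (simp add: power_mult_distrib)
      then show ?thesis by (simp only: power_mult_distrib power_mult)
    qed
    then show ?thesis
      unfolding F_def sum_distrib_left by (intro sum.cong refl) (simp only: mult.left_commute)
  qed
  with 1 2 show ?thesis by (simp add: field_simps)
qed

section \<open>Gaussian estimates for binomial coefficients and cosine powers\<close>

lemma binomial_ratio:
  assumes "j < n"
  shows "real (n + j + 1) * real (2 * n choose (n + Suc j)) = real (n - j) * real (2 * n choose (n + j))"
proof -
  have "Suc (n + j) * (2 * n choose Suc (n + j)) = (2 * n - (n + j)) * (2 * n choose (n + j))"
    using binomial_absorption[of "n + j" "2 * n"] binomial_absorb_comp[of "2 * n" "n + j"] by simp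
  also have "2 * n - (n + j) = n - j" by simp
  finally have "real (Suc (n + j) * (2 * n choose Suc (n + j))) = real ((n - j) * (2 * n choose (n + j)))" by simp
  then show ?thesis using assms by (simp add: of_nat_diff algebra_simps)
qed

text \<open>The quotient of neighbouring coefficients is
  \<open>1 - (2 * i + 1) / (n + i + 1)\<close>, at most
  \<open>exp (- (2 * i + 1) / (n + j))\<close>, and the odd numbers add up to \<open>i^2\<close>.
  The parameter \<open>j\<close> fixes one denominator for the whole induction; the applications
  take \<open>i = j\<close>.\<close>

lemma binomial_upper:
  assumes "i \<le> j" "j \<le> n" "n > 0"
  shows "real (2 * n choose (n + i)) \<le> real (2 * n choose n) * exp (- ((real i)\<^sup>2 / real (n + j)))"
  using assms(1)
proof (induction i)
  case (Suc i)
  define B where "B = real (2 * n choose (n + i))"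
  define B' where "B' = real (2 * n choose (n + Suc i))"
  have "real (n + i + 1) * B' = real (n - i) * B"
    unfolding B_def B'_def by (rule binomial_ratio) (use Suc.prems assms in simp)
  then have "B' = B * (1 + - ((2 * real i + 1) / real (n + i + 1)))"
    using Suc.prems assms by (simp add: field_simps of_nat_diff)
  also have "\<dots> \<le> B * exp (- ((2 * real i + 1) / real (n + i + 1)))"
    by (intro mult_left_mono exp_ge_add_one_self) (simp add: B_def)
  also have "\<dots> \<le> B * exp (- ((2 * real i + 1) / real (n + j)))"
    using Suc.prems assms by (intro mult_left_mono) (auto simp: B_def intro!: divide_left_mono mult_pos_pos)
  also have "\<dots> \<le> real (2 * n choose n) * exp (- ((real i)\<^sup>2 / real (n + j))) * exp (- ((2 * real i + 1) / real (n + j)))"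
    using Suc by (intro mult_right_mono) (auto simp: B_def)
  also have "\<dots> = real (2 * n choose n) * exp (- ((real (Suc i))\<^sup>2 / real (n + j)))"
    by (simp add: exp_add[symmetric] mult.assoc add_divide_distrib[symmetric] power2_eq_square algebra_simps
        del: of_nat_add)
  finally show ?case by (simp add: B'_def)
qed simp

text \<open>The inverse quotient is \<open>1 + (2 * i + 1) / (n - i)\<close>, bounded by an
  exponential with the smallest denominator that occurs, \<open>n - j + 1\<close>.\<close>

lemma binomial_lower:
  assumes "i \<le> j" "j \<le> n"
  shows "real (2 * n choose (n + i)) \<ge> real (2 * n choose n) * exp (- ((real i)\<^sup>2 / (real n - real j + 1)))"
  using assms(1)
proof (induction i)
  case (Suc i)
  define B where "B = real (2 * n choose (n + i))"
  define B' where "B' = real (2 * n choose (n + Suc i))"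
  define d where "d = real n - real j + 1"
  have d: "d > 0" using assms by (simp add: d_def)
  have ni: "real n - real i > 0" "real n - real i \<ge> d" using Suc.prems assms by (auto simp: d_def)
  have "real (n + i + 1) * B' = real (n - i) * B"
    unfolding B_def B'_def by (rule binomial_ratio) (use Suc.prems assms in simp)
  then have "B = B' * (1 + (2 * real i + 1) / (real n - real i))"
    using ni Suc.prems assms by (simp add: field_simps of_nat_diff)
  also have "\<dots> \<le> B' * exp ((2 * real i + 1) / (real n - real i))"
    by (intro mult_left_mono exp_ge_add_one_self) (simp add: B'_def)
  also have "\<dots> \<le> B' * exp ((2 * real i + 1) / d)"
    using ni d by (intro mult_left_mono) (auto simp: B'_def intro!: divide_left_mono mult_pos_pos)
  finally have "B * exp (- ((2 * real i + 1) / d)) \<le> B' * exp ((2 * real i + 1) / d) * exp (- ((2 * real i + 1) / d))"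
    by (intro mult_right_mono) auto
  then have "B * exp (- ((2 * real i + 1) / d)) \<le> B'" by (simp add: mult.assoc exp_minus_inverse)
  moreover have "real (2 * n choose n) * exp (- ((real i)\<^sup>2 / d)) * exp (- ((2 * real i + 1) / d)) \<le> B * exp (- ((2 * real i + 1) / d))"
    using Suc by (intro mult_right_mono) (auto simp: B_def d_def)
  moreover have "real (2 * n choose n) * exp (- ((real i)\<^sup>2 / d)) * exp (- ((2 * real i + 1) / d))
      = real (2 * n choose n) * exp (- ((real (Suc i))\<^sup>2 / d))"
    by (simp add: exp_add[symmetric] mult.assoc add_divide_distrib[symmetric] power2_eq_square algebra_simps)
  ultimately have "real (2 * n choose n) * exp (- ((real (Suc i))\<^sup>2 / d)) \<le> B'" by linarith
  then show ?case by (simp only: B'_def d_def)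
qed simp

text \<open>The asymptotics of generalised binomial coefficients are given by the Gamma function; in
  this form they apply to the central coefficient, and \<open>Gamma (1/2) = sqrt pi\<close> gives
  the limit.\<close>

lemma central_binomial_gbinomial:
  "real (2 * n choose n) / 4 ^ n = (-1) ^ n * ((- 1 / 2 :: real) gchoose n)"
proof (induction n)
  case (Suc n)
  have g: "((- 1 / 2 :: real) gchoose Suc n) = (- 1 / 2 gchoose n) * (- 1 / 2 - real n) / real (Suc n)"
    by (simp add: gbinomial_prod_rev mult_ac)
  have c: "real (2 * Suc n choose Suc n) * real (Suc n) = real (2 * n choose n) * (2 * (2 * real n + 1))"
  proof -
    have e: "2 * Suc n - Suc n = Suc n" by simp
    have "real (2 * Suc n choose Suc n) = fact (2 * Suc n) / (fact (Suc n) * fact (Suc n))"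
      using binomial_fact[of "Suc n" "2 * Suc n", OF le_add1[of "Suc n" "Suc n", folded mult_2], where ?'a = real]
      unfolding e .
    moreover have "real (2 * n choose n) = fact (2 * n) / (fact n * fact n)"
      by (simp add: binomial_fact)
    moreover have "(fact (2 * Suc n) :: real) = (2 * real n + 2) * (2 * real n + 1) * fact (2 * n)"
      by (simp add: algebra_simps)
    moreover have "(2 * N + 2) * (2 * N + 1) * G / (((1 + N) * F) * ((1 + N) * F)) * (1 + N)
        = G / (F * F) * (2 * (2 * N + 1))" if "F > 0" "N \<ge> 0" for F G N :: real
      using that by (simp add: divide_simps add_nonneg_eq_0_iff) (simp add: algebra_simps)
    ultimately show ?thesis by (simp only: fact_Suc of_nat_Suc fact_gt_zero of_nat_0_le_iff)
  qed
  have "real (2 * Suc n choose Suc n) / 4 ^ Suc n = (real (2 * n choose n) / 4 ^ n) * ((2 * real n + 1) / (2 * real (Suc n)))"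
  proof -
    have "X / (4 * P) = C / P * (M / (2 * S))" if "X * S = C * (2 * M)" "S > 0" "P > 0" for X S C M P :: real
      using that by (simp add: field_simps)
    from this[OF c] show ?thesis by simp
  qed
  also have "\<dots> = (-1) ^ Suc n * ((- 1 / 2 :: real) gchoose Suc n)"
    unfolding Suc g by (simp add: field_simps)
  finally show ?case .
qed simp

lemma central_binomial_limit: "(\<lambda>n. real (2 * n choose n) / 4 ^ n * sqrt (real n)) \<longlonglongrightarrow> 1 / sqrt pi"
proof -
  have "(\<lambda>n. ((- 1 / 2 :: real) gchoose n) / ((-1)^n / exp ((- 1 / 2 + 1) * of_real (ln (real n)))))
     \<longlonglongrightarrow> inverse (Gamma (- (- 1 / 2)))" by (rule gbinomial_asymptotic)
  then have "(\<lambda>n. ((- 1 / 2 :: real) gchoose n) / ((-1)^n / exp ((- 1 / 2 + 1) * of_real (ln (real n))))) \<longlonglongrightarrow> 1 / sqrt pi"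
    by (simp add: Gamma_one_half_real inverse_eq_divide)
  then show ?thesis
  proof (rule Lim_transform_eventually)
    show "eventually (\<lambda>n. ((- 1 / 2 :: real) gchoose n) / ((-1)^n / exp ((- 1 / 2 + 1) * of_real (ln (real n))))
      = real (2 * n choose n) / 4 ^ n * sqrt (real n)) sequentially"
      using eventually_gt_at_top[of 0]
    proof eventually_elim
      case (elim n)
      have "exp ((- 1 / 2 + 1) * of_real (ln (real n))) = sqrt (real n)"
        using elim by (simp add: powr_half_sqrt[symmetric] powr_def)
      then show ?case unfolding central_binomial_gbinomial by (simp add: field_simps power_mult_distrib[symmetric])
    qed
  qed
qed

text \<open>The function \<open>cos u * exp (u^2 / 2)\<close> decreases, since its derivative has
  the sign of \<open>- (sin u - u * cos u)\<close>. The bound supplies a summable majorant for the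
  cosine powers.\<close>

lemma cos_le_exp:
  assumes "0 \<le> x" "x \<le> pi / 2"
  shows "cos x \<le> exp (- (x\<^sup>2 / 2))"
proof -
  have 1: "sin y - y * cos y \<ge> 0" if "0 \<le> y" "y \<le> pi / 2" for y
  proof -
    have "sin 0 - 0 * cos 0 \<le> sin y - y * cos y"
    proof (rule DERIV_nonneg_imp_nondecreasing[OF that(1)])
      fix u assume u: "0 \<le> u" "u \<le> y"
      have "((\<lambda>u. sin u - u * cos u) has_real_derivative u * sin u) (at u)"
        by (auto intro!: derivative_eq_intros)
      moreover have "u * sin u \<ge> 0" using u that by (intro mult_nonneg_nonneg sin_ge_zero) auto
      ultimately show "\<exists>d. ((\<lambda>u. sin u - u * cos u) has_real_derivative d) (at u) \<and> 0 \<le> d" by blast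
    qed
    then show ?thesis by simp
  qed
  have "cos x * exp (x\<^sup>2 / 2) \<le> cos 0 * exp (0\<^sup>2 / 2)"
  proof (rule DERIV_nonpos_imp_nonincreasing[OF assms(1)])
    fix u assume u: "0 \<le> u" "u \<le> x"
    have "((\<lambda>u. cos u * exp (u\<^sup>2 / 2)) has_real_derivative - (sin u - u * cos u) * exp (u\<^sup>2 / 2)) (at u)"
      by (auto intro!: derivative_eq_intros simp: algebra_simps)
    moreover have "- (sin u - u * cos u) * exp (u\<^sup>2 / 2) \<le> 0"
      using 1[of u] u assms by (intro mult_nonpos_nonneg) auto
    ultimately show "\<exists>d. ((\<lambda>u. cos u * exp (u\<^sup>2 / 2)) has_real_derivative d) (at u) \<and> d \<le> 0" by blast
  qed
  then show ?thesis by (simp add: exp_minus field_simps)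
qed

definition psi12 :: "real \<Rightarrow> real" where
  "psi12 t = (\<Sum>j. chi12 j * exp (- (t * (real j)\<^sup>2 / 24)))"

lemma summable_exp_square:
  assumes "c > 0" shows "summable (\<lambda>j. exp (- (c * (real j)\<^sup>2)))"
proof (rule summable_comparison_test)
  show "\<exists>N. \<forall>n\<ge>N. norm (exp (- (c * (real n)\<^sup>2))) \<le> exp (-c) ^ n"
  proof (intro exI allI impI)
    fix n :: nat
    have "real n \<le> (real n)\<^sup>2" by (simp add: power2_eq_square) (metis le_square of_nat_le_iff of_nat_mult)
    then show "norm (exp (- (c * (real n)\<^sup>2))) \<le> exp (-c) ^ n"
      using assms by (simp add: exp_of_nat_mult[symmetric] mult.commute)
  qed
  show "summable (\<lambda>n. exp (-c) ^ n)" using assms by (intro summable_geometric) auto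
qed

lemma summable_psi12:
  assumes "t > 0" shows "summable (\<lambda>j. chi12 j * exp (- (t * (real j)\<^sup>2 / 24)))"
proof (rule summable_comparison_test)
  show "summable (\<lambda>j. exp (- (t / 24 * (real j)\<^sup>2)))" using assms by (intro summable_exp_square) auto
  show "\<exists>N. \<forall>n\<ge>N. norm (chi12 n * exp (- (t * (real n)\<^sup>2 / 24))) \<le> exp (- (t / 24 * (real n)\<^sup>2))"
    using abs_chi12_le by (auto simp: abs_mult mult_le_cancel_right2 intro!: exI[of _ 0])
qed

text \<open>Tannery's theorem asks for a majorant that holds eventually along a product filter; the
  majorants below hold for every summation index as soon as \<open>m\<close> is large.\<close>

lemma eventually_prod_snd:
  assumes "eventually Q G" and "\<And>k m. Q m \<Longrightarrow> R k m"
  shows "\<forall>\<^sub>F (k, m) in F \<times>\<^sub>F G. R k m"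
  unfolding eventually_prod_filter
  using assms by (intro exI[of _ "\<lambda>_. True"] exI[of _ Q]) auto

text \<open>
  The limit \<open>m \<rightarrow> \<infinity>\<close> of the finite identity above, with \<open>n\<close> about \<open>24 m\<^sup>2/t\<close>: both sides become Gaussian sums.
\<close>

lemma psi12_transform:
  assumes t: "t > 0"
  shows "psi12 (4 * pi\<^sup>2 / t) = sqrt (t / (2 * pi)) * psi12 t"
proof -
  \<comment> \<open>The size of \<open>N\<close> balances both sides:
    \<open>cos (pi * k / (12 * m)) ^ (2 * N)\<close> behaves like
    \<open>exp (- N * (pi * k / (12 * m))^2)\<close>, which tends to
    \<open>exp (- pi^2 * k^2 / (6 * t))\<close>, and the binomial quotient behaves like
    \<open>exp (- (m * j)^2 / N)\<close>, which tends to
    \<open>exp (- t * j^2 / 24)\<close>.\<close>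
  define N where "N = (\<lambda>m::nat. nat \<lfloor>24 * (real m)\<^sup>2 / t\<rfloor>)"
  have N_le: "real (N m) \<le> 24 * (real m)\<^sup>2 / t" for m using t by (simp add: N_def)
  have N_ge: "real (N m) \<ge> 24 * (real m)\<^sup>2 / t - 1" for m using t unfolding N_def by linarith
  have N_lim: "(\<lambda>m. real (N m) / (real m)\<^sup>2) \<longlonglongrightarrow> 24 / t"
  proof (rule tendsto_sandwich)
    show "(\<lambda>m. 24 / t - 1 / (real m)\<^sup>2) \<longlonglongrightarrow> 24 / t" by real_asymp
    show "(\<lambda>m. 24 / t) \<longlonglongrightarrow> 24 / t" by simp
    show "\<forall>\<^sub>F m in sequentially. 24 / t - 1 / (real m)\<^sup>2 \<le> real (N m) / (real m)\<^sup>2"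
      using eventually_gt_at_top[of 0]
    proof eventually_elim
      case (elim m)
      have "(24 * (real m)\<^sup>2 / t - 1) / (real m)\<^sup>2 \<le> real (N m) / (real m)\<^sup>2"
        by (intro divide_right_mono N_ge) auto
      then show ?case using elim by (simp add: diff_divide_distrib)
    qed
    show "\<forall>\<^sub>F m in sequentially. real (N m) / (real m)\<^sup>2 \<le> 24 / t"
      using eventually_gt_at_top[of 0]
    proof eventually_elim
      case (elim m)
      have "real (N m) / (real m)\<^sup>2 \<le> (24 * (real m)\<^sup>2 / t) / (real m)\<^sup>2"
        by (intro divide_right_mono N_le) auto
      then show ?case using elim by simp
    qed
  qed
  have N_top: "filterlim N at_top sequentially"
  proof -
    have "filterlim (\<lambda>m. 24 * (real m)\<^sup>2 / t - 1) at_top sequentially" using t by real_asymp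
    then have "filterlim (\<lambda>m. real (N m)) at_top sequentially"
      by (rule filterlim_at_top_mono) (use N_ge in auto)
    then show ?thesis by (simp add: filterlim_sequentially_iff_filterlim_real)
  qed
  have N_pos: "eventually (\<lambda>m. N m > 0 \<and> m > 0) sequentially"
    using N_top[unfolded filterlim_at_top, rule_format, of 1] eventually_gt_at_top[of "0::nat"]
    by eventually_elim auto

  define a where "a = (\<lambda>k m. if k < 6 * m then chi12 k * cos (pi * real k / (12 * real m)) ^ (2 * N m) else 0)"
  have a_lim: "(\<lambda>m. a k m) \<longlonglongrightarrow> chi12 k * exp (- (4 * pi\<^sup>2 / t * (real k)\<^sup>2 / 24))" for k
  proof (cases "k = 0")
    case True
    moreover have "a 0 = (\<lambda>m. 0)" by (auto simp: a_def fun_eq_iff)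
    ultimately show ?thesis by simp
  next
    case False
    define x where "x = (\<lambda>m::nat. pi * real k / (12 * real m))"
    have x0: "filterlim x (at 0) sequentially"
      unfolding filterlim_at
    proof
      show "x \<longlonglongrightarrow> 0" unfolding x_def using False by real_asymp
      show "\<forall>\<^sub>F m in sequentially. x m \<in> UNIV \<and> x m \<noteq> 0"
        using eventually_gt_at_top[of 0] by eventually_elim (use False in \<open>auto simp: x_def\<close>)
    qed
    have "((\<lambda>y::real. ln (cos y) / y\<^sup>2) \<longlongrightarrow> - 1 / 2) (at 0)" by real_asymp
    from filterlim_compose[OF this x0] have l1: "(\<lambda>m. ln (cos (x m)) / (x m)\<^sup>2) \<longlonglongrightarrow> - 1 / 2" .
    have "(\<lambda>m. real (N m) / (real m)\<^sup>2 * (pi * real k / 12)\<^sup>2) \<longlonglongrightarrow> 24 / t * (pi * real k / 12)\<^sup>2"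
      by (intro tendsto_intros N_lim)
    from tendsto_mult[OF tendsto_mult[OF tendsto_const[of "2::real"] this] l1]
    have "(\<lambda>m. exp (2 * (real (N m) / (real m)\<^sup>2 * (pi * real k / 12)\<^sup>2) * (ln (cos (x m)) / (x m)\<^sup>2)))
        \<longlonglongrightarrow> exp (2 * (24 / t * (pi * real k / 12)\<^sup>2) * (- 1 / 2))" by (rule tendsto_exp)
    also have "exp (2 * (24 / t * (pi * real k / 12)\<^sup>2) * (- 1 / 2)) = exp (- (4 * pi\<^sup>2 / t * (real k)\<^sup>2 / 24))"
      by (simp add: power_mult_distrib power_divide)
    finally have l2: "(\<lambda>m. exp (2 * (real (N m) / (real m)\<^sup>2 * (pi * real k / 12)\<^sup>2) * (ln (cos (x m)) / (x m)\<^sup>2)))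
        \<longlonglongrightarrow> exp (- (4 * pi\<^sup>2 / t * (real k)\<^sup>2 / 24))" .
    have "(\<lambda>m. chi12 k * exp (2 * (real (N m) / (real m)\<^sup>2 * (pi * real k / 12)\<^sup>2) * (ln (cos (x m)) / (x m)\<^sup>2)))
        \<longlonglongrightarrow> chi12 k * exp (- (4 * pi\<^sup>2 / t * (real k)\<^sup>2 / 24))"
      by (intro tendsto_intros l2)
    then show ?thesis
    proof (rule Lim_transform_eventually)
      show "\<forall>\<^sub>F m in sequentially. chi12 k * exp (2 * (real (N m) / (real m)\<^sup>2 * (pi * real k / 12)\<^sup>2) * (ln (cos (x m)) / (x m)\<^sup>2)) = a k m"
        using eventually_gt_at_top[of k]
      proof eventually_elim
        case (elim m)
        have "x m \<ge> 0" "x m < pi / 2" using elim False by (auto simp: x_def field_simps)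
        then have c: "cos (x m) > 0" by (intro cos_gt_zero_pi) auto
        have "2 * (real (N m) / (real m)\<^sup>2 * (pi * real k / 12)\<^sup>2) * (ln (cos (x m)) / (x m)\<^sup>2)
           = real (2 * N m) * ln (cos (x m))"
          using elim False by (simp add: x_def field_simps power2_eq_square)
        also have "exp (real (2 * N m) * ln (cos (x m))) = cos (x m) ^ (2 * N m)"
          unfolding exp_of_nat_mult using c by simp
        finally show ?case using elim by (simp add: a_def x_def)
      qed
    qed
  qed
  \<comment> \<open>Half of the limit \<open>24 / t\<close> is exceeded eventually and suffices for
    a majorant.\<close>
  have "eventually (\<lambda>m. 12 / t \<le> real (N m) / (real m)\<^sup>2) sequentially"
    using order_tendstoD(1)[OF N_lim, of "12 / t"] t
    by (auto simp: divide_strict_right_mono elim: eventually_mono)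
  then have N12: "eventually (\<lambda>m. 12 / t \<le> real (N m) / (real m)\<^sup>2 \<and> m > 0) sequentially"
    using eventually_gt_at_top[of "0::nat"] by eventually_elim auto
  have a_bound: "\<forall>\<^sub>F (k, m) in at_top \<times>\<^sub>F sequentially. norm (a k m) \<le> exp (- (pi\<^sup>2 / (12 * t) * (real k)\<^sup>2))"
  proof -
    have "norm (a k m) \<le> exp (- (pi\<^sup>2 / (12 * t) * (real k)\<^sup>2))"
      if m: "12 / t \<le> real (N m) / (real m)\<^sup>2 \<and> m > 0" for k m
    proof (cases "k < 6 * m")
      case True
      define x where "x = pi * real k / (12 * real m)"
      have x: "x \<ge> 0" "x \<le> pi / 2" using True m by (auto simp: x_def field_simps)
      have "norm (a k m) \<le> cos x ^ (2 * N m)"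
        using True abs_chi12_le[of k] x cos_ge_zero[of x]
        by (auto simp: a_def x_def[symmetric] abs_mult intro!: mult_left_le_one_le)
      also have "\<dots> \<le> exp (- (x\<^sup>2 / 2)) ^ (2 * N m)"
        using x cos_ge_zero[of x] by (intro power_mono cos_le_exp) auto
      also have "\<dots> = exp (- (x\<^sup>2 * real (N m)))"
        by (simp add: exp_of_nat_mult[symmetric] mult_ac)
      also have "x\<^sup>2 * real (N m) = (pi * real k / 12)\<^sup>2 * (real (N m) / (real m)\<^sup>2)"
        by (simp add: x_def power_divide power_mult_distrib)
      also have "exp (- \<dots>) \<le> exp (- ((pi * real k / 12)\<^sup>2 * (12 / t)))"
        using mult_left_mono[OF conjunct1[OF m], of "(pi * real k / 12)\<^sup>2"]
        by (simp only: exp_le_cancel_iff neg_le_iff_le zero_le_power2)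
      also have "(pi * real k / 12)\<^sup>2 * (12 / t) = pi\<^sup>2 / (12 * t) * (real k)\<^sup>2"
        by (simp add: power_divide power_mult_distrib)
      finally show ?thesis .
    qed (simp add: a_def)
    then show ?thesis by (rule eventually_prod_snd[OF N12])
  qed
  have "((\<lambda>m. \<Sum>k. a k m) \<longlongrightarrow> (\<Sum>k. chi12 k * exp (- (4 * pi\<^sup>2 / t * (real k)\<^sup>2 / 24)))) sequentially"
    using tannerys_theorem[OF a_lim a_bound] summable_exp_square[of "pi\<^sup>2 / (12 * t)"] t by simp
  then have limL: "(\<lambda>m. \<Sum>k. a k m) \<longlonglongrightarrow> psi12 (4 * pi\<^sup>2 / t)" by (simp add: psi12_def)
  have a_sum: "(\<Sum>k. a k m) = (\<Sum>k<6*m. chi12 k * cos (pi * real k / (12 * real m)) ^ (2 * N m))" for m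
    by (subst suminf_finite[of "{..<6*m}"]) (auto simp: a_def)

  define b where "b = (\<lambda>j m. chi12 j * (real (2 * N m choose (N m + m * j)) / real (2 * N m choose N m)))"
  have b_bound0: "real (2 * N m choose (N m + m * j)) / real (2 * N m choose N m) \<le> exp (- (t / 48 * (real j)\<^sup>2))"
    if m: "N m > 0 \<and> m > 0" for m j
  proof (cases "m * j \<le> N m")
    case True
    have e1: "real (2 * N m choose (N m + m * j)) / real (2 * N m choose N m)
        \<le> exp (- ((real (m * j))\<^sup>2 / real (N m + m * j)))"
      using binomial_upper[OF order_refl True] m by (simp add: field_simps)
    have e2: "(real (m * j))\<^sup>2 / real (N m + m * j) \<ge> (real (m * j))\<^sup>2 / (2 * real (N m))"
    proof (rule divide_left_mono)
      have "real (m * j) \<le> real (N m)" using True by (simp only: of_nat_le_iff)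
      then show "real (N m + m * j) \<le> 2 * real (N m)" by simp
    qed (use m in \<open>auto simp: intro!: mult_pos_pos add_pos_nonneg\<close>)
    have e3: "(real (m * j))\<^sup>2 / (2 * real (N m)) \<ge> t / 48 * (real j)\<^sup>2"
    proof -
      have "t * real (N m) \<le> 24 * (real m)\<^sup>2" using N_le[of m] t by (simp add: field_simps)
      then have "t * real (N m) * (real j)\<^sup>2 \<le> 24 * (real m)\<^sup>2 * (real j)\<^sup>2" by (intro mult_right_mono) auto
      then show ?thesis using m by (simp add: field_simps power_mult_distrib)
    qed
    show ?thesis
      by (rule order_trans[OF e1]) (simp only: exp_le_cancel_iff neg_le_iff_le order_trans[OF e3 e2])
  qed (simp add: binomial_eq_0)
  have b_bound: "\<forall>\<^sub>F (j, m) in at_top \<times>\<^sub>F sequentially. norm (b j m) \<le> exp (- (t / 48 * (real j)\<^sup>2))"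
  proof -
    have "norm (b j m) \<le> exp (- (t / 48 * (real j)\<^sup>2))" if m: "N m > 0 \<and> m > 0" for j m
    proof -
      have "norm (b j m) \<le> 1 * (real (2 * N m choose (N m + m * j)) / real (2 * N m choose N m))"
        unfolding b_def norm_mult using abs_chi12_le[of j] by (intro mult_mono) auto
      with b_bound0[OF m, of j] show ?thesis by linarith
    qed
    then show ?thesis by (rule eventually_prod_snd[OF N_pos])
  qed
  have b_lim: "(\<lambda>m. b j m) \<longlonglongrightarrow> chi12 j * exp (- (t * (real j)\<^sup>2 / 24))" for j
  proof -
    have "(\<lambda>m. real (2 * N m choose (N m + m * j)) / real (2 * N m choose N m)) \<longlonglongrightarrow> exp (- (t * (real j)\<^sup>2 / 24))"
    proof (rule tendsto_sandwich[where
          f = "\<lambda>m. exp (- ((real j)\<^sup>2 / (real (N m) / (real m)\<^sup>2 - real j * (1 / real m) + 1 / (real m)\<^sup>2)))" and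
          h = "\<lambda>m. exp (- ((real j)\<^sup>2 / (real (N m) / (real m)\<^sup>2 + real j * (1 / real m))))"])
      have i1: "(\<lambda>m. 1 / real m) \<longlonglongrightarrow> 0" by real_asymp
      have "(\<lambda>m. (real j)\<^sup>2 / (real (N m) / (real m)\<^sup>2 + real j * (1 / real m))) \<longlonglongrightarrow> (real j)\<^sup>2 / (24 / t + real j * 0)"
        by (intro tendsto_intros N_lim i1) (use t in auto)
      then have "(\<lambda>m. exp (- ((real j)\<^sup>2 / (real (N m) / (real m)\<^sup>2 + real j * (1 / real m))))) \<longlonglongrightarrow> exp (- ((real j)\<^sup>2 / (24 / t + real j * 0)))"
        by (rule tendsto_exp[OF tendsto_minus])
      then show "(\<lambda>m. exp (- ((real j)\<^sup>2 / (real (N m) / (real m)\<^sup>2 + real j * (1 / real m))))) \<longlonglongrightarrow> exp (- (t * (real j)\<^sup>2 / 24))"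
        using t by (simp add: mult.commute)
      have i2: "(\<lambda>m. 1 / (real m)\<^sup>2) \<longlonglongrightarrow> 0" by real_asymp
      have "(\<lambda>m. (real j)\<^sup>2 / (real (N m) / (real m)\<^sup>2 - real j * (1 / real m) + 1 / (real m)\<^sup>2)) \<longlonglongrightarrow> (real j)\<^sup>2 / (24 / t - real j * 0 + 0)"
        by (intro tendsto_intros N_lim i1 i2) (use t in auto)
      then have "(\<lambda>m. exp (- ((real j)\<^sup>2 / (real (N m) / (real m)\<^sup>2 - real j * (1 / real m) + 1 / (real m)\<^sup>2)))) \<longlonglongrightarrow> exp (- ((real j)\<^sup>2 / (24 / t - real j * 0 + 0)))"
        by (rule tendsto_exp[OF tendsto_minus])
      then show "(\<lambda>m. exp (- ((real j)\<^sup>2 / (real (N m) / (real m)\<^sup>2 - real j * (1 / real m) + 1 / (real m)\<^sup>2)))) \<longlonglongrightarrow> exp (- (t * (real j)\<^sup>2 / 24))"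
        using t by (simp add: mult.commute)
      have ev: "\<forall>\<^sub>F m in sequentially. m > 0 \<and> N m > 0 \<and> m * j \<le> N m"
      proof -
        have "(\<lambda>m. real (N m) / (real m)\<^sup>2 - real j * (1 / real m)) \<longlonglongrightarrow> 24 / t - real j * 0"
          by (intro tendsto_intros N_lim i1)
        then have "\<forall>\<^sub>F m in sequentially. real (N m) / (real m)\<^sup>2 - real j * (1 / real m) > 0"
          by (rule order_tendstoD) (use t in auto)
        then show ?thesis using N_pos
        proof eventually_elim
          case (elim m)
          then have "real (m * j) < real (N m)" by (simp add: field_simps power2_eq_square)
          then have "m * j < N m" by (simp only: of_nat_less_iff)
          with elim show ?case by auto
        qed
      qed
      show "\<forall>\<^sub>F m in sequentially. real (2 * N m choose (N m + m * j)) / real (2 * N m choose N m)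
          \<le> exp (- ((real j)\<^sup>2 / (real (N m) / (real m)\<^sup>2 + real j * (1 / real m))))"
        using ev
      proof eventually_elim
        case (elim m)
        have "(real (m * j))\<^sup>2 / real (N m + m * j) = (real j)\<^sup>2 / (real (N m) / (real m)\<^sup>2 + real j * (1 / real m))"
          using elim by (simp add: field_simps power2_eq_square)
        then show ?case using binomial_upper[of "m * j" "m * j" "N m"] elim by (simp add: field_simps)
      qed
      show "\<forall>\<^sub>F m in sequentially. exp (- ((real j)\<^sup>2 / (real (N m) / (real m)\<^sup>2 - real j * (1 / real m) + 1 / (real m)\<^sup>2)))
         \<le> real (2 * N m choose (N m + m * j)) / real (2 * N m choose N m)"
        using ev
      proof eventually_elim
        case (elim m)
        have "real (N m) / (real m)\<^sup>2 - real j * (1 / real m) + 1 / (real m)\<^sup>2 = (real (N m) - real (m * j) + 1) / (real m)\<^sup>2"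
          using elim by (simp add: field_simps power2_eq_square)
        then have "(real (m * j))\<^sup>2 / (real (N m) - real (m * j) + 1)
            = (real j)\<^sup>2 / (real (N m) / (real m)\<^sup>2 - real j * (1 / real m) + 1 / (real m)\<^sup>2)"
          by (simp add: power_mult_distrib mult.commute)
        then show ?case using binomial_lower[of "m * j" "m * j" "N m"] elim by (simp add: field_simps)
      qed
    qed
    then show ?thesis unfolding b_def by (rule tendsto_mult[OF tendsto_const])
  qed
  have limR: "(\<lambda>m. \<Sum>j. b j m) \<longlonglongrightarrow> psi12 t"
    using tannerys_theorem[OF b_lim b_bound] summable_exp_square[of "t / 48"] t by (simp add: psi12_def)
  \<comment> \<open>The prefactor \<open>m * sqrt 12 / 4^N\<close> times the central coefficient,
    split into convergent factors; their limits multiply to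
    \<open>sqrt (t / (2 * pi))\<close>.\<close>
  have "(\<lambda>m. sqrt 12 * (1 / sqrt (real (N m) / (real m)\<^sup>2)) * (real (2 * N m choose N m) / 4 ^ N m * sqrt (real (N m))) * (\<Sum>j. b j m))
      \<longlonglongrightarrow> sqrt 12 * (1 / sqrt (24 / t)) * (1 / sqrt pi) * psi12 t"
    by (intro tendsto_intros N_lim limR filterlim_compose[OF central_binomial_limit N_top]) (use t in auto)
  also have "sqrt 12 * (1 / sqrt (24 / t)) * (1 / sqrt pi) = sqrt (t / (2 * pi))"
    using t by (simp add: real_sqrt_divide[symmetric] real_sqrt_mult[symmetric])
  finally have "(\<lambda>m. \<Sum>k. a k m) \<longlonglongrightarrow> sqrt (t / (2 * pi)) * psi12 t"
  proof (rule Lim_transform_eventually)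
    show "\<forall>\<^sub>F m in sequentially. sqrt 12 * (1 / sqrt (real (N m) / (real m)\<^sup>2)) * (real (2 * N m choose N m) / 4 ^ N m * sqrt (real (N m))) * (\<Sum>j. b j m) = (\<Sum>k. a k m)"
      using N_pos
    proof eventually_elim
      case (elim m)
      define C where "C = real (2 * N m choose N m)"
      have C: "C > 0" by (simp add: C_def)
      have "(\<Sum>j. b j m) = (\<Sum>j. chi12 j * real (2 * N m choose (N m + m * j)) / C)"
        by (simp add: b_def C_def)
      also have "\<dots> = (\<Sum>j. chi12 j * real (2 * N m choose (N m + m * j))) / C"
      proof (rule suminf_divide, rule summable_finite[of "{..N m}"])
        fix j assume "j \<notin> {..N m}"
        then have "N m < j" by simp
        also have "j \<le> m * j" using elim by simp
        finally show "chi12 j * real (2 * N m choose (N m + m * j)) = 0" by (simp add: binomial_eq_0)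
      qed simp
      finally have "(\<Sum>j. chi12 j * real (2 * N m choose (N m + m * j))) = C * (\<Sum>j. b j m)" using C by simp
      then show ?case
        unfolding a_sum chi12_cos_power_sum[OF conjunct2[OF elim]] C_def[symmetric]
        using elim by (simp add: real_sqrt_divide field_simps)
    qed
  qed
  with limL show ?thesis by (rule LIMSEQ_unique)
qed

section \<open>Modular transformation of the generating function\<close>

lemma chi12_near_6:
  "chi12 (6 * n + 2) = 0" "chi12 (6 * n + 3) = 0" "chi12 (6 * n + 4) = 0" "chi12 (6 * n + 6) = 0"
  "chi12 (6 * n + 5) = (-1) ^ Suc n" "chi12 (6 * n + 7) = (-1) ^ Suc n"
proof -
  have *: "(6 * n + c) mod 12 = (if even n then c mod 12 else (c + 6) mod 12)" for c
  proof (cases "even n")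
    case True
    then obtain l where "n = 2 * l" by blast
    then have "6 * n + c = c + l * 12" by simp
    then show ?thesis using True by simp
  next
    case False
    then obtain l where "n = 2 * l + 1" by (metis oddE)
    then have "6 * n + c = (c + 6) + l * 12" by simp
    then show ?thesis using False by (simp only: mod_mult_self1 if_False)
  qed
  show "chi12 (6 * n + 2) = 0" "chi12 (6 * n + 3) = 0" "chi12 (6 * n + 4) = 0" "chi12 (6 * n + 6) = 0"
    "chi12 (6 * n + 5) = (-1) ^ Suc n" "chi12 (6 * n + 7) = (-1) ^ Suc n"
    unfolding chi12_def * by auto
qed

text \<open>Completing the square, \<open>s * (3 * s - 1) / 2 = ((6 * s - 1)^2 - 1) / 24\<close>,
  produces the factor \<open>exp (t / 24)\<close>. The step from \<open>n\<close> to
  \<open>n + 1\<close> adds the six indices \<open>6 * n + 2\<close> to \<open>6 * n + 7\<close>, of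
  which only \<open>6 * n + 5\<close> and \<open>6 * n + 7\<close> have a nonzero character.\<close>

lemma pent_partial_psi12:
  "pent_partial (exp (-t)) n = exp (t / 24) * (\<Sum>j<6*n+2. chi12 j * exp (- (t * (real j)\<^sup>2 / 24)))"
proof (induction n)
  case 0
  have "{..<2::nat} = {0, 1}" by auto
  moreover have "chi12 1 = 1" by (simp add: chi12_def)
  ultimately show ?case by (simp add: pent_partial_def exp_add[symmetric])
next
  case (Suc n)
  define s where "s = Suc n"
  define g where "g = (\<lambda>j. chi12 j * exp (- (t * (real j)\<^sup>2 / 24)))"
  have "6 * Suc n + 2 = Suc (Suc (Suc (Suc (Suc (Suc (6 * n + 2))))))" by simp
  then have "sum g {..<6 * Suc n + 2} = sum g {..<6*n+2} + g (6*n+2) + g (6*n+3) + g (6*n+4) + g (6*n+5) + g (6*n+6) + g (6*n+7)"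
    by (simp add: numeral_eq_Suc)
  also have "\<dots> = sum g {..<6*n+2} + g (6*n+5) + g (6*n+7)"
    unfolding g_def chi12_near_6 by simp
  finally have sumg: "sum g {..<6 * Suc n + 2} = sum g {..<6*n+2} + g (6*n+5) + g (6*n+7)" .
  have ev: "even (s * (3 * s - 1))" "even (s * (3 * s + 1))" by (auto simp: s_def)
  have r1: "real (s * (3 * s - 1) div 2) = real s * (3 * real s - 1) / 2"
    using ev(1) by (subst real_of_nat_div) (auto simp: s_def of_nat_diff algebra_simps)
  have r2: "real (s * (3 * s + 1) div 2) = real s * (3 * real s + 1) / 2"
    using ev(2) by (subst real_of_nat_div) (auto simp: algebra_simps)
  have e1: "exp (t / 24) * g (6 * n + 5) = (-1) ^ s * exp (-t) ^ (s * (3 * s - 1) div 2)"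
  proof -
    have "t / 24 + - (t * (real (6 * n + 5))\<^sup>2 / 24) = real (s * (3 * s - 1) div 2) * (- t)"
      unfolding r1 unfolding s_def by (simp add: field_simps power2_eq_square)
    then have "exp (t / 24) * exp (- (t * (real (6 * n + 5))\<^sup>2 / 24)) = exp (-t) ^ (s * (3 * s - 1) div 2)"
      by (simp only: exp_add[symmetric] exp_of_nat_mult[symmetric])
    then show ?thesis unfolding g_def chi12_near_6 s_def[symmetric] by (simp only: mult.left_commute)
  qed
  have e2: "exp (t / 24) * g (6 * n + 7) = (-1) ^ s * exp (-t) ^ (s * (3 * s + 1) div 2)"
  proof -
    have "t / 24 + - (t * (real (6 * n + 7))\<^sup>2 / 24) = real (s * (3 * s + 1) div 2) * (- t)"
      unfolding r2 unfolding s_def by (simp add: field_simps power2_eq_square)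
    then have "exp (t / 24) * exp (- (t * (real (6 * n + 7))\<^sup>2 / 24)) = exp (-t) ^ (s * (3 * s + 1) div 2)"
      by (simp only: exp_add[symmetric] exp_of_nat_mult[symmetric])
    then show ?thesis unfolding g_def chi12_near_6 s_def[symmetric] by (simp only: mult.left_commute)
  qed
  have "pent_partial (exp (-t)) (Suc n) = pent_partial (exp (-t)) n
      + (-1) ^ s * (exp (-t) ^ (s * (3 * s - 1) div 2) + exp (-t) ^ (s * (3 * s + 1) div 2))"
    unfolding pent_partial_def s_def by (simp only: sum.cl_ivl_Suc) simp
  also have "\<dots> = exp (t / 24) * sum g {..<6 * Suc n + 2}"
    unfolding Suc sumg g_def[symmetric] distrib_left e1 e2 by simp
  finally show ?case by (simp add: g_def)
qed

lemma psi12_eq: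
  assumes t: "t > 0"
  shows "psi12 t = exp (- t / 24) / partition_gf (exp (-t))"
proof -
  have "(\<lambda>n. \<Sum>j<n. chi12 j * exp (- (t * (real j)\<^sup>2 / 24))) \<longlonglongrightarrow> psi12 t"
    unfolding psi12_def by (rule summable_LIMSEQ[OF summable_psi12[OF t]])
  moreover have "filterlim (\<lambda>n::nat. 6 * n + 2) at_top sequentially"
    by (rule filterlim_subseq) (auto simp: strict_mono_def)
  ultimately have "(\<lambda>n. \<Sum>j<6*n+2. chi12 j * exp (- (t * (real j)\<^sup>2 / 24))) \<longlonglongrightarrow> psi12 t"
    by (rule filterlim_compose)
  then have "(\<lambda>n. exp (t / 24) * (\<Sum>j<6*n+2. chi12 j * exp (- (t * (real j)\<^sup>2 / 24)))) \<longlonglongrightarrow> exp (t / 24) * psi12 t"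
    by (rule tendsto_mult[OF tendsto_const])
  then have "pent_partial (exp (-t)) \<longlonglongrightarrow> exp (t / 24) * psi12 t"
    by (simp only: pent_partial_psi12[symmetric])
  with pent_partial_tendsto[OF t] have "1 / partition_gf (exp (-t)) = exp (t / 24) * psi12 t"
    by (rule LIMSEQ_unique)
  then have "exp (- t / 24) * (exp (t / 24) * psi12 t) = exp (- t / 24) * (1 / partition_gf (exp (-t)))" by simp
  then show ?thesis by (simp add: mult.assoc[symmetric] exp_add[symmetric])
qed

lemma partition_gf_transform:
  assumes t: "t > 0"
  shows "partition_gf (exp (-t)) = sqrt (t / (2 * pi)) * exp (pi\<^sup>2 / (6 * t) - t / 24) * partition_gf (exp (- (4 * pi\<^sup>2 / t)))"
proof -
  define A where "A = partition_gf (exp (-t))"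
  define B where "B = partition_gf (exp (- (4 * pi\<^sup>2 / t)))"
  have t': "4 * pi\<^sup>2 / t > 0" using t by simp
  have AB: "A > 0" "B > 0"
    using partition_gf_ge_1[OF t] partition_gf_ge_1[OF t'] by (auto simp: A_def B_def)
  have "exp (- (4 * pi\<^sup>2 / t) / 24) / B = sqrt (t / (2 * pi)) * (exp (- t / 24) / A)"
    using psi12_transform[OF t] psi12_eq[OF t] psi12_eq[OF t'] by (simp add: A_def B_def)
  then have "A * exp (- (4 * pi\<^sup>2 / t) / 24) = sqrt (t / (2 * pi)) * exp (- t / 24) * B"
    using AB by (simp add: field_simps)
  then have "A * exp (- (4 * pi\<^sup>2 / t) / 24) * exp (pi\<^sup>2 / (6 * t))
     = sqrt (t / (2 * pi)) * (exp (pi\<^sup>2 / (6 * t)) * exp (- t / 24)) * B" by (simp only: mult_ac)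
  moreover have "exp (- (4 * pi\<^sup>2 / t) / 24) * exp (pi\<^sup>2 / (6 * t)) = 1"
    using t by (simp add: exp_add[symmetric])
  ultimately have "A = sqrt (t / (2 * pi)) * exp (pi\<^sup>2 / (6 * t) + - t / 24) * B"
    by (simp only: exp_add mult.assoc mult_1_right)
  then show ?thesis by (simp add: A_def B_def)
qed

section \<open>Extension to the right half-plane\<close>

definition partition_fps :: "complex fps" where
  "partition_fps = Abs_fps (\<lambda>n. of_nat (partition_p n))"

definition partition_fun :: "complex \<Rightarrow> complex" where
  "partition_fun w = eval_fps partition_fps (exp (-w))"

lemma partition_fps_conv_radius: "fps_conv_radius partition_fps \<ge> 1"
  unfolding fps_conv_radius_def partition_fps_def fps_nth_Abs_fps
proof (rule conv_radius_geI_ex')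
  fix r :: real assume r: "0 < r" "ereal r < 1"
  define s where "s = - ln r"
  have s: "s > 0" "exp (-s) = r" using r by (auto simp: s_def)
  have "summable (\<lambda>n. real (partition_p n) * r ^ n)" using summable_partition_exp[OF s(1)] s(2) by simp
  then have "summable (\<lambda>n. complex_of_real (real (partition_p n) * r ^ n))" by (rule summable_of_real)
  then show "summable (\<lambda>n. complex_of_nat (partition_p n) * complex_of_real r ^ n)" by simp
qed

lemma exp_minus_in_conv:
  assumes "Re w > 0"
  shows "ereal (norm (exp (-w))) < fps_conv_radius partition_fps"
proof -
  have "ereal (norm (exp (-w))) < 1" using assms by (simp add: norm_exp_eq_Re)
  then show ?thesis using partition_fps_conv_radius by (rule less_le_trans)
qed

lemma partition_fun_sums:
  assumes "Re w > 0"
  shows "(\<lambda>n. of_nat (partition_p n) * exp (-w) ^ n) sums partition_fun w"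
  using sums_eval_fps[OF exp_minus_in_conv[OF assms]] by (simp add: partition_fun_def partition_fps_def)

lemma partition_fun_of_real:
  assumes "t > 0"
  shows "partition_fun (of_real t) = of_real (partition_gf (exp (-t)))"
proof -
  have "(\<lambda>n. real (partition_p n) * exp (-t) ^ n) sums partition_gf (exp (-t))"
    unfolding partition_gf_def by (rule summable_sums[OF summable_partition_exp[OF assms]])
  then have "(\<lambda>n. complex_of_real (real (partition_p n) * exp (-t) ^ n)) sums of_real (partition_gf (exp (-t)))"
    by (rule sums_of_real)
  then have "(\<lambda>n. of_nat (partition_p n) * exp (- complex_of_real t) ^ n) sums of_real (partition_gf (exp (-t)))"
    by (simp add: exp_of_real[symmetric])
  moreover have "(\<lambda>n. of_nat (partition_p n) * exp (- complex_of_real t) ^ n) sums partition_fun (of_real t)"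
    by (rule partition_fun_sums) (use assms in simp)
  ultimately show ?thesis by (rule sums_unique2[symmetric])
qed

lemma partition_fun_holomorphic: "partition_fun holomorphic_on {w. Re w > 0}"
proof -
  have "(eval_fps partition_fps \<circ> (\<lambda>w. exp (-w))) holomorphic_on {w. Re w > 0}"
    by (rule holomorphic_on_compose_gen[where t = "eball 0 (fps_conv_radius partition_fps)"])
       (auto intro!: holomorphic_intros simp: in_eball_iff dest!: exp_minus_in_conv)
  then show ?thesis by (simp add: o_def partition_fun_def[abs_def])
qed

lemma Re_inverse_pos:
  assumes "Re w > 0" "c > 0" shows "Re (of_real c / w) > 0"
proof -
  have "w \<noteq> 0" using assms by auto
  then have "(Re w)\<^sup>2 + (Im w)\<^sup>2 > 0" by (simp add: complex_eq_iff sum_power2_gt_zero_iff)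
  then show ?thesis using assms by (simp add: Re_divide)
qed

text \<open>Both sides are holomorphic for \<open>Re w > 0\<close>, a half-plane that is preserved
  by \<open>4 * pi^2 / w\<close>, and they agree on the positive reals, which accumulate at 1; the
  identity theorem does the rest. The principal root is holomorphic there because
  \<open>w / (2 * pi)\<close> avoids the negative axis.\<close>

lemma partition_fun_transform:
  assumes w: "Re w > 0"
  shows "partition_fun w = csqrt (w / of_real (2 * pi)) * exp (of_real (pi\<^sup>2 / 6) / w - w / 24)
            * partition_fun (of_real (4 * pi\<^sup>2) / w)"
proof -
  define S where "S = {w. Re w > 0}"
  define g where "g = (\<lambda>w. csqrt (w / of_real (2 * pi)) * exp (of_real (pi\<^sup>2 / 6) / w - w / 24)
            * partition_fun (of_real (4 * pi\<^sup>2) / w))"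
  have "(partition_fun \<circ> (\<lambda>w. of_real (4 * pi\<^sup>2) / w)) holomorphic_on S"
  proof (rule holomorphic_on_compose_gen[where t = S])
    show "(\<lambda>w. complex_of_real (4 * pi\<^sup>2) / w) holomorphic_on S"
      by (auto intro!: holomorphic_intros simp: S_def)
    show "(\<lambda>w. complex_of_real (4 * pi\<^sup>2) / w) ` S \<subseteq> S"
      using Re_inverse_pos[of _ "4 * pi\<^sup>2"] by (auto simp: S_def)
  qed (use partition_fun_holomorphic in \<open>simp add: S_def\<close>)
  then have h1: "(\<lambda>w. partition_fun (of_real (4 * pi\<^sup>2) / w)) holomorphic_on S" by (simp add: o_def)
  have h2: "(\<lambda>w. csqrt (w / of_real (2 * pi))) holomorphic_on S"
  proof (intro holomorphic_intros)
    fix w assume "w \<in> S"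
    then have "Re (w / of_real (2 * pi)) > 0" unfolding S_def Re_divide_of_real by simp
    then show "w / complex_of_real (2 * pi) \<notin> \<real>\<^sub>\<le>\<^sub>0" by (auto simp only: complex_nonpos_Reals_iff)
  qed simp
  have h3: "(\<lambda>w. exp (of_real (pi\<^sup>2 / 6) / w - w / 24)) holomorphic_on S"
    by (auto intro!: holomorphic_intros simp: S_def)
  have "(\<lambda>w. partition_fun w - g w) holomorphic_on S"
    unfolding g_def
    by (rule holomorphic_on_diff[OF partition_fun_holomorphic[folded S_def]
          holomorphic_on_mult[OF holomorphic_on_mult[OF h2 h3] h1]])
  moreover have "open S" unfolding S_def by (rule open_halfspace_Re_gt)
  moreover have "connected S" unfolding S_def by (intro convex_connected convex_halfspace_Re_gt)
  moreover have "of_real ` {0<..} \<subseteq> S" by (auto simp: S_def)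
  moreover have "1 \<in> S" by (simp add: S_def)
  moreover have "(1::complex) islimpt of_real ` {0<..}"
    unfolding islimpt_approachable
  proof (intro allI impI)
    fix e :: real assume e: "e > 0"
    show "\<exists>x'\<in>complex_of_real ` {0<..}. x' \<noteq> 1 \<and> dist x' 1 < e"
    proof (intro bexI conjI)
      have d: "complex_of_real (1 + e / 2) - 1 = of_real (e / 2)" by simp
      show "dist (complex_of_real (1 + e / 2)) 1 < e" unfolding dist_norm d norm_of_real using e by simp
      show "complex_of_real (1 + e / 2) \<noteq> 1" using e by (simp add: complex_eq_iff)
      show "complex_of_real (1 + e / 2) \<in> complex_of_real ` {0<..}" using e by (intro imageI) simp
    qed
  qed
  moreover have "partition_fun z - g z = 0" if z: "z \<in> of_real ` {0<..}" for z
  proof -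
    obtain t where t: "z = of_real t" "t > 0" using z by auto
    have "g z = of_real (sqrt (t / (2 * pi)) * exp (pi\<^sup>2 / (6 * t) - t / 24) * partition_gf (exp (- (4 * pi\<^sup>2 / t))))"
    proof -
      have "csqrt (z / of_real (2 * pi)) = of_real (sqrt (t / (2 * pi)))"
      proof -
        have "z / of_real (2 * pi) = of_real (t / (2 * pi))" using t(1) by simp
        then show ?thesis using of_real_sqrt[of "t / (2 * pi)"] t(2) by simp
      qed
      moreover have "exp (of_real (pi\<^sup>2 / 6) / z - z / 24) = of_real (exp (pi\<^sup>2 / (6 * t) - t / 24))"
      proof -
        have "of_real (pi\<^sup>2 / 6) / z - z / 24 = of_real (pi\<^sup>2 / (6 * t) - t / 24)" using t(1) by simp
        then show ?thesis by (simp only: exp_of_real)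
      qed
      moreover have "partition_fun (of_real (4 * pi\<^sup>2) / z) = of_real (partition_gf (exp (- (4 * pi\<^sup>2 / t))))"
        using partition_fun_of_real[of "4 * pi\<^sup>2 / t"] t by simp
      ultimately show ?thesis by (simp add: g_def)
    qed
    then show ?thesis using partition_gf_transform[OF t(2)] partition_fun_of_real[OF t(2)] t(1) by simp
  qed
  moreover have "w \<in> S" using w by (simp add: S_def)
  ultimately have "partition_fun w - g w = 0" by (rule analytic_continuation)
  then show ?thesis by (simp add: g_def)
qed

section \<open>The contour integral\<close>

text \<open>The primitive is normalised by \<open>G 0 = 0\<close>, hence \<open>sqrt pi / 2\<close>
  times the imaginary error function. On the ray upwards from a point with real part
  \<open>x\<close> and imaginary part \<open>y\<close> the integrand is at most
  \<open>exp (x^2 - y^2 - 2 * y * s)\<close>, whose integral is the stated bound, and the limit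
  along the ray is the one along the imaginary axis, a Gaussian integral. The lower half-plane
  follows since \<open>G\<close> is odd.\<close>

lemma gauss_primitive:
  obtains G :: "complex \<Rightarrow> complex"
  where "\<And>z. (G has_field_derivative exp (z\<^sup>2)) (at z)"
    and "\<And>z. Im z > 0 \<Longrightarrow> norm (G z - \<i> * of_real (sqrt pi / 2)) \<le> exp (Re (z\<^sup>2)) / (2 * Im z)"
    and "\<And>z. Im z < 0 \<Longrightarrow> norm (G z + \<i> * of_real (sqrt pi / 2)) \<le> exp (Re (z\<^sup>2)) / (2 * - Im z)"
proof -
  obtain H where H: "\<And>z::complex. z \<in> UNIV \<Longrightarrow> (H has_field_derivative exp (z\<^sup>2)) (at z within UNIV)"
    by (rule holomorphic_convex_primitive'[of UNIV "\<lambda>z. exp (z\<^sup>2)"]) (auto intro!: holomorphic_intros)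
  define G where "G = (\<lambda>z. H z - H 0)"
  have G: "(G has_field_derivative exp (z\<^sup>2)) (at z)" for z
    unfolding G_def using H[of z] by (auto intro!: derivative_eq_intros)
  have G0: "G 0 = 0" by (simp add: G_def)
  have G_line: "((\<lambda>s. G (z + of_real s * \<i>)) has_vector_derivative \<i> * exp ((z + of_real s * \<i>)\<^sup>2)) (at s)" for z s
  proof -
    have "((\<lambda>s. z + of_real s * \<i>) has_vector_derivative \<i>) (at s)"
      by (auto intro!: derivative_eq_intros simp: has_vector_derivative_def scaleR_conv_of_real)
    from field_vector_diff_chain_at[OF this G] show ?thesis by (simp add: o_def)
  qed
  have lim_i: "((\<lambda>T. G (of_real T * \<i>)) \<longlongrightarrow> \<i> * of_real (sqrt pi / 2)) at_top"
  proof -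
    have int: "integrable lborel (\<lambda>x::real. indicator {0..} x *\<^sub>R exp (- x\<^sup>2))"
      and val: "(\<integral>x. indicator {0..} x *\<^sub>R exp (- x\<^sup>2) \<partial>lborel) = sqrt pi / 2"
      using gaussian_moment_0 by (auto simp: has_bochner_integral_iff)
    have "((\<lambda>T. \<integral>x. indicator {..T} x *\<^sub>R (indicator {0..} x *\<^sub>R exp (- x\<^sup>2)) \<partial>lborel) \<longlongrightarrow> sqrt pi / 2) at_top"
      using tendsto_integral_at_top[OF sets_lborel int] unfolding val .
    moreover have "(\<integral>x. indicator {..T} x *\<^sub>R (indicator {0..} x *\<^sub>R exp (- x\<^sup>2)) \<partial>lborel) = integral {0..T} (\<lambda>x. exp (- x\<^sup>2))" for T :: real
    proof -
      have "set_integrable lborel {0..T} (\<lambda>x::real. exp (- x\<^sup>2))"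
        by (rule borel_integrable_atLeastAtMost') (auto intro!: continuous_intros)
      from set_borel_integral_eq_integral(2)[OF this]
      have "(LINT x:{0..T}|lborel. exp (- x\<^sup>2)) = integral {0..T} (\<lambda>x. exp (- x\<^sup>2))" .
      moreover have "indicator {..T} x *\<^sub>R (indicator {0..} x *\<^sub>R exp (- x\<^sup>2)) = indicator {0..T} x *\<^sub>R exp (- x\<^sup>2)" for x :: real
        by (auto simp: indicator_def)
      ultimately show ?thesis by (simp only: set_lebesgue_integral_def)
    qed
    ultimately have lim: "((\<lambda>T. integral {0..T} (\<lambda>x. exp (- x\<^sup>2))) \<longlongrightarrow> sqrt pi / 2) at_top" by simp
    have eq: "G (of_real T * \<i>) = \<i> * of_real (integral {0..T} (\<lambda>x. exp (- x\<^sup>2)))" if "T \<ge> 0" for T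
    proof -
      have "((\<lambda>s. \<i> * exp ((0 + complex_of_real s * \<i>)\<^sup>2)) has_integral G (0 + of_real T * \<i>) - G (0 + of_real 0 * \<i>)) {0..T}"
        by (rule fundamental_theorem_of_calculus[OF that]) (use G_line in \<open>blast intro: has_vector_derivative_at_within\<close>)
      then have 1: "((\<lambda>s. \<i> * of_real (exp (- s\<^sup>2))) has_integral G (of_real T * \<i>)) {0..T}"
        by (simp add: G0 power_mult_distrib exp_of_real[symmetric])
      have "(\<lambda>x::real. exp (- x\<^sup>2)) integrable_on {0..T}"
        by (intro integrable_continuous_real continuous_intros)
      then have "((\<lambda>x::real. exp (- x\<^sup>2)) has_integral integral {0..T} (\<lambda>x. exp (- x\<^sup>2))) {0..T}"
        by (rule integrable_integral)
      then have "((\<lambda>s. \<i> * of_real (exp (- s\<^sup>2))) has_integral \<i> * of_real (integral {0..T} (\<lambda>x. exp (- x\<^sup>2)))) {0..T}"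
        by (intro has_integral_mult_right has_integral_of_real)
      with 1 show ?thesis by (rule has_integral_unique)
    qed
    have "((\<lambda>T. \<i> * complex_of_real (integral {0..T} (\<lambda>x. exp (- x\<^sup>2)))) \<longlongrightarrow> \<i> * of_real (sqrt pi / 2)) at_top"
      by (intro tendsto_intros lim)
    then show ?thesis
    proof (rule Lim_transform_eventually)
      show "\<forall>\<^sub>F T in at_top. \<i> * complex_of_real (integral {0..T} (\<lambda>x. exp (- x\<^sup>2))) = G (of_real T * \<i>)"
        using eventually_ge_at_top[of 0] by eventually_elim (simp add: eq)
    qed
  qed
  have upper: "norm (G z - \<i> * of_real (sqrt pi / 2)) \<le> exp (Re (z\<^sup>2)) / (2 * Im z)" if z: "Im z > 0" for z
  proof -
    define x y where "x = Re z" and "y = Im z"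
    have y: "y > 0" using z by (simp add: y_def)
    have Rez: "Re (z\<^sup>2) = x\<^sup>2 - y\<^sup>2" by (simp add: x_def y_def power2_eq_square)
    have bd: "norm (G (z + of_real T * \<i>) - G z) \<le> exp (x\<^sup>2 - y\<^sup>2) / (2 * y)" if T: "T > 0" for T
    proof -
      define \<phi> where "\<phi> = (\<lambda>s::real. - exp (x\<^sup>2 - y\<^sup>2 - 2 * y * s) / (2 * y))"
      have "norm (G (z + of_real T * \<i>) - G (z + of_real 0 * \<i>)) \<le> \<phi> T - \<phi> 0"
      proof (rule differentiable_bound_general[OF T, where f' = "\<lambda>s. \<i> * exp ((z + of_real s * \<i>)\<^sup>2)" and \<phi>' = "\<lambda>s. exp (x\<^sup>2 - y\<^sup>2 - 2 * y * s)"])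
        show "continuous_on {0..T} (\<lambda>s. G (z + of_real s * \<i>))"
          by (intro continuous_at_imp_continuous_on ballI has_vector_derivative_continuous[OF G_line])
        show "continuous_on {0..T} \<phi>" unfolding \<phi>_def by (intro continuous_intros) (use y in auto)
        fix s assume s: "0 < s" "s < T"
        show "((\<lambda>s. G (z + of_real s * \<i>)) has_vector_derivative \<i> * exp ((z + of_real s * \<i>)\<^sup>2)) (at s)"
          by (rule G_line)
        have "(\<phi> has_real_derivative exp (x\<^sup>2 - y\<^sup>2 - 2 * y * s)) (at s)"
          unfolding \<phi>_def using y by (auto intro!: derivative_eq_intros simp: field_simps)
        then show "(\<phi> has_vector_derivative exp (x\<^sup>2 - y\<^sup>2 - 2 * y * s)) (at s)"
          by (simp add: has_real_derivative_iff_has_vector_derivative)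
        have "Re ((z + of_real s * \<i>)\<^sup>2) = x\<^sup>2 - y\<^sup>2 - 2 * y * s - s\<^sup>2"
          by (simp add: x_def y_def power2_eq_square algebra_simps)
        then show "norm (\<i> * exp ((z + of_real s * \<i>)\<^sup>2)) \<le> exp (x\<^sup>2 - y\<^sup>2 - 2 * y * s)"
          by (simp add: norm_mult)
      qed
      also have "\<dots> \<le> exp (x\<^sup>2 - y\<^sup>2) / (2 * y)" using y by (simp add: \<phi>_def)
      finally show ?thesis by simp
    qed
    \<comment> \<open>The horizontal segment between the imaginary axis and the ray at height
      \<open>y + T\<close>: the integrand tends to 0 on it as \<open>T\<close> grows, so both lines
      share the limit of \<open>G\<close>.\<close>
    have near: "norm (G (z + of_real T * \<i>) - G (of_real (y + T) * \<i>)) \<le> exp (x\<^sup>2 - (y + T)\<^sup>2) * \<bar>x\<bar>" for T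
    proof -
      define S where "S = closed_segment (of_real (y + T) * \<i>) (z + of_real T * \<i>)"
      have "norm (G (z + of_real T * \<i>) - G (of_real (y + T) * \<i>)) \<le> exp (x\<^sup>2 - (y + T)\<^sup>2) * norm ((z + of_real T * \<i>) - of_real (y + T) * \<i>)"
      proof (rule field_differentiable_bound[where S = S and f' = "\<lambda>u. exp (u\<^sup>2)"])
        fix u assume "u \<in> S"
        then obtain r where r: "0 \<le> r" "r \<le> 1" "u = (1 - r) *\<^sub>R (of_real (y + T) * \<i>) + r *\<^sub>R (z + of_real T * \<i>)"
          unfolding S_def in_segment by blast
        have u: "Re u = r * x" "Im u = y + T" unfolding r(3) by (simp_all add: x_def y_def algebra_simps)
        have "(r * x)\<^sup>2 \<le> x\<^sup>2" using r by (simp add: power_mult_distrib power_le_one mult_left_le_one_le)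
        then show "norm (exp (u\<^sup>2)) \<le> exp (x\<^sup>2 - (y + T)\<^sup>2)"
          by (simp add: u norm_exp_eq_Re power2_eq_square)
      qed (auto simp: S_def intro!: has_field_derivative_at_within[OF G])
      also have "(z + of_real T * \<i>) - of_real (y + T) * \<i> = of_real x"
        by (simp add: complex_eq_iff x_def y_def)
      finally show ?thesis by (simp only: norm_of_real)
    qed
    have l1: "((\<lambda>T. G (of_real (y + T) * \<i>)) \<longlongrightarrow> \<i> * of_real (sqrt pi / 2)) at_top"
      by (rule filterlim_compose[OF lim_i]) real_asymp
    have "((\<lambda>T. G (z + of_real T * \<i>) - G (of_real (y + T) * \<i>)) \<longlongrightarrow> 0) at_top"
    proof (rule Lim_null_comparison)
      show "\<forall>\<^sub>F T in at_top. norm (G (z + of_real T * \<i>) - G (of_real (y + T) * \<i>)) \<le> exp (x\<^sup>2 - (y + T)\<^sup>2) * \<bar>x\<bar>"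
        by (intro always_eventually allI near)
      show "((\<lambda>T. exp (x\<^sup>2 - (y + T)\<^sup>2) * \<bar>x\<bar>) \<longlongrightarrow> 0) at_top"
      proof -
        have "((\<lambda>T. exp (x\<^sup>2 - (y + T)\<^sup>2)) \<longlongrightarrow> 0) at_top" by real_asymp
        from tendsto_mult_left_zero[OF this] show ?thesis .
      qed
    qed
    from tendsto_add[OF this l1] have "((\<lambda>T. G (z + of_real T * \<i>)) \<longlongrightarrow> \<i> * of_real (sqrt pi / 2)) at_top" by simp
    then have "((\<lambda>T. norm (G (z + of_real T * \<i>) - G z)) \<longlongrightarrow> norm (\<i> * of_real (sqrt pi / 2) - G z)) at_top"
      by (intro tendsto_intros)
    then have "norm (\<i> * of_real (sqrt pi / 2) - G z) \<le> exp (x\<^sup>2 - y\<^sup>2) / (2 * y)"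
    proof (rule tendsto_upperbound)
      show "\<forall>\<^sub>F T in at_top. norm (G (z + of_real T * \<i>) - G z) \<le> exp (x\<^sup>2 - y\<^sup>2) / (2 * y)"
        using eventually_gt_at_top[of 0] by eventually_elim (rule bd)
    qed simp
    then show ?thesis by (simp add: norm_minus_commute Rez y_def)
  qed
  have odd: "G (- z) = - G z" for z
  proof -
    have "\<exists>c. \<forall>z\<in>UNIV. G z + G (- z) = c"
    proof (rule has_field_derivative_zero_constant)
      fix x :: complex
      have "((\<lambda>z. G (- z)) has_field_derivative exp ((- x)\<^sup>2) * (- 1)) (at x)"
        by (rule DERIV_chain2[OF G]) (auto intro!: derivative_eq_intros)
      from DERIV_add[OF G this] show "((\<lambda>z. G z + G (- z)) has_field_derivative 0) (at x within UNIV)"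
        by simp
    qed simp
    then obtain c where "G z + G (- z) = c" for z by auto
    from this[of 0] this[of z] show ?thesis by (simp add: G0 add_eq_0_iff)
  qed
  have lower: "norm (G z + \<i> * of_real (sqrt pi / 2)) \<le> exp (Re (z\<^sup>2)) / (2 * - Im z)" if z: "Im z < 0" for z
  proof -
    have "norm (G (- z) - \<i> * of_real (sqrt pi / 2)) \<le> exp (Re ((- z)\<^sup>2)) / (2 * Im (- z))"
      by (rule upper) (use z in simp)
    moreover have "norm (G (- z) - \<i> * of_real (sqrt pi / 2)) = norm (G z + \<i> * of_real (sqrt pi / 2))"
      unfolding odd by (metis minus_add_distrib norm_minus_cancel uminus_add_conv_diff add.commute)
    ultimately show ?thesis by simp
  qed
  show thesis by (rule that[OF G upper lower])
qed

section \<open>The coefficient integral over a vertical segment\<close>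

lemma vertical_segment:
  assumes "w \<in> closed_segment (Complex t (-pi)) (Complex t pi)"
  shows "Re w = t" "\<bar>Im w\<bar> \<le> pi"
proof -
  obtain u where u: "0 \<le> u" "u \<le> 1" "w = (1 - u) *\<^sub>R Complex t (-pi) + u *\<^sub>R Complex t pi"
    using assms unfolding in_segment by blast
  show "Re w = t" unfolding u(3) by (simp add: algebra_simps)
  have "Im w = (2 * u - 1) * pi" unfolding u(3) by (simp add: algebra_simps)
  moreover have "\<bar>2 * u - 1\<bar> \<le> 1" using u by linarith
  ultimately show "\<bar>Im w\<bar> \<le> pi" by (simp add: abs_mult mult_left_le_one_le)
qed

lemma exp_contour_integral:
  fixes m :: int and t :: real
  shows "((\<lambda>w. exp (of_int m * w)) has_contour_integral (if m = 0 then 2 * of_real pi * \<i> else 0))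
           (linepath (Complex t (-pi)) (Complex t pi))"
proof (cases "m = 0")
  case True
  have "Complex t pi - Complex t (-pi) = 2 * of_real pi * \<i>" by (simp add: complex_eq_iff)
  moreover have "((\<lambda>w. 1) has_contour_integral 1 * (Complex t pi - Complex t (-pi))) (linepath (Complex t (-pi)) (Complex t pi))"
    by (rule has_contour_integral_const_linepath)
  ultimately show ?thesis using True by simp
next
  case False
  let ?F = "\<lambda>w. exp (of_int m * w) / of_int m :: complex"
  have "((\<lambda>w. exp (of_int m * w)) has_contour_integral
      (?F (pathfinish (linepath (Complex t (-pi)) (Complex t pi))) - ?F (pathstart (linepath (Complex t (-pi)) (Complex t pi)))))
      (linepath (Complex t (-pi)) (Complex t pi))"
    by (rule contour_integral_primitive[of UNIV]) (use False in \<open>auto intro!: derivative_eq_intros\<close>)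
  moreover have "exp (of_int m * Complex t pi) = exp (of_int m * Complex t (-pi))"
    unfolding exp_eq by (intro exI[of _ m]) (simp add: complex_eq_iff algebra_simps)
  ultimately show ?thesis using False by simp
qed

text \<open>Cauchy's formula in exponential form: on the segment
  \<open>norm (exp (- w)) = exp (- t)\<close>, so the power series converges uniformly, and
  integration over a full period of length \<open>2 * pi\<close> kills every term except
  \<open>k = n\<close>.\<close>

lemma partition_coeff_integral:
  assumes t: "t > 0"
  shows "((\<lambda>w. partition_fun w * exp (of_nat n * w)) has_contour_integral (2 * of_real pi * \<i> * of_nat (partition_p n)))
           (linepath (Complex t (-pi)) (Complex t pi))"
proof -
  define \<gamma> where "\<gamma> = linepath (Complex t (-pi)) (Complex t pi)"
  have Re_path: "Re w = t" if "w \<in> path_image \<gamma>" for w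
    using that vertical_segment(1) by (simp add: \<gamma>_def)
  define f where "f = (\<lambda>k w. of_nat (partition_p k) * exp (-w) ^ k * exp (of_nat n * w) :: complex)"
  have f_eq: "f k w = of_nat (partition_p k) * exp (of_int (int n - int k) * w)" for k w
  proof -
    have "exp (-w) ^ k * exp (of_nat n * w) = exp (of_int (int n - int k) * w)"
      by (simp add: exp_of_nat_mult[symmetric] exp_add[symmetric] algebra_simps)
    then show ?thesis by (simp add: f_def mult.assoc)
  qed
  have f_int: "(f k has_contour_integral (if k = n then 2 * of_real pi * \<i> * of_nat (partition_p n) else 0)) \<gamma>" for k
    using has_contour_integral_lmul[OF exp_contour_integral[of "int n - int k" t], of "of_nat (partition_p k)"]
    by (auto simp: f_eq[abs_def] \<gamma>_def mult_ac)
  have s_int: "((\<lambda>w. \<Sum>k<N. f k w) has_contour_integral (\<Sum>k<N. if k = n then 2 * of_real pi * \<i> * of_nat (partition_p n) else 0)) \<gamma>" for N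
    by (rule has_contour_integral_sum) (auto simp: f_int)
  have sums: "(\<lambda>k. f k w) sums (partition_fun w * exp (of_nat n * w))" if "w \<in> path_image \<gamma>" for w
    unfolding f_def by (rule sums_mult2[OF partition_fun_sums]) (use Re_path[OF that] t in simp)
  have "uniform_limit (path_image \<gamma>) (\<lambda>N w. \<Sum>k<N. f k w) (\<lambda>w. \<Sum>k. f k w) sequentially"
  proof (rule Weierstrass_m_test)
    fix k w assume "w \<in> path_image \<gamma>"
    then have "Re w = t" by (rule Re_path)
    then show "norm (f k w) \<le> real (partition_p k) * exp (-t) ^ k * exp (real n * t)"
      by (simp add: f_def norm_mult norm_power norm_exp_eq_Re)
  next
    show "summable (\<lambda>k. real (partition_p k) * exp (-t) ^ k * exp (real n * t))"
      by (rule summable_mult2[OF summable_partition_exp[OF t]])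
  qed
  then have ul: "uniform_limit (path_image \<gamma>) (\<lambda>N w. \<Sum>k<N. f k w) (\<lambda>w. partition_fun w * exp (of_nat n * w)) sequentially"
    by (rule uniform_limit_cong'[THEN iffD1, rotated -1]) (auto simp: sums_unique[OF sums])
  have ev: "eventually (\<lambda>N. (\<lambda>w. \<Sum>k<N. f k w) contour_integrable_on \<gamma>) sequentially"
    using s_int by (intro always_eventually allI) (auto simp: contour_integrable_on_def)
  have B: "norm (vector_derivative \<gamma> (at x)) \<le> norm (Complex t pi - Complex t (-pi))" for x
    by (simp add: \<gamma>_def)
  note lim = contour_integral_uniform_limit[OF ev ul B]
  have 1: "(\<lambda>w. partition_fun w * exp (of_nat n * w)) contour_integrable_on \<gamma>"
    by (rule lim(1)) (auto simp: \<gamma>_def)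
  have 2: "(\<lambda>N. contour_integral \<gamma> (\<lambda>w. \<Sum>k<N. f k w)) \<longlonglongrightarrow> contour_integral \<gamma> (\<lambda>w. partition_fun w * exp (of_nat n * w))"
    by (rule lim(2)) (auto simp: \<gamma>_def)
  have "(\<lambda>N. contour_integral \<gamma> (\<lambda>w. \<Sum>k<N. f k w)) \<longlonglongrightarrow> 2 * of_real pi * \<i> * of_nat (partition_p n)"
  proof (rule tendsto_eventually)
    show "\<forall>\<^sub>F N in sequentially. contour_integral \<gamma> (\<lambda>w. \<Sum>k<N. f k w) = 2 * of_real pi * \<i> * of_nat (partition_p n)"
      using eventually_gt_at_top[of n]
    proof eventually_elim
      case (elim N)
      then show ?case using contour_integral_unique[OF s_int[of N]] by (simp add: sum.delta)
    qed
  qed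
  with 2 have "contour_integral \<gamma> (\<lambda>w. partition_fun w * exp (of_nat n * w)) = 2 * of_real pi * \<i> * of_nat (partition_p n)"
    by (rule LIMSEQ_unique)
  with has_contour_integral_integral[OF 1] show ?thesis by (simp add: \<gamma>_def)
qed

section \<open>The contribution of the dual factor\<close>

lemma norm_partition_fun_minus_1:
  assumes "Re u > 0"
  shows "norm (partition_fun u - 1) \<le> partition_gf (exp (- Re u)) - 1"
proof -
  have 1: "(\<lambda>k. of_nat (partition_p (Suc k)) * exp (-u) ^ Suc k) sums (partition_fun u - 1)"
    using partition_fun_sums[OF assms] by (subst sums_Suc_iff) (simp add: partition_p_0)
  have "(\<lambda>k. real (partition_p k) * exp (- Re u) ^ k) sums partition_gf (exp (- Re u))"
    unfolding partition_gf_def by (rule summable_sums[OF summable_partition_exp[OF assms]])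
  then have 2: "(\<lambda>k. real (partition_p (Suc k)) * exp (- Re u) ^ Suc k) sums (partition_gf (exp (- Re u)) - 1)"
    by (subst sums_Suc_iff) (simp add: partition_p_0)
  have "norm (\<Sum>k. of_nat (partition_p (Suc k)) * exp (-u) ^ Suc k) \<le> (\<Sum>k. real (partition_p (Suc k)) * exp (- Re u) ^ Suc k)"
    by (rule norm_suminf_le[OF _ sums_summable[OF 2]])
       (simp only: norm_mult norm_power norm_of_nat norm_exp_eq_Re uminus_complex.sel order_refl)
  then show ?thesis using sums_unique[OF 1] sums_unique[OF 2] by simp
qed

text \<open>With the constant term 1 removed, every remaining term gains at least one factor
  \<open>exp (s1 - s)\<close>.\<close>

lemma partition_gf_decay:
  assumes "0 < s1" "s1 \<le> s"
  shows "partition_gf (exp (-s)) - 1 \<le> exp (s1 - s) * (partition_gf (exp (-s1)) - 1)"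
proof -
  have sums: "(\<lambda>k. real (partition_p (Suc k)) * exp (- x) ^ Suc k) sums (partition_gf (exp (- x)) - 1)" if "x > 0" for x
  proof -
    have "(\<lambda>k. real (partition_p k) * exp (- x) ^ k) sums partition_gf (exp (- x))"
      unfolding partition_gf_def by (rule summable_sums[OF summable_partition_exp[OF that]])
    then show ?thesis by (subst sums_Suc_iff) (simp add: partition_p_0)
  qed
  show ?thesis
  proof (rule sums_le[OF _ sums sums_mult[OF sums]])
    fix k
    have "exp (- s) ^ Suc k = exp (s1 - s) ^ Suc k * exp (- s1) ^ Suc k"
      by (simp only: power_mult_distrib[symmetric] exp_add[symmetric]) simp
    also have "\<dots> \<le> exp (s1 - s) ^ 1 * exp (- s1) ^ Suc k"
      using assms by (intro mult_right_mono power_decreasing) auto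
    finally show "real (partition_p (Suc k)) * exp (- s) ^ Suc k \<le> exp (s1 - s) * (real (partition_p (Suc k)) * exp (- s1) ^ Suc k)"
      by (simp only: mult.left_commute[of "exp (s1 - s)"] power_one_right) (intro mult_left_mono, auto)
  qed (use assms in auto)
qed

text \<open>In the application \<open>R\<close> is the real part of \<open>1 / w\<close>, and the
  left side is the dual factor minus 1, together with the growth that the main exponential owes to
  \<open>R\<close>. The cases split at \<open>4 * pi^2 * R = 2 * pi\<close>, the fixed point of the
  map from \<open>s\<close> to \<open>4 * pi^2 / s\<close>. Below it the crude bound on the
  generating function gives \<open>exp (1 / (24 * R))\<close>; above it the decay
  \<open>exp (- 4 * pi^2 * R)\<close> outweighs \<open>exp (pi^2 * R / 6)\<close>.\<close>

lemma dual_bound: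
  assumes R: "R > 0"
  shows "exp (pi\<^sup>2 / 6 * R) * (partition_gf (exp (- (4 * pi\<^sup>2 * R))) - 1) \<le> exp (pi / 6 + 1 / (24 * R))"
proof (cases "R \<le> 1 / (2 * pi)")
  case True
  have s: "4 * pi\<^sup>2 * R > 0" using R by simp
  have "partition_gf (exp (- (4 * pi\<^sup>2 * R))) \<le> exp (pi\<^sup>2 / (6 * (4 * pi\<^sup>2 * R)))" by (rule partition_gf_le[OF s])
  also have "pi\<^sup>2 / (6 * (4 * pi\<^sup>2 * R)) = 1 / (24 * R)" by simp
  finally have 1: "partition_gf (exp (- (4 * pi\<^sup>2 * R))) - 1 \<le> exp (1 / (24 * R))" by simp
  have "pi\<^sup>2 / 6 * R \<le> pi\<^sup>2 / 6 * (1 / (2 * pi))" using True by (intro mult_left_mono) auto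
  also have "\<dots> = pi / 12" by (simp add: power2_eq_square)
  also have "\<dots> \<le> pi / 6" by simp
  finally have "exp (pi\<^sup>2 / 6 * R) \<le> exp (pi / 6)" by simp
  then have "exp (pi\<^sup>2 / 6 * R) * (partition_gf (exp (- (4 * pi\<^sup>2 * R))) - 1) \<le> exp (pi / 6) * exp (1 / (24 * R))"
    using 1 partition_gf_ge_1[OF s] by (intro mult_mono) auto
  then show ?thesis by (simp add: exp_add)
next
  case False
  have s: "2 * pi \<le> 4 * pi\<^sup>2 * R" using False by (simp add: field_simps power2_eq_square)
  have "partition_gf (exp (- (2 * pi))) \<le> exp (pi\<^sup>2 / (6 * (2 * pi)))" by (rule partition_gf_le) simp
  also have "pi\<^sup>2 / (6 * (2 * pi)) = pi / 12" by (simp add: power2_eq_square)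
  finally have "partition_gf (exp (- (2 * pi))) - 1 \<le> exp (pi / 12)" by simp
  then have "exp (2 * pi - 4 * pi\<^sup>2 * R) * (partition_gf (exp (- (2 * pi))) - 1) \<le> exp (2 * pi - 4 * pi\<^sup>2 * R) * exp (pi / 12)"
    by (intro mult_left_mono) auto
  then have "partition_gf (exp (- (4 * pi\<^sup>2 * R))) - 1 \<le> exp (2 * pi - 4 * pi\<^sup>2 * R) * exp (pi / 12)"
    using partition_gf_decay[OF _ s] pi_gt_zero by linarith
  then have "exp (pi\<^sup>2 / 6 * R) * (partition_gf (exp (- (4 * pi\<^sup>2 * R))) - 1)
      \<le> exp (pi\<^sup>2 / 6 * R) * (exp (2 * pi - 4 * pi\<^sup>2 * R) * exp (pi / 12))"
    by (intro mult_left_mono) auto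
  also have "\<dots> = exp (pi\<^sup>2 / 6 * R + (2 * pi - 4 * pi\<^sup>2 * R) + pi / 12)" by (simp only: exp_add mult.assoc)
  also have "\<dots> \<le> exp (pi / 6 + 1 / (24 * R))"
  proof -
    have "(4 - 1 / 6) * pi\<^sup>2 * R \<ge> (4 - 1 / 6) * pi\<^sup>2 * (1 / (2 * pi))" using False by (intro mult_left_mono) auto
    also have "(4 - 1 / 6) * pi\<^sup>2 * (1 / (2 * pi)) = (2 - 1 / 12) * pi" by (simp add: power2_eq_square)
    finally have "pi\<^sup>2 / 6 * R + (2 * pi - 4 * pi\<^sup>2 * R) + pi / 12 \<le> pi / 6" by (simp add: algebra_simps)
    moreover have "1 / (24 * R) > 0" using R by simp
    ultimately show ?thesis by (simp only: exp_le_cancel_iff)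
  qed
  finally show ?thesis .
qed

section \<open>An explicit primitive for the main part\<close>

lemma main_primitive_deriv:
  fixes G :: "complex \<Rightarrow> complex" and sa sn m :: real
  assumes G: "\<And>z. (G has_field_derivative exp (z\<^sup>2)) (at z)"
    and sa: "sa > 0" and sn: "sn > 0" and m: "m = 2 * sa * sn" and w: "Re w > 0"
  shows "((\<lambda>w. (csqrt w * exp (of_real (sn\<^sup>2) * w + of_real (sa\<^sup>2) / w)
            + of_real (sa * (1 - 1 / m) * exp m) * G (of_real sn * csqrt w - of_real sa / csqrt w)
            - of_real (sa * (1 + 1 / m) * exp (-m)) * G (of_real sn * csqrt w + of_real sa / csqrt w)) / of_real (sn\<^sup>2))
          has_field_derivative csqrt w * exp (of_real (sn\<^sup>2) * w + of_real (sa\<^sup>2) / w)) (at w)"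
proof -
  define v where "v = csqrt w"
  have w0: "w \<noteq> 0" using w by auto
  have v0: "v \<noteq> 0" using w0 by (simp add: v_def)
  have wv: "w = v\<^sup>2" by (simp add: v_def)
  have wn: "w \<notin> \<real>\<^sub>\<le>\<^sub>0" using w by (auto simp: complex_nonpos_Reals_iff)
  define E where "E = of_real (sn\<^sup>2) * w + of_real (sa\<^sup>2) / w"
  have dv: "(csqrt has_field_derivative 1 / (2 * v)) (at w)"
    using has_field_derivative_csqrt[OF wn] by (simp add: v_def inverse_eq_divide)
  have dE: "((\<lambda>w. of_real (sn\<^sup>2) * w + of_real (sa\<^sup>2) / w) has_field_derivative (of_real (sn\<^sup>2) - of_real (sa\<^sup>2) / w\<^sup>2)) (at w)"
    using w0 by (auto intro!: derivative_eq_intros simp: power2_eq_square)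
  have d1: "((\<lambda>w. csqrt w * exp (of_real (sn\<^sup>2) * w + of_real (sa\<^sup>2) / w)) has_field_derivative
      (exp E / (2 * v) + v * (exp E * (of_real (sn\<^sup>2) - of_real (sa\<^sup>2) / w\<^sup>2)))) (at w)"
    by (rule DERIV_cong[OF DERIV_mult[OF dv DERIV_chain2[OF DERIV_exp dE]]]) (simp add: E_def v_def algebra_simps)
  have dA1: "((\<lambda>w. of_real sn * csqrt w - of_real sa / csqrt w) has_field_derivative ((of_real sn + of_real sa / v\<^sup>2) / (2 * v))) (at w)"
    by (rule DERIV_cong[OF DERIV_diff[OF DERIV_cmult[OF dv] DERIV_divide[OF DERIV_const dv]]])
       (use v0 in \<open>auto simp: v_def[symmetric] field_simps power2_eq_square\<close>)
  have dA2: "((\<lambda>w. of_real sn * csqrt w + of_real sa / csqrt w) has_field_derivative ((of_real sn - of_real sa / v\<^sup>2) / (2 * v))) (at w)"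
    by (rule DERIV_cong[OF DERIV_add[OF DERIV_cmult[OF dv] DERIV_divide[OF DERIV_const dv]]])
       (use v0 in \<open>auto simp: v_def[symmetric] field_simps power2_eq_square\<close>)
  have x1: "of_real (exp m) * exp ((of_real sn * v - of_real sa / v)\<^sup>2) = exp E"
  proof -
    have "of_real m + (of_real sn * v - of_real sa / v)\<^sup>2 = E"
      using v0 by (simp add: E_def wv m power2_eq_square field_simps)
    then show ?thesis by (simp only: exp_of_real[symmetric] exp_add[symmetric])
  qed
  have x2: "of_real (exp (-m)) * exp ((of_real sn * v + of_real sa / v)\<^sup>2) = exp E"
  proof -
    have "of_real (-m) + (of_real sn * v + of_real sa / v)\<^sup>2 = E"
      using v0 by (simp add: E_def wv m power2_eq_square field_simps)
    then show ?thesis by (simp only: exp_of_real[symmetric] exp_add[symmetric])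
  qed
  have d2: "((\<lambda>w. of_real (sa * (1 - 1 / m) * exp m) * G (of_real sn * csqrt w - of_real sa / csqrt w)) has_field_derivative
      of_real (sa * (1 - 1 / m)) * exp E * ((of_real sn + of_real sa / v\<^sup>2) / (2 * v))) (at w)"
    by (rule DERIV_cong[OF DERIV_cmult[OF DERIV_chain2[OF G dA1]]])
       (simp add: v_def[symmetric] x1[symmetric] del: of_real_exp)
  have d3: "((\<lambda>w. of_real (sa * (1 + 1 / m) * exp (-m)) * G (of_real sn * csqrt w + of_real sa / csqrt w)) has_field_derivative
      of_real (sa * (1 + 1 / m)) * exp E * ((of_real sn - of_real sa / v\<^sup>2) / (2 * v))) (at w)"
    by (rule DERIV_cong[OF DERIV_cmult[OF DERIV_chain2[OF G dA2]]])
       (simp add: v_def[symmetric] x2[symmetric] del: of_real_exp)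
  define A B where "A = complex_of_real sa" and "B = complex_of_real sn"
  have A0: "A \<noteq> 0" "B \<noteq> 0" using sa sn by (auto simp: A_def B_def)
  have mC: "complex_of_real m = 2 * A * B" by (simp add: m A_def B_def)
  \<comment> \<open>The weights of \<open>G\<close> are dictated by this identity: their common part
    \<open>A\<close> cancels \<open>A^2 / v^3\<close>, the parts with \<open>1 / m\<close> cancel
    \<open>1 / (2 * v)\<close>, and \<open>v * B^2\<close> remains.\<close>
  have alg: "(1 / (2 * v) + v * (B\<^sup>2 - A\<^sup>2 / (v\<^sup>2)\<^sup>2)
        + A * (1 - 1 / (2 * A * B)) * ((B + A / v\<^sup>2) / (2 * v)) - A * (1 + 1 / (2 * A * B)) * ((B - A / v\<^sup>2) / (2 * v))) / B\<^sup>2 = v"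
    using v0 A0 by (simp add: field_simps power2_eq_square)
  show ?thesis
  proof (rule DERIV_cong[OF DERIV_cdivide[OF DERIV_diff[OF DERIV_add[OF d1 d2] d3]]])
    have gen: "(x / (2 * v) + v * (x * p) + A * c * x * q - A * d * x * r) / z
        = x * ((1 / (2 * v) + v * p + A * c * q - A * d * r) / z)" for x p c d q r z :: complex
      by (simp add: algebra_simps)
    have "(exp E / (2 * v) + v * (exp E * (of_real (sn\<^sup>2) - of_real (sa\<^sup>2) / w\<^sup>2))
        + of_real (sa * (1 - 1 / m)) * exp E * ((of_real sn + of_real sa / v\<^sup>2) / (2 * v))
        - of_real (sa * (1 + 1 / m)) * exp E * ((of_real sn - of_real sa / v\<^sup>2) / (2 * v))) / of_real (sn\<^sup>2)
      = exp E * ((1 / (2 * v) + v * (B\<^sup>2 - A\<^sup>2 / (v\<^sup>2)\<^sup>2)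
        + A * (1 - 1 / (2 * A * B)) * ((B + A / v\<^sup>2) / (2 * v)) - A * (1 + 1 / (2 * A * B)) * ((B - A / v\<^sup>2) / (2 * v))) / B\<^sup>2)"
      unfolding wv of_real_mult of_real_diff of_real_add of_real_divide of_real_power of_real_1 mC A_def[symmetric] B_def[symmetric]
      by (rule gen)
    also have "\<dots> = v * exp E" unfolding alg by simp
    finally show "(exp E / (2 * v) + v * (exp E * (of_real (sn\<^sup>2) - of_real (sa\<^sup>2) / w\<^sup>2))
        + of_real (sa * (1 - 1 / m)) * exp E * ((of_real sn + of_real sa / v\<^sup>2) / (2 * v))
        - of_real (sa * (1 + 1 / m)) * exp E * ((of_real sn - of_real sa / v\<^sup>2) / (2 * v))) / of_real (sn\<^sup>2)
      = csqrt w * exp (of_real (sn\<^sup>2) * w + of_real (sa\<^sup>2) / w)" by (simp add: v_def E_def)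
  qed
qed

text \<open>
  With \<open>w = v\<^sup>2\<close> and \<open>m = 2 sa sn\<close> one has \<open>sn\<^sup>2 w + sa\<^sup>2/w = (sn v \<mp> sa/v)\<^sup>2 \<plusminus> m\<close>, so that integration by parts
  reduces \<open>\<integral> w\<^sup>1\<^sup>/\<^sup>2 exp (sn\<^sup>2 w + sa\<^sup>2/w)\<close> to the primitive \<open>G\<close> of \<open>exp z\<^sup>2\<close>.
\<close>

definition main_primitive :: "(complex \<Rightarrow> complex) \<Rightarrow> real \<Rightarrow> real \<Rightarrow> real \<Rightarrow> complex \<Rightarrow> complex" where
  "main_primitive G sa sn m w = (csqrt w * exp (of_real (sn\<^sup>2) * w + of_real (sa\<^sup>2) / w)
            + of_real (sa * (1 - 1 / m) * exp m) * G (of_real sn * csqrt w - of_real sa / csqrt w)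
            - of_real (sa * (1 + 1 / m) * exp (-m)) * G (of_real sn * csqrt w + of_real sa / csqrt w)) / of_real (sn\<^sup>2)"

text \<open>Compare fifth powers: \<open>e^3 <= 27 <= 32\<close>.\<close>

lemma exp_three_fifths_le: "exp (3 / 5 :: real) \<le> 2"
proof -
  have "exp (3 / 5 :: real) ^ 5 = exp 1 ^ 3" by (simp add: exp_of_nat_mult[symmetric])
  also have "\<dots> \<le> 3 ^ 3" by (intro power_mono exp_le) auto
  also have "\<dots> \<le> (2::real) ^ 5" by simp
  finally show ?thesis by (rule power_le_imp_le_base[of _ 4, simplified]) simp
qed

lemma csqrt_Re_pos:
  assumes "Re w > 0" shows "Re (csqrt w) > 0"
proof (rule ccontr)
  assume "\<not> Re (csqrt w) > 0"
  then have "Re (csqrt w) = 0" using csqrt_principal[of w] by auto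
  then have "Re ((csqrt w)\<^sup>2) \<le> 0" by (simp add: power2_eq_square)
  then show False using assms by simp
qed

text \<open>Both arguments of \<open>G\<close> lie in the half-plane of sign \<sigma>, at distance
  at least 1 from the real axis, so \<open>G\<close> is close to its limit there. The deviations are
  governed by \<open>norm (exp E)\<close>, which at the ends of the segment is only of order
  \<open>exp (m / 2)\<close>; a term of size \<open>exp m\<close> enters solely through that limit,
  which has opposite signs at the two ends. The abscissa \<open>t = sa / sn\<close> is the saddle
  point: \<open>sn^2 * t + sa^2 / t\<close> takes its minimum \<open>m\<close> there.\<close>

lemma main_primitive_endpoint:
  fixes G :: "complex \<Rightarrow> complex" and sa sn m t :: real
  assumes up: "\<And>z. Im z > 0 \<Longrightarrow> norm (G z - \<i> * of_real (sqrt pi / 2)) \<le> exp (Re (z\<^sup>2)) / (2 * Im z)"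
    and lo: "\<And>z. Im z < 0 \<Longrightarrow> norm (G z + \<i> * of_real (sqrt pi / 2)) \<le> exp (Re (z\<^sup>2)) / (2 * - Im z)"
    and sa: "1 \<le> sa" "sa \<le> 13 / 10" "sa\<^sup>2 = pi\<^sup>2 / 6" and sn: "28 \<le> sn" and m: "m = 2 * sa * sn" and t: "t = sa / sn"
    and \<sigma>: "\<sigma> = 1 \<or> \<sigma> = (-1 :: real)"
  shows "norm (main_primitive G sa sn m (Complex t (\<sigma> * pi)) - \<i> * of_real (\<sigma> * (sqrt pi / 2 * (sa * (1 - 1 / m) * exp m) / sn\<^sup>2)))
           \<le> 12 * exp (m / 2) / sn\<^sup>2"
proof -
  define w where "w = Complex t (\<sigma> * pi)"
  define v where "v = csqrt w"
  define E where "E = of_real (sn\<^sup>2) * w + of_real (sa\<^sup>2) / w"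
  define X where "X = norm (exp E)"
  have t0: "t > 0" using sa sn by (simp add: t)
  have "sa / sn \<le> (13 / 10) / 28" using sa sn by (intro frac_le) auto
  then have t20: "t \<le> 1 / 20" using t by simp
  have \<sigma>2: "\<sigma>\<^sup>2 = 1" "\<bar>\<sigma>\<bar> = 1" "\<sigma> * \<sigma> = 1" using \<sigma> by auto
  have Rew: "Re w = t" "Im w = \<sigma> * pi" by (simp_all add: w_def)
  have w0: "w \<noteq> 0" using t0 Rew by auto
  have v0: "v \<noteq> 0" using w0 by (simp add: v_def)
  have wv: "w = v\<^sup>2" by (simp add: v_def)
  have normw2: "(norm w)\<^sup>2 = t\<^sup>2 + pi\<^sup>2" by (simp add: cmod_power2 Rew power_mult_distrib \<sigma>2)
  have normw_ge: "norm w \<ge> pi"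
    using abs_Im_le_cmod[of w] \<sigma>2 by (simp add: Rew abs_mult)
  have normw_le: "norm w \<le> 4"
    using cmod_le[of w] t0 t20 \<sigma>2 pi_less_4 pi_approx by (simp add: Rew abs_mult)
  have nv: "(norm v)\<^sup>2 = norm w" by (simp add: wv norm_power)
  have "(norm v)\<^sup>2 \<le> 2\<^sup>2" using nv normw_le by simp
  then have nv2: "norm v \<le> 2" by (rule power2_le_imp_le) simp
  have Rev: "Re v > 0" unfolding v_def by (rule csqrt_Re_pos) (use Rew t0 in simp)
  have Rev2: "Re v \<le> 2" using complex_Re_le_cmod[of v] nv2 by simp
  have "Im w = 2 * Re v * Im v" unfolding wv by (simp add: power2_eq_square)
  then have "2 * Re v * (\<sigma> * Im v) = \<sigma> * (\<sigma> * pi)" unfolding Rew by simp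
  then have prod: "2 * Re v * (\<sigma> * Im v) = pi" using \<sigma>2 by (simp add: mult.assoc[symmetric])
  \<comment> \<open>From \<open>2 * Re v * (\<sigma> * Im v) = pi\<close>, with
    \<open>Re v <= 2\<close> and \<open>pi > 3\<close>.\<close>
  have Imv: "\<sigma> * Im v \<ge> 3 / 4"
  proof (rule ccontr)
    assume "\<not> 3 / 4 \<le> \<sigma> * Im v"
    then have "2 * Re v * (\<sigma> * Im v) < 2 * Re v * (3 / 4)" using Rev by simp
    also have "\<dots> \<le> 3" using Rev2 by simp
    also have "\<dots> < pi" by (rule pi_gt3)
    finally show False using prod by simp
  qed
  have Iminv: "Im (of_real sa / v) = - (sa * Im v / norm w)"
    by (simp add: Im_divide nv[symmetric] cmod_power2)
  define A1 where "A1 = of_real sn * v - of_real sa / v"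
  define A2 where "A2 = of_real sn * v + of_real sa / v"
  have ImA1: "\<sigma> * Im A1 = (\<sigma> * Im v) * (sn + sa / norm w)" unfolding A1_def by (simp add: Iminv algebra_simps)
  have ImA2: "\<sigma> * Im A2 = (\<sigma> * Im v) * (sn - sa / norm w)" unfolding A2_def by (simp add: Iminv algebra_simps)
  have sw: "0 \<le> sa / norm w" "sa / norm w \<le> 2"
  proof -
    show "0 \<le> sa / norm w" using sa by simp
    have "sa / norm w \<le> (13 / 10) / 1" using sa normw_ge pi_gt3 by (intro frac_le) auto
    then show "sa / norm w \<le> 2" by linarith
  qed
  have A1b: "\<sigma> * Im A1 \<ge> 1"
  proof -
    have "4 / 3 \<le> sn + sa / norm w" using sw sn by linarith
    then have "(3 / 4) * (4 / 3) \<le> (\<sigma> * Im v) * (sn + sa / norm w)" using Imv by (intro mult_mono) auto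
    then show ?thesis unfolding ImA1 by simp
  qed
  have A2b: "\<sigma> * Im A2 \<ge> 1"
  proof -
    have "4 / 3 \<le> sn - sa / norm w" using sw sn by linarith
    then have "(3 / 4) * (4 / 3) \<le> (\<sigma> * Im v) * (sn - sa / norm w)" using Imv by (intro mult_mono) auto
    then show ?thesis unfolding ImA2 by simp
  qed
  have Gb: "norm (G z - \<i> * of_real (\<sigma> * (sqrt pi / 2))) \<le> exp (Re (z\<^sup>2)) / 2" if z: "\<sigma> * Im z \<ge> 1" for z
  proof -
    have "norm (G z - \<i> * of_real (\<sigma> * (sqrt pi / 2))) \<le> exp (Re (z\<^sup>2)) / (2 * (\<sigma> * Im z))"
      using \<sigma> up[of z] lo[of z] z by auto
    also have "\<dots> \<le> exp (Re (z\<^sup>2)) / (2 * 1)" using z by (intro divide_left_mono) auto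
    finally show ?thesis by simp
  qed
  have x1: "exp m * exp (Re (A1\<^sup>2)) = X"
  proof -
    have "of_real m + A1\<^sup>2 = E"
      using v0 by (simp add: E_def A1_def wv m power2_eq_square field_simps)
    then have "Re E = m + Re (A1\<^sup>2)" by (metis Re_complex_of_real plus_complex.sel(1))
    then show ?thesis by (simp only: X_def norm_exp_eq_Re exp_add)
  qed
  have x2: "exp (-m) * exp (Re (A2\<^sup>2)) = X"
  proof -
    have "of_real (-m) + A2\<^sup>2 = E"
      using v0 by (simp add: E_def A2_def wv m power2_eq_square field_simps)
    then have "Re E = - m + Re (A2\<^sup>2)" by (metis Re_complex_of_real plus_complex.sel(1))
    then show ?thesis by (simp only: X_def norm_exp_eq_Re exp_add)
  qed
  have m0: "m \<ge> 1"
  proof -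
    have "1 * 28 \<le> sa * sn" using sa sn by (intro mult_mono) auto
    then show ?thesis by (simp add: m)
  qed
  have Xle: "X \<le> 2 * exp (m / 2)"
  proof -
    have "Re E = sn\<^sup>2 * t + sa\<^sup>2 * t / (norm w)\<^sup>2" by (simp add: E_def Rew Re_divide cmod_power2)
    also have "sn\<^sup>2 * t = m / 2" using sn by (simp add: t m power2_eq_square)
    also have "sa\<^sup>2 * t / (norm w)\<^sup>2 \<le> sa\<^sup>2 * t / pi\<^sup>2"
      using normw_ge t0 w0 by (intro divide_left_mono power_mono mult_pos_pos) auto
    also have "sa\<^sup>2 * t / pi\<^sup>2 = t / 6" by (simp add: sa(3))
    also have "t / 6 \<le> 3 / 5" using t20 by simp
    finally have "exp (Re E) \<le> exp (m / 2 + 3 / 5)" by simp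
    also have "\<dots> \<le> exp (m / 2) * 2" unfolding exp_add using exp_three_fifths_le by (intro mult_left_mono) auto
    finally show ?thesis by (simp add: X_def norm_exp_eq_Re)
  qed
  have X0: "X \<ge> 0" by (simp add: X_def)
  define g where "g = \<i> * complex_of_real (\<sigma> * (sqrt pi / 2))"
  have ng: "norm g \<le> 1"
  proof -
    have "sqrt pi \<le> sqrt 4" using pi_less_4 by (intro real_sqrt_le_mono) simp
    then have "sqrt pi / 2 \<le> 1" by simp
    then show ?thesis unfolding g_def norm_mult norm_of_real abs_mult \<sigma>2 by simp
  qed
  define c1 where "c1 = sa * (1 - 1 / m)"
  define c2 where "c2 = sa * (1 + 1 / m)"
  have c1: "0 \<le> c1" "c1 \<le> 13 / 10"
  proof -
    show "0 \<le> c1" unfolding c1_def using sa m0 by (intro mult_nonneg_nonneg) auto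
    have "c1 \<le> 13 / 10 * 1" unfolding c1_def using sa m0 by (intro mult_mono) auto
    then show "c1 \<le> 13 / 10" by simp
  qed
  have c2: "0 \<le> c2" "c2 \<le> 26 / 10"
  proof -
    show "0 \<le> c2" unfolding c2_def using sa m0 by (intro mult_nonneg_nonneg) auto
    have "c2 \<le> 13 / 10 * 2" unfolding c2_def using sa m0 by (intro mult_mono) auto
    then show "c2 \<le> 26 / 10" by simp
  qed
  have dec: "v * exp E + of_real (c1 * exp m) * G A1 - of_real (c2 * exp (-m)) * G A2 - of_real (c1 * exp m) * g
     = v * exp E + of_real (c1 * exp m) * (G A1 - g) - of_real (c2 * exp (-m)) * (G A2 - g) - of_real (c2 * exp (-m)) * g"
    by (simp add: algebra_simps)
  have b1: "norm (v * exp E) \<le> 2 * X" unfolding norm_mult X_def[symmetric] using nv2 X0 by (intro mult_right_mono)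
  have b2: "norm (of_real (c1 * exp m) * (G A1 - g)) \<le> 13 / 10 * (X / 2)"
  proof -
    have "norm (of_real (c1 * exp m) * (G A1 - g)) = c1 * exp m * norm (G A1 - g)"
      unfolding norm_mult norm_of_real using c1 by simp
    also have "\<dots> \<le> c1 * exp m * (exp (Re (A1\<^sup>2)) / 2)"
      using Gb[OF A1b] c1 by (intro mult_left_mono) (auto simp: g_def)
    also have "\<dots> = c1 * (X / 2)" unfolding x1[symmetric] by simp
    also have "\<dots> \<le> 13 / 10 * (X / 2)" using c1 X0 by (intro mult_right_mono) auto
    finally show ?thesis .
  qed
  have b3: "norm (of_real (c2 * exp (-m)) * (G A2 - g)) \<le> 26 / 10 * (X / 2)"
  proof -
    have "norm (of_real (c2 * exp (-m)) * (G A2 - g)) = c2 * exp (-m) * norm (G A2 - g)"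
      unfolding norm_mult norm_of_real using c2 by simp
    also have "\<dots> \<le> c2 * exp (-m) * (exp (Re (A2\<^sup>2)) / 2)"
      using Gb[OF A2b] c2 by (intro mult_left_mono) (auto simp: g_def)
    also have "\<dots> = c2 * (X / 2)" unfolding x2[symmetric] by simp
    also have "\<dots> \<le> 26 / 10 * (X / 2)" using c2 X0 by (intro mult_right_mono) auto
    finally show ?thesis .
  qed
  have b4: "norm (of_real (c2 * exp (-m)) * g) \<le> 26 / 10 * exp (m / 2)"
  proof -
    have "norm (of_real (c2 * exp (-m)) * g) = c2 * exp (-m) * norm g"
      unfolding norm_mult norm_of_real using c2 by simp
    also have "\<dots> \<le> c2 * exp (m / 2) * 1"
      using c2 m0 ng by (intro mult_mono mult_left_mono) auto
    also have "\<dots> \<le> 26 / 10 * exp (m / 2)" using c2 by simp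
    finally show ?thesis .
  qed
  have "norm (v * exp E + of_real (c1 * exp m) * G A1 - of_real (c2 * exp (-m)) * G A2 - of_real (c1 * exp m) * g)
     \<le> 2 * X + 13 / 10 * (X / 2) + 26 / 10 * (X / 2) + 26 / 10 * exp (m / 2)"
    unfolding dec using b1 b2 b3 b4
    by (meson add_mono norm_triangle_ineq norm_triangle_ineq4 order_trans)
  \<comment> \<open>The coefficient of \<open>X\<close> is \<open>79/20\<close>; with
    \<open>X <= 2 * exp (m / 2)\<close> the total is \<open>21/2\<close>, rounded up.\<close>
  also have "\<dots> \<le> 12 * exp (m / 2)" using Xle exp_gt_zero[of "m / 2"] by linarith
  finally have fin: "norm (v * exp E + of_real (c1 * exp m) * G A1 - of_real (c2 * exp (-m)) * G A2 - of_real (c1 * exp m) * g)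
     \<le> 12 * exp (m / 2)" .
  have eq: "main_primitive G sa sn m w - \<i> * of_real (\<sigma> * (sqrt pi / 2 * (sa * (1 - 1 / m) * exp m) / sn\<^sup>2))
     = (v * exp E + of_real (c1 * exp m) * G A1 - of_real (c2 * exp (-m)) * G A2 - of_real (c1 * exp m) * g) / of_real (sn\<^sup>2)"
    unfolding main_primitive_def v_def[symmetric] E_def[symmetric] A1_def[symmetric] A2_def[symmetric] c1_def[symmetric] c2_def[symmetric] g_def
    by (simp add: diff_divide_distrib mult_ac)
  have "norm (main_primitive G sa sn m w - \<i> * of_real (\<sigma> * (sqrt pi / 2 * (sa * (1 - 1 / m) * exp m) / sn\<^sup>2)))
      \<le> 12 * exp (m / 2) / sn\<^sup>2"
    unfolding eq norm_divide norm_of_real using fin by (simp add: divide_right_mono)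
  then show ?thesis by (simp add: w_def)
qed

lemma csqrt_divide_of_real:
  assumes "Re w > 0" "r > 0"
  shows "csqrt (w / of_real r) = csqrt w / of_real (sqrt r)"
proof (rule csqrt_unique)
  show "(csqrt w / of_real (sqrt r))\<^sup>2 = w / of_real r"
    using assms by (simp add: power_divide flip: of_real_power)
  have "Re (csqrt w / of_real (sqrt r)) > 0"
    unfolding Re_divide_of_real using csqrt_Re_pos[OF assms(1)] assms(2) by simp
  then show "0 < Re (csqrt w / of_real (sqrt r)) \<or> Re (csqrt w / of_real (sqrt r)) = 0 \<and> 0 \<le> Im (csqrt w / of_real (sqrt r))" by simp
qed

text \<open>The main term is \<open>sqrt 12 / (24 * n - 1) * (1 - 1 / m) * exp m\<close>, the first
  term of the Hardy-Ramanujan-Rademacher series, with \<open>24 * n - 1\<close> written as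
  \<open>36 * m^2 / pi^2\<close>. In the exponent of the error, \<open>m / 2\<close> is the real
  part of \<open>sn^2 * w\<close> on the segment, and \<open>m / 8\<close> comes from the dual
  factor at the ends, where \<open>1 / (24 * R)\<close> is largest. After division by
  \<open>2 * pi\<close> the integrand contributes the factor 2 and the endpoints at most 1.\<close>

lemma partition_asymptotic:
  assumes n: "n \<ge> 800"
  shows "\<bar>real (partition_p n) - pi\<^sup>2 * sqrt 12 / 36 * ((mu n - 1) * exp (mu n) / mu n ^ 3)\<bar> \<le> 3 * exp (5 * mu n / 8)"
proof -
  \<comment> \<open>The shift by \<open>1/24\<close> absorbs the factor
    \<open>exp (- w / 24)\<close> of the transformation.\<close>
  define N where "N = real n - 1 / 24"
  define sa where "sa = pi / sqrt 6"
  define sn where "sn = sqrt N"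
  define m where "m = 2 * sa * sn"
  define t where "t = sa / sn"
  have N: "N \<ge> 784" using n by (simp add: N_def)
  have sn: "sn \<ge> 28" unfolding sn_def by (rule real_le_rsqrt) (use N in simp)
  have sn2: "sn\<^sup>2 = N" using N by (simp add: sn_def)
  have sa2: "sa\<^sup>2 = pi\<^sup>2 / 6" by (simp add: sa_def power_divide)
  have sa0: "sa > 0" by (simp add: sa_def)
  have pi315: "pi \<le> 63 / 20" using pi_approx by simp
  have pi2: "pi\<^sup>2 \<le> (315 / 100)\<^sup>2" "pi\<^sup>2 \<ge> 3\<^sup>2"
    using pi_approx by (intro power_mono; simp)+
  have sa1: "1 \<le> sa" "sa \<le> 13 / 10"
  proof -
    have "1\<^sup>2 \<le> sa\<^sup>2" unfolding sa2 using pi2 by (simp add: power2_eq_square)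
    then show "1 \<le> sa" by (rule power2_le_imp_le) (use sa0 in simp)
    have "sa\<^sup>2 \<le> (13 / 10)\<^sup>2" unfolding sa2 using pi2 by (simp add: power2_eq_square)
    then show "sa \<le> 13 / 10" by (rule power2_le_imp_le) simp
  qed
  have mu: "mu n = m"
  proof -
    have "sqrt (24 * real n - 1) = sqrt 24 * sqrt N"
      unfolding real_sqrt_mult[symmetric] by (rule arg_cong[of _ _ sqrt]) (simp add: N_def)
    also have "sqrt 24 = 2 * sqrt 6" using real_sqrt_mult[of 4 6] by simp
    finally have "mu n = pi / 6 * (2 * sqrt 6 * sqrt N)" by (simp add: mu_def)
    also have "\<dots> = m"
    proof -
      have "sqrt 6 * sqrt 6 = (6::real)" by simp
      then have "pi / sqrt 6 = pi / 6 * sqrt 6" by (simp add: field_simps)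
      then have "2 * (pi / sqrt 6) * sqrt N = 2 * (pi / 6 * sqrt 6) * sqrt N" by (rule arg_cong)
      then show ?thesis unfolding m_def sa_def sn_def by simp
    qed
    finally show ?thesis .
  qed
  have t0: "t > 0" using sa0 sn by (simp add: t_def)
  have "sa / sn \<le> (13 / 10) / 28" using sa1 sn by (intro frac_le) auto
  then have t20: "t \<le> 1 / 20" unfolding t_def by linarith
  have m0: "m > 0" using sa0 sn by (simp add: m_def)
  obtain G where G: "\<And>z. (G has_field_derivative exp (z\<^sup>2)) (at z)"
    and up: "\<And>z. Im z > 0 \<Longrightarrow> norm (G z - \<i> * of_real (sqrt pi / 2)) \<le> exp (Re (z\<^sup>2)) / (2 * Im z)"
    and lo: "\<And>z. Im z < 0 \<Longrightarrow> norm (G z + \<i> * of_real (sqrt pi / 2)) \<le> exp (Re (z\<^sup>2)) / (2 * - Im z)"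
    by (rule gauss_primitive) (rule that; blast)
  define E where "E = (\<lambda>w::complex. of_real (sn\<^sup>2) * w + of_real (sa\<^sup>2) / w)"
  define \<Psi> where "\<Psi> = main_primitive G sa sn m"
  define a where "a = Complex t (-pi)"
  define b where "b = Complex t pi"
  define r where "r = sqrt (2 * pi)"
  have r: "r > 0" "r\<^sup>2 = 2 * pi" by (simp_all add: r_def)
  have seg: "Re w = t" "\<bar>Im w\<bar> \<le> pi" if "w \<in> closed_segment a b" for w
    using vertical_segment[of w t] that by (auto simp: a_def b_def)
  have I0: "((\<lambda>w. partition_fun w * exp (of_nat n * w)) has_contour_integral (2 * of_real pi * \<i> * of_nat (partition_p n))) (linepath a b)"
    unfolding a_def b_def by (rule partition_coeff_integral[OF t0])
  have "((\<lambda>w. csqrt w * exp (E w)) has_contour_integral (\<Psi> (pathfinish (linepath a b)) - \<Psi> (pathstart (linepath a b)))) (linepath a b)"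
  proof (rule contour_integral_primitive[of "closed_segment a b"])
    fix w assume "w \<in> closed_segment a b"
    then have "Re w > 0" using seg t0 by simp
    then have "(\<Psi> has_field_derivative csqrt w * exp (E w)) (at w)"
      unfolding \<Psi>_def main_primitive_def[abs_def] E_def
      by (intro main_primitive_deriv[OF G]) (use sa0 sn in \<open>auto simp: m_def\<close>)
    then show "(\<Psi> has_field_derivative csqrt w * exp (E w)) (at w within closed_segment a b)"
      by (rule has_field_derivative_at_within)
  qed auto
  then have I1: "((\<lambda>w. csqrt w * exp (E w)) has_contour_integral (\<Psi> b - \<Psi> a)) (linepath a b)" by simp
  define D where "D = 2 * of_real pi * \<i> * of_nat (partition_p n) - of_real (1 / r) * (\<Psi> b - \<Psi> a)"
  have I2: "((\<lambda>w. partition_fun w * exp (of_nat n * w) - of_real (1 / r) * (csqrt w * exp (E w))) has_contour_integral D) (linepath a b)"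
    unfolding D_def by (rule has_contour_integral_diff[OF I0 has_contour_integral_lmul[OF I1]])
  have bound: "norm (partition_fun w * exp (of_nat n * w) - of_real (1 / r) * (csqrt w * exp (E w))) \<le> 2 * exp (5 * m / 8)"
    if w: "w \<in> closed_segment a b" for w
  proof -
    have Rew: "Re w = t" and Imw: "\<bar>Im w\<bar> \<le> pi" using seg[OF w] by auto
    have Rpos: "Re w > 0" using Rew t0 by simp
    have w0: "w \<noteq> 0" using Rpos by auto
    define R where "R = t / (norm w)\<^sup>2"
    have R0: "R > 0" using t0 w0 by (simp add: R_def)
    have normw: "(norm w)\<^sup>2 \<le> t\<^sup>2 + pi\<^sup>2"
      using Imw Rew by (simp add: cmod_power2 abs_le_square_iff[symmetric])
    have Rediv: "Re (of_real c / w) = c * R" for c by (simp add: Re_divide cmod_power2 R_def Rew)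
    define u where "u = of_real (4 * pi\<^sup>2) / w"
    have Reu: "Re u = 4 * pi\<^sup>2 * R" unfolding u_def by (rule Rediv)
    have Fu: "norm (partition_fun u - 1) \<le> partition_gf (exp (- (4 * pi\<^sup>2 * R))) - 1"
      using norm_partition_fun_minus_1[of u] R0 unfolding Reu by simp
    have "partition_fun w * exp (of_nat n * w) = of_real (1 / r) * (csqrt w * exp (E w)) * partition_fun u"
    proof -
      have "partition_fun w = (csqrt w / of_real r) * exp (of_real (pi\<^sup>2 / 6) / w - w / 24) * partition_fun u"
        using partition_fun_transform[OF Rpos] csqrt_divide_of_real[OF Rpos, of "2 * pi"] by (simp add: u_def r_def)
      moreover have "exp (of_real (pi\<^sup>2 / 6) / w - w / 24) * exp (of_nat n * w) = exp (E w)"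
      proof -
        have "(of_real (pi\<^sup>2 / 6) / w - w / 24) + of_nat n * w = E w"
          unfolding E_def sn2 sa2 N_def by (simp add: algebra_simps)
        then show ?thesis by (simp only: exp_add[symmetric])
      qed
      ultimately have "partition_fun w * exp (of_nat n * w) = (csqrt w / of_real r) * exp (E w) * partition_fun u"
        by (simp only: mult_ac)
      then show ?thesis by (simp add: mult_ac)
    qed
    then have "partition_fun w * exp (of_nat n * w) - of_real (1 / r) * (csqrt w * exp (E w))
        = of_real (1 / r) * csqrt w * exp (E w) * (partition_fun u - 1)"
      by (simp only: right_diff_distrib mult.assoc mult_1_right)
    then have "norm (partition_fun w * exp (of_nat n * w) - of_real (1 / r) * (csqrt w * exp (E w)))
        = (norm (csqrt w) / r) * (norm (exp (E w)) * norm (partition_fun u - 1))"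
      using r(1) by (simp add: norm_mult norm_divide)
    also have "\<dots> \<le> 1 * (exp (m / 2) * exp (pi / 6 + 1 / (24 * R)))"
    proof (rule mult_mono)
      have "(norm (csqrt w))\<^sup>2 = norm w" by (simp add: norm_power[symmetric])
      also have "\<dots> \<le> \<bar>Re w\<bar> + \<bar>Im w\<bar>" by (rule cmod_le)
      also have "\<dots> \<le> 2 * pi" using Rew Imw t0 t20 pi_gt3 by simp
      finally have "(norm (csqrt w))\<^sup>2 \<le> r\<^sup>2" by (simp add: r)
      then have "norm (csqrt w) \<le> r" by (rule power2_le_imp_le) (use r in simp)
      then show "norm (csqrt w) / r \<le> 1" using r(1) by simp
      have "Re (E w) = m / 2 + pi\<^sup>2 / 6 * R"
      proof -
        have "Re (E w) = sn\<^sup>2 * t + sa\<^sup>2 * R" unfolding E_def plus_complex.sel Rediv by (simp add: Rew)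
        also have "sn\<^sup>2 * t = m / 2" using sn by (simp add: t_def m_def power2_eq_square)
        finally show ?thesis by (simp add: sa2)
      qed
      then have "norm (exp (E w)) * norm (partition_fun u - 1) = exp (m / 2) * (exp (pi\<^sup>2 / 6 * R) * norm (partition_fun u - 1))"
        by (simp add: norm_exp_eq_Re exp_add)
      also have "\<dots> \<le> exp (m / 2) * (exp (pi\<^sup>2 / 6 * R) * (partition_gf (exp (- (4 * pi\<^sup>2 * R))) - 1))"
        using Fu by (intro mult_left_mono) auto
      also have "\<dots> \<le> exp (m / 2) * exp (pi / 6 + 1 / (24 * R))"
        by (intro mult_left_mono dual_bound[OF R0]) auto
      finally show "norm (exp (E w)) * norm (partition_fun u - 1) \<le> exp (m / 2) * exp (pi / 6 + 1 / (24 * R))" .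
    qed auto
    also have "\<dots> = exp (m / 2 + (pi / 6 + 1 / (24 * R)))" by (simp add: exp_add)
    also have "\<dots> \<le> exp (5 * m / 8 + 3 / 5)"
    proof -
      have "1 / (24 * R) = (norm w)\<^sup>2 / (24 * t)" by (simp add: R_def)
      also have "\<dots> \<le> (t\<^sup>2 + pi\<^sup>2) / (24 * t)" using normw t0 by (intro divide_right_mono) auto
      also have "\<dots> = t / 24 + pi\<^sup>2 / 6 / (4 * t)" using t0 by (simp add: field_simps power2_eq_square)
      also have "pi\<^sup>2 / 6 / (4 * t) = m / 8"
        unfolding sa2[symmetric] using sa0 sn by (simp add: t_def m_def power2_eq_square)
      finally have "1 / (24 * R) \<le> t / 24 + m / 8" .
      moreover have "pi / 6 + t / 24 \<le> 3 / 5" using t20 pi315 by linarith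
      ultimately show ?thesis by simp
    qed
    also have "\<dots> \<le> exp (5 * m / 8) * 2"
      unfolding exp_add using exp_three_fifths_le by (intro mult_left_mono) auto
    finally show ?thesis by simp
  qed
  have "norm D \<le> 2 * exp (5 * m / 8) * norm (b - a)"
    by (rule has_contour_integral_bound_linepath[OF I2 _ bound]) auto
  also have "b - a = of_real (2 * pi) * \<i>" by (simp add: a_def b_def complex_eq_iff)
  also have "norm (of_real (2 * pi) * \<i>) = 2 * pi" by (simp add: norm_mult)
  finally have D: "norm D \<le> 2 * exp (5 * m / 8) * (2 * pi)" .
  define \<kappa> where "\<kappa> = sqrt pi / 2 * (sa * (1 - 1 / m) * exp m) / sn\<^sup>2"
  have Pb: "norm (\<Psi> b - \<i> * of_real \<kappa>) \<le> 12 * exp (m / 2) / sn\<^sup>2"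
    using main_primitive_endpoint[OF up lo sa1 sa2 sn m_def t_def, of 1] by (simp add: \<Psi>_def b_def \<kappa>_def)
  have Pa: "norm (\<Psi> a + \<i> * of_real \<kappa>) \<le> 12 * exp (m / 2) / sn\<^sup>2"
    using main_primitive_endpoint[OF up lo sa1 sa2 sn m_def t_def, of "-1"] by (simp add: \<Psi>_def a_def \<kappa>_def)
  have "norm ((\<Psi> b - \<i> * of_real \<kappa>) - (\<Psi> a + \<i> * of_real \<kappa>)) \<le> 12 * exp (m / 2) / sn\<^sup>2 + 12 * exp (m / 2) / sn\<^sup>2"
    using norm_triangle_ineq4 Pa Pb by (meson add_mono order_trans)
  then have Pd: "norm ((\<Psi> b - \<Psi> a) - 2 * \<i> * of_real \<kappa>) \<le> 24 * exp (m / 2) / sn\<^sup>2"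
    by (simp add: algebra_simps)
  have main: "of_real (2 * pi) * \<i> * of_real (real (partition_p n) - \<kappa> / (pi * r))
      = D + of_real (1 / r) * ((\<Psi> b - \<Psi> a) - 2 * \<i> * of_real \<kappa>)"
    unfolding D_def by (simp add: algebra_simps)
  have "2 * pi * \<bar>real (partition_p n) - \<kappa> / (pi * r)\<bar> = norm (D + of_real (1 / r) * ((\<Psi> b - \<Psi> a) - 2 * \<i> * of_real \<kappa>))"
    unfolding main[symmetric] norm_mult norm_of_real by simp
  also have "\<dots> \<le> norm D + norm (of_real (1 / r) * ((\<Psi> b - \<Psi> a) - 2 * \<i> * of_real \<kappa>))"
    by (rule norm_triangle_ineq)
  also have "\<dots> \<le> 2 * exp (5 * m / 8) * (2 * pi) + 1 * (exp (5 * m / 8) * (24 / 784))"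
  proof (rule add_mono[OF D])
    have "r \<ge> 1" unfolding r_def using pi_gt3 by simp
    have "24 * exp (m / 2) / sn\<^sup>2 \<le> 24 * exp (5 * m / 8) / 784"
      using N m0 by (intro frac_le) (auto simp: sn2)
    with Pd have "norm ((\<Psi> b - \<Psi> a) - 2 * \<i> * of_real \<kappa>) \<le> exp (5 * m / 8) * (24 / 784)" by linarith
    then show "norm (of_real (1 / r) * ((\<Psi> b - \<Psi> a) - 2 * \<i> * of_real \<kappa>)) \<le> 1 * (exp (5 * m / 8) * (24 / 784))"
      unfolding norm_mult norm_of_real using \<open>r \<ge> 1\<close> by (intro mult_mono) auto
  qed
  also have "\<dots> \<le> 2 * exp (5 * m / 8) * (2 * pi) + exp (5 * m / 8) * (2 * pi)"
    using pi_gt3 by (intro add_left_mono) (simp add: mult_left_mono)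
  also have "\<dots> = 2 * pi * (3 * exp (5 * m / 8))" by simp
  finally have "\<bar>real (partition_p n) - \<kappa> / (pi * r)\<bar> \<le> 3 * exp (5 * m / 8)" by simp
  moreover have "\<kappa> / (pi * r) = pi\<^sup>2 * sqrt 12 / 36 * ((m - 1) * exp m / m ^ 3)"
  proof -
    have q: "sqrt 12 = 2 * sqrt 3" "sqrt 6 = sqrt 2 * sqrt 3"
      using real_sqrt_mult[of 4 3] real_sqrt_mult[of 2 3] by simp_all
    have s: "sqrt 2 * sqrt 2 = (2::real)" "sqrt 3 * sqrt 3 = (3::real)" by simp_all
    have rr: "r = sqrt 2 * sqrt pi" by (simp add: r_def real_sqrt_mult)
    have "\<kappa> / (pi * r) = sa * (1 - 1 / m) * exp m / (2 * sqrt 2 * pi * sn\<^sup>2)"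
    proof -
      have "s / 2 * x / y / (pi * (q * s)) = x / (2 * q * pi * y)" if "s > 0" for s x y q :: real
        using that by simp
      then show ?thesis unfolding \<kappa>_def rr by (simp add: mult_ac)
    qed
    also have "\<dots> = (sa / (2 * sqrt 2 * pi)) * ((m - 1) * exp m) / (m * sn\<^sup>2)"
      using m0 by (simp add: field_simps)
    also have "sa / (2 * sqrt 2 * pi) = sqrt 12 / 24"
      unfolding sa_def q using s by (simp add: field_simps)
    also have "sqrt 12 / 24 * ((m - 1) * exp m) / (m * sn\<^sup>2) = pi\<^sup>2 * sqrt 12 / 36 * ((m - 1) * exp m / m ^ 3)"
    proof -
      have m3: "m ^ 3 = m * (4 * (pi\<^sup>2 / 6) * sn\<^sup>2)"
        unfolding sa2[symmetric] by (simp add: power3_eq_cube m_def power2_eq_square)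
      have gen: "q / 24 * y / (m * s) = p * q / 36 * (y / (m * (4 * (p / 6) * s)))" if "p > 0" for p q y s :: real
        using that by simp
      show ?thesis unfolding m3 by (rule gen) simp
    qed
    finally show ?thesis .
  qed
  ultimately show ?thesis by (simp add: mu)
qed

section \<open>Large arguments\<close>

definition part_main :: "real \<Rightarrow> real" where
  "part_main m = pi\<^sup>2 * sqrt 12 / 36 * ((m - 1) * exp m / m ^ 3)"

lemma part_main_pos: "m > 1 \<Longrightarrow> part_main m > 0"
  by (simp add: part_main_def)

lemma exp_one_ge: "exp (1::real) \<ge> 27178 / 10000"
proof -
  have "1 + 1/32 + (1/32)\<^sup>2 / 2 \<le> exp (1/32 :: real)" by (rule exp_lower_Taylor_quadratic) simp
  then have "2113 / 2048 \<le> exp (1/32 :: real)" by (simp add: power2_eq_square)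
  then have "(2113 / 2048) ^ 32 \<le> exp (1/32 :: real) ^ 32" by (intro power_mono) auto
  also have "exp (1/32 :: real) ^ 32 = exp 1" by (simp add: exp_of_nat_mult[symmetric])
  finally have "(2113 / 2048 :: real) ^ 32 \<le> exp 1" .
  moreover have "27178 / 10000 \<le> (2113 / 2048 :: real) ^ 32" by (simp add: power_divide)
  ultimately show ?thesis by linarith
qed

text \<open>Checked at \<open>c = 145/2\<close>, where \<open>3 * c / 8 = 27 + 3/16\<close>, and
  carried upwards by \<open>(m / c)^7 <= exp (7 * (m / c - 1))\<close>, since
  \<open>7 / c < 3 / 8\<close>.\<close>

lemma power7_le_exp:
  assumes m: "m \<ge> (145 / 2 :: real)"
  shows "m ^ 7 \<le> 169 / 10 * exp (3 * m / 8)"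
proof -
  define c where "c = (145 / 2 :: real)"
  have c7: "c ^ 7 \<le> 169 / 10 * exp (3 * c / 8)"
  proof -
    have "1 + 3/16 + (3/16)\<^sup>2 / 2 \<le> exp (3/16 :: real)" by (rule exp_lower_Taylor_quadratic) simp
    then have "1205 / 1000 \<le> exp (3/16 :: real)" by (simp add: power2_eq_square)
    moreover have "(27178 / 10000) ^ 27 \<le> exp (1::real) ^ 27" by (intro power_mono exp_one_ge) simp
    ultimately have "(27178 / 10000) ^ 27 * (1205 / 1000) \<le> exp (1::real) ^ 27 * exp (3/16)"
      by (intro mult_mono) auto
    also have "exp (1::real) ^ 27 * exp (3/16) = exp (3 * c / 8)"
      by (simp add: c_def exp_of_nat_mult[symmetric] exp_add[symmetric])
    finally have "169 / 10 * ((27178 / 10000) ^ 27 * (1205 / 1000)) \<le> 169 / 10 * exp (3 * c / 8)" by simp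
    moreover have "c ^ 7 \<le> 169 / 10 * ((27178 / 10000) ^ 27 * (1205 / 1000))"
      by (simp add: c_def power_divide)
    ultimately show ?thesis by linarith
  qed
  have "1 + (m / c - 1) \<le> exp (m / c - 1)" by (rule exp_ge_add_one_self)
  then have "(m / c) ^ 7 \<le> exp (m / c - 1) ^ 7" using m by (intro power_mono) (auto simp: c_def)
  also have "\<dots> = exp (7 * (m / c - 1))" by (simp add: exp_of_nat_mult[symmetric])
  also have "\<dots> \<le> exp (3 * m / 8 - 3 * c / 8)" using m by (simp add: c_def)
  finally have "(m / c) ^ 7 * c ^ 7 \<le> exp (3 * m / 8 - 3 * c / 8) * (169 / 10 * exp (3 * c / 8))"
    using c7 by (intro mult_mono) (auto simp: c_def)
  also have "\<dots> = 169 / 10 * exp (3 * m / 8)" by (simp add: exp_diff)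
  also have "(m / c) ^ 7 * c ^ 7 = m ^ 7" by (simp add: power_divide c_def)
  finally show ?thesis .
qed

lemma mu_ge_800:
  assumes "n \<ge> 800" shows "mu n \<ge> 145 / 2"
proof -
  have "277 / 2 \<le> sqrt (24 * real n - 1)" by (rule real_le_rsqrt) (use assms in \<open>simp add: power2_eq_square\<close>)
  moreover have "pi / 6 \<ge> 5235 / 10000" using pi_approx by simp
  ultimately have "5235 / 10000 * (277 / 2) \<le> pi / 6 * sqrt (24 * real n - 1)" by (intro mult_mono) auto
  then show ?thesis by (simp add: mu_def)
qed

text \<open>Relative to the main term the error \<open>3 * exp (5 * m / 8)\<close> has order
  \<open>m^2 * exp (- 3 * m / 8)\<close>, and \<open>power7_le_exp\<close> brings this below
  \<open>55 / m^5\<close>. The constant 55 is half of 110; the total loss in the final estimate is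
  then \<open>4 * 55 + 110 = 330\<close> over \<open>x^5\<close>.\<close>

lemma partition_relative_error:
  assumes n: "n \<ge> 800"
  shows "\<bar>real (partition_p n) - part_main (mu n)\<bar> \<le> 55 / mu n ^ 5 * part_main (mu n)"
proof -
  define m where "m = mu n"
  have m: "m \<ge> 145 / 2" unfolding m_def by (rule mu_ge_800[OF n])
  define K where "K = pi\<^sup>2 * sqrt 12 / 36"
  have K: "K \<ge> 94 / 100"
  proof -
    have "(314 / 100)\<^sup>2 \<le> pi\<^sup>2" using pi_approx by (intro power_mono) auto
    moreover have "346 / 100 \<le> sqrt 12" by (rule real_le_rsqrt) (simp add: power2_eq_square)
    ultimately have "(314 / 100)\<^sup>2 * (346 / 100) \<le> pi\<^sup>2 * sqrt 12" by (intro mult_mono) auto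
    then show ?thesis by (simp add: K_def power2_eq_square)
  qed
  have "3 * m ^ 7 \<le> 507 / 10 * exp (3 * m / 8)" using power7_le_exp[OF m] by simp
  then have "3 * m ^ 7 * m \<le> 507 / 10 * exp (3 * m / 8) * m" using m by (intro mult_right_mono) auto
  also have "507 / 10 * exp (3 * m / 8) * m = (507 / 10 * m) * exp (3 * m / 8)" by simp
  also have "\<dots> \<le> 55 * K * (m - 1) * exp (3 * m / 8)"
  proof (rule mult_right_mono)
    have "507 / 10 * m \<le> 55 * (94 / 100) * (m - 1)" using m by simp
    also have "\<dots> \<le> 55 * K * (m - 1)" using K m by (intro mult_right_mono) auto
    finally show "507 / 10 * m \<le> 55 * K * (m - 1)" .
  qed simp
  finally have "3 * m ^ 8 \<le> 55 * K * (m - 1) * exp (3 * m / 8)"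
    using power_Suc2[of m 7] by (simp add: mult.assoc)
  then have "3 * m ^ 8 * exp (5 * m / 8) \<le> 55 * K * (m - 1) * exp (3 * m / 8) * exp (5 * m / 8)"
    by (intro mult_right_mono) auto
  also have "55 * K * (m - 1) * exp (3 * m / 8) * exp (5 * m / 8) = 55 * K * (m - 1) * exp m"
    by (simp add: mult.assoc exp_add[symmetric])
  finally have "3 * exp (5 * m / 8) \<le> 55 * K * (m - 1) * exp m / m ^ 8" using m by (simp add: field_simps)
  also have "\<dots> = 55 / m ^ 5 * part_main m"
  proof -
    have "m ^ 8 = m ^ 5 * m ^ 3" using power_add[of m 5 3] by simp
    then show ?thesis unfolding part_main_def K_def by (simp add: mult_ac)
  qed
  finally have "3 * exp (5 * m / 8) \<le> 55 / m ^ 5 * part_main m" .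
  with partition_asymptotic[OF n] show ?thesis by (simp add: m_def part_main_def)
qed

text \<open>With \<open>v = sqrt (1 - u)\<close> the numerator of \<open>Q_fun u\<close> is
  \<open>u^2 - (v - v^2)^2\<close>. As \<open>v - v^2\<close> increases up to
  \<open>v = 1/2\<close>, one may replace \<open>v\<close> by \<open>V = sqrt S\<close>, where
  \<open>S <= 1/9\<close> keeps \<open>V <= 1/3\<close>. The last hypothesis is
  \<open>(V - V^2)^2 < \<tau> * (1 - 2 * S)\<close>, and \<open>1 - 2 * S <= u^2\<close>.\<close>

lemma Q_criterion:
  assumes u: "0 < u" "u \<le> 1" and S: "1 - u \<le> S" "S \<le> 1 / 9" and T: "T \<le> 1 - \<tau>"
    and c: "S + S\<^sup>2 < 2 * S * sqrt S + \<tau> * (1 - 2 * S)"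
  shows "T < Q_fun u"
proof -
  define v where "v = sqrt (1 - u)"
  define V where "V = sqrt S"
  have S0: "0 \<le> S" using u S by simp
  have v2: "v\<^sup>2 = 1 - u" and v0: "v \<ge> 0" using u by (simp_all add: v_def)
  have V2: "V\<^sup>2 = S" and V0: "V \<ge> 0" using S0 by (simp_all add: V_def)
  have vV: "v \<le> V" unfolding v_def V_def using S by simp
  have V3: "V \<le> 1 / 3" unfolding V_def by (rule real_le_lsqrt) (use S in \<open>simp_all add: power2_eq_square\<close>)
  have sq: "sqrt ((1 - u) ^ 3) = v ^ 3" by (simp add: v_def real_sqrt_power)
  have cV: "(V - V\<^sup>2)\<^sup>2 < \<tau> * (1 - 2 * S)"
  proof -
    have "(V - V\<^sup>2)\<^sup>2 = S + S\<^sup>2 - 2 * S * V" unfolding V2[symmetric] by (simp add: power2_eq_square algebra_simps)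
    then show ?thesis using c by (simp add: V_def)
  qed
  have \<tau>0: "\<tau> \<ge> 0"
  proof (rule ccontr)
    assume "\<not> \<tau> \<ge> 0"
    then have "\<tau> * (1 - 2 * S) \<le> 0" using S by (intro mult_nonpos_nonneg) auto
    then show False using cV zero_le_power2[of "V - V\<^sup>2"] by linarith
  qed
  have mono: "(v - v\<^sup>2)\<^sup>2 \<le> (V - V\<^sup>2)\<^sup>2"
  proof (rule power_mono)
    have "0 \<le> (V - v) * (1 - (V + v))" using vV V3 v0 by (intro mult_nonneg_nonneg) auto
    then show "v - v\<^sup>2 \<le> V - V\<^sup>2" by (simp add: power2_eq_square algebra_simps)
    have "0 \<le> v * (1 - v)" using vV V3 v0 by (intro mult_nonneg_nonneg) auto
    then show "0 \<le> v - v\<^sup>2" by (simp add: power2_eq_square algebra_simps)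
  qed
  have "\<tau> * (1 - 2 * S) \<le> \<tau> * u\<^sup>2"
  proof (rule mult_left_mono[OF _ \<tau>0])
    have "1 - 2 * S \<le> 1 - 2 * (1 - u)" using S by simp
    also have "\<dots> \<le> u\<^sup>2" using zero_le_power2[of "1 - u"] by (simp add: power2_eq_square algebra_simps)
    finally show "1 - 2 * S \<le> u\<^sup>2" .
  qed
  then have main: "(v - v\<^sup>2)\<^sup>2 < \<tau> * u\<^sup>2" using mono cV by linarith
  have "T * u\<^sup>2 \<le> (1 - \<tau>) * u\<^sup>2" using T by (intro mult_right_mono) auto
  also have "\<dots> < u\<^sup>2 - (v - v\<^sup>2)\<^sup>2" using main by (simp add: algebra_simps)
  also have "\<dots> = 3 * u + 2 * v ^ 3 - 2"
  proof -
    have uv: "u = 1 - v\<^sup>2" using v2 by simp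
    show ?thesis unfolding uv by (simp add: power2_eq_square power3_eq_cube algebra_simps)
  qed
  finally show ?thesis using u by (simp add: Q_fun_def sq pos_less_divide_eq)
qed

section \<open>Expansion of the main quotient at three consecutive arguments\<close>

context
  fixes x y z b :: real
  assumes pos: "0 < x" "0 < y" "0 < z" and b: "0 < b" and x2: "x\<^sup>2 = y\<^sup>2 - b" and z2: "z\<^sup>2 = y\<^sup>2 + b"
begin

lemma xyz_order: "x \<le> y" "y \<le> z" "x * z \<le> y\<^sup>2" "x + z \<le> 2 * y"
proof -
  show "x \<le> y" by (rule power2_le_imp_le) (use x2 b pos in auto)
  show "y \<le> z" by (rule power2_le_imp_le) (use z2 b pos in auto)
  have "(x * z)\<^sup>2 \<le> (y\<^sup>2)\<^sup>2" unfolding power_mult_distrib x2 z2 by (simp add: power2_eq_square algebra_simps)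
  then show 1: "x * z \<le> y\<^sup>2" by (rule power2_le_imp_le) simp
  have "(x + z)\<^sup>2 = x\<^sup>2 + z\<^sup>2 + 2 * (x * z)" by (simp add: power2_eq_square algebra_simps)
  also have "\<dots> \<le> (2 * y)\<^sup>2" using 1 unfolding x2 z2 by (simp add: power2_eq_square)
  finally show "x + z \<le> 2 * y" by (rule power2_le_imp_le) (use pos in simp)
qed

text \<open>Rationalise twice: \<open>z - y\<close> and \<open>y - x\<close> become quotients with
  the same numerator \<open>b\<close>, so their difference contains \<open>z - x\<close>, which is
  again such a quotient.\<close>

lemma second_difference: "x - 2 * y + z = - 2 * b\<^sup>2 / ((z + y) * (y + x) * (z + x))"
proof -
  have 1: "z - y = b / (z + y)" using z2 pos by (simp add: field_simps power2_eq_square)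
  have 2: "y - x = b / (y + x)" using x2 pos by (simp add: field_simps power2_eq_square)
  have 3: "z - x = 2 * b / (z + x)" using x2 z2 pos by (simp add: field_simps power2_eq_square)
  have "x - 2 * y + z = b / (z + y) - b / (y + x)" using 1 2 by linarith
  also have "\<dots> = - b * (z - x) / ((z + y) * (y + x))" using pos by (simp add: field_simps)
  also have "\<dots> = - 2 * b\<^sup>2 / ((z + y) * (y + x) * (z + x))" unfolding 3 by (simp add: power2_eq_square mult_ac)
  finally show ?thesis .
qed

lemma second_difference_bounds: "x - 2 * y + z \<le> - (b\<^sup>2 / 4 / y ^ 3)" "- (b\<^sup>2 / 4 / x ^ 3) \<le> x - 2 * y + z"
proof -
  have "(z + y) * (y + x) = y\<^sup>2 + y * (x + z) + x * z" by (simp add: power2_eq_square algebra_simps)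
  also have "\<dots> \<le> y\<^sup>2 + y * (2 * y) + y\<^sup>2"
    using xyz_order pos by (intro add_mono mult_left_mono) auto
  finally have p: "(z + y) * (y + x) \<le> 4 * y\<^sup>2" by (simp add: power2_eq_square)
  have "(z + y) * (y + x) * (z + x) \<le> 4 * y\<^sup>2 * (2 * y)"
    by (rule mult_mono[OF p]) (use xyz_order pos in auto)
  then have "2 * b\<^sup>2 / (4 * y\<^sup>2 * (2 * y)) \<le> 2 * b\<^sup>2 / ((z + y) * (y + x) * (z + x))"
    using pos by (intro divide_left_mono) auto
  then show "x - 2 * y + z \<le> - (b\<^sup>2 / 4 / y ^ 3)"
    unfolding second_difference by (simp add: power2_eq_square power3_eq_cube)
  have "(2 * x) * (2 * x) * (2 * x) \<le> (z + y) * (y + x) * (z + x)"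
    using xyz_order pos by (intro mult_mono) auto
  then have "2 * b\<^sup>2 / ((z + y) * (y + x) * (z + x)) \<le> 2 * b\<^sup>2 / ((2 * x) * (2 * x) * (2 * x))"
    using pos by (intro divide_left_mono) auto
  then show "- (b\<^sup>2 / 4 / x ^ 3) \<le> x - 2 * y + z"
    unfolding second_difference by (simp add: power2_eq_square power3_eq_cube)
qed

text \<open>Everything is expressed through \<open>D = y^2 - x * z\<close>, using
  \<open>b^2 = D * (y^2 + x * z)\<close> and \<open>(x + z)^2 = 4 * y^2 - 2 * D\<close>. To leading
  order \<open>D\<close> is \<open>b^2 / (2 * y^2)\<close>, and \<open>(y - 1)^2 * x * z\<close>
  exceeds \<open>(x - 1) * (z - 1) * y^2\<close> by about \<open>3/2 * D * y\<close>, which is where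
  \<open>3 * b^2 / (4 * y^5)\<close> comes from.\<close>

lemma one_minus_inverse_product:
  assumes y: "2 \<le> y" "b \<le> y"
  shows "(x - 1) * (z - 1) * y\<^sup>2 \<le> (y - 1)\<^sup>2 * (x * z) * (1 - 3 * b\<^sup>2 / 4 / y ^ 5)"
proof -
  define q where "q = x * z"
  define D where "D = y\<^sup>2 - q"
  have q0: "q > 0" using pos by (simp add: q_def)
  have qy: "q \<le> y\<^sup>2" using xyz_order by (simp add: q_def)
  have D0: "D \<ge> 0" using qy by (simp add: D_def)
  have "q\<^sup>2 = (y\<^sup>2)\<^sup>2 - b\<^sup>2" unfolding q_def power_mult_distrib x2 z2 by (simp add: power2_eq_square algebra_simps)
  then have bD: "b\<^sup>2 = D * (y\<^sup>2 + q)" by (simp add: D_def power2_eq_square algebra_simps)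
  have D1: "D \<le> 1"
  proof (rule ccontr)
    assume "\<not> D \<le> 1"
    then have "1 * y\<^sup>2 < D * (y\<^sup>2 + q)" using q0 pos by (intro mult_strict_mono) auto
    moreover have "b\<^sup>2 \<le> y\<^sup>2" using y b by (intro power_mono) auto
    ultimately show False using bD by simp
  qed
  \<comment> \<open>Squaring reduces this to
    \<open>sqrt (4 - 2 * \<eta>) >= 2 - \<eta> / 2 - \<eta>^2 / 4\<close> for
    \<open>\<eta> = D / y^2\<close>.\<close>
  have sum: "(x + z) * y \<ge> 2 * y\<^sup>2 - D / 2 - D\<^sup>2 / (4 * y\<^sup>2)"
  proof (rule power2_le_imp_le)
    define \<eta> where "\<eta> = D / y\<^sup>2"
    have Dy: "D = \<eta> * y\<^sup>2" using pos by (simp add: \<eta>_def)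
    have \<eta>: "0 \<le> \<eta>" "\<eta> \<le> 1" using D0 q0 by (auto simp: \<eta>_def D_def divide_le_eq)
    have "(2 - \<eta> / 2 - \<eta>\<^sup>2 / 4)\<^sup>2 \<le> 4 - 2 * \<eta>"
    proof -
      have "4 - 2 * \<eta> - (2 - \<eta> / 2 - \<eta>\<^sup>2 / 4)\<^sup>2 = \<eta>\<^sup>2 * (3 / 4 - \<eta> / 4 - \<eta>\<^sup>2 / 16)"
        by (simp add: power2_eq_square field_simps)
      moreover have "\<eta>\<^sup>2 \<le> 1" using \<eta> by (simp add: power_le_one)
      then have "\<eta>\<^sup>2 * (3 / 4 - \<eta> / 4 - \<eta>\<^sup>2 / 16) \<ge> 0" using \<eta> by (intro mult_nonneg_nonneg) auto
      ultimately show ?thesis by linarith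
    qed
    then have "(2 - \<eta> / 2 - \<eta>\<^sup>2 / 4)\<^sup>2 * (y\<^sup>2)\<^sup>2 \<le> (4 - 2 * \<eta>) * (y\<^sup>2)\<^sup>2" by (intro mult_right_mono) auto
    moreover have "2 * y\<^sup>2 - D / 2 - D\<^sup>2 / (4 * y\<^sup>2) = (2 - \<eta> / 2 - \<eta>\<^sup>2 / 4) * y\<^sup>2"
      unfolding Dy using pos by (simp add: field_simps power2_eq_square)
    moreover have "((x + z) * y)\<^sup>2 = (4 - 2 * \<eta>) * (y\<^sup>2)\<^sup>2"
    proof -
      have "((x + z) * y)\<^sup>2 = (x\<^sup>2 + z\<^sup>2 + 2 * q) * y\<^sup>2" by (simp add: q_def power2_eq_square algebra_simps)
      also have "x\<^sup>2 + z\<^sup>2 + 2 * q = 4 * y\<^sup>2 - 2 * D" unfolding x2 z2 D_def by simp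
      finally show ?thesis unfolding Dy by (simp add: power2_eq_square algebra_simps)
    qed
    ultimately show "(2 * y\<^sup>2 - D / 2 - D\<^sup>2 / (4 * y\<^sup>2))\<^sup>2 \<le> ((x + z) * y)\<^sup>2" by (simp add: power_mult_distrib)
    show "0 \<le> (x + z) * y" using pos by simp
  qed
  have e1: "(y - 1)\<^sup>2 * q - (x - 1) * (z - 1) * y\<^sup>2 = y * ((x + z) * y - 2 * q) - D"
    unfolding D_def q_def by (simp add: power2_eq_square algebra_simps)
  have e2: "y * ((x + z) * y - 2 * q) - D \<ge> y * (3 / 2 * D - D\<^sup>2 / (4 * y\<^sup>2)) - D"
  proof -
    have "3 / 2 * D - D\<^sup>2 / (4 * y\<^sup>2) \<le> (x + z) * y - 2 * q" using sum D_def by linarith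
    then show ?thesis using pos by (intro diff_right_mono mult_left_mono) auto
  qed
  have e3: "y * (3 / 2 * D - D\<^sup>2 / (4 * y\<^sup>2)) - D = D * (3 / 2 * y - 1 - D / (4 * y))"
    using pos by (simp add: field_simps power2_eq_square)
  have e4: "D * (3 / 2 * y - 1 - D / (4 * y)) \<ge> D * (3 / 2 * (y - 1)\<^sup>2 / y)"
  proof (rule mult_left_mono[OF _ D0])
    have "3 / 2 * (y - 1)\<^sup>2 / y = 3 / 2 * y - 3 + 3 / 2 / y" using pos by (simp add: field_simps power2_eq_square)
    moreover have "3 / 2 / y \<le> 3 / 2 / 2" using y by (intro divide_left_mono) auto
    moreover have "D / (4 * y) \<le> 1 / (4 * 2)" using y D0 D1 by (intro frac_le) auto
    ultimately show "3 / 2 * (y - 1)\<^sup>2 / y \<le> 3 / 2 * y - 1 - D / (4 * y)" by simp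
  qed
  have e5: "D * (3 / 2 * (y - 1)\<^sup>2 / y) \<ge> (y - 1)\<^sup>2 * q * (3 * b\<^sup>2 / 4 / y ^ 5)"
  proof -
    have "b\<^sup>2 \<le> D * (2 * y\<^sup>2)" unfolding bD using qy D0 by (intro mult_left_mono) auto
    then have "q * b\<^sup>2 \<le> y\<^sup>2 * (D * (2 * y\<^sup>2))" using qy q0 by (intro mult_mono) auto
    then have "(y - 1)\<^sup>2 * (q * b\<^sup>2) * (3 / 4 / y ^ 5) \<le> (y - 1)\<^sup>2 * (y\<^sup>2 * (D * (2 * y\<^sup>2))) * (3 / 4 / y ^ 5)"
      using pos by (intro mult_right_mono mult_left_mono) auto
    also have "\<dots> = D * (3 / 2 * (y - 1)\<^sup>2 / y)"
      using pos by (simp add: field_simps eval_nat_numeral)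
    finally show ?thesis by (simp add: mult_ac)
  qed
  have "(y - 1)\<^sup>2 * q - (x - 1) * (z - 1) * y\<^sup>2 \<ge> (y - 1)\<^sup>2 * q * (3 * b\<^sup>2 / 4 / y ^ 5)"
    using e1 e2 e3 e4 e5 by linarith
  then show ?thesis by (simp add: q_def right_diff_distrib)
qed

end

text \<open>This is \<open>part_main x * part_main z / (part_main y)^2\<close>, and also what is
  left of \<open>f_fun\<close> when the constants -1, -1 and +1 in \<open>x^10 - x^9 - 1\<close>,
  \<open>z^10 - z^9 - 1\<close> and \<open>y^10 - y^9 + 1\<close> are dropped.\<close>

definition g_fun :: "real \<Rightarrow> real \<Rightarrow> real \<Rightarrow> real" where
  "g_fun x y z = exp (x - 2 * y + z) * ((x - 1) * (z - 1) * y ^ 6 / (x ^ 3 * z ^ 3 * (y - 1)\<^sup>2))"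

text \<open>The three factors bound the exponential, the quotient of the terms
  \<open>1 - 1/x\<close>, \<open>1 - 1/z\<close>, \<open>(1 - 1/y)^2\<close>, and
  \<open>y^4 / (x * z)^2\<close>; in the application \<open>c = pi^4 / 9\<close>, about 10.82. In
  the product the cross term \<open>- h * t\<close> outweighs \<open>11/10 * h^2\<close> because
  \<open>h = 4 * t / y\<close>, and \<open>60 / y^6\<close> absorbs
  \<open>t^2 / 2 + j * t\<close>.\<close>

lemma g_poly_bound:
  fixes c y :: real
  assumes y: "y \<ge> 236 / 10" and c: "10 \<le> c" "c \<le> 1083 / 100"
  shows "exp (- (c / y ^ 3)) * (1 - 3 * c / y ^ 5) * (y ^ 4 / (y ^ 4 - 4 * c))
     \<le> 1 - c / y ^ 3 + 4 * c / y ^ 4 - 3 * c / y ^ 5 + 60 / y ^ 6"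
proof -
  define w where "w = 1 / y"
  have w: "0 < w" "w \<le> 1 / 23" using y by (auto simp: w_def field_simps)
  define t h j where "t = c * w ^ 3" and "h = 4 * c * w ^ 4" and "j = 3 * c * w ^ 5"
  have yw: "c / y ^ 3 = t" "4 * c / y ^ 4 = h" "3 * c / y ^ 5 = j" "60 / y ^ 6 = 60 * w ^ 6"
    by (simp_all add: t_def h_def j_def w_def power_divide)
  have ht: "h = 4 * w * t" by (simp add: h_def t_def eval_nat_numeral)
  have jt: "j = 3 * w\<^sup>2 * t" by (simp add: j_def t_def eval_nat_numeral)
  have t0: "t > 0" using w c by (simp add: t_def)
  have t1: "t \<le> 1 / 100"
  proof -
    have "c * w ^ 3 \<le> (1083 / 100) * (1 / 23) ^ 3" using c w by (intro mult_mono power_mono) auto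
    then show ?thesis unfolding t_def by (simp add: power_divide)
  qed
  have h0: "h > 0" unfolding ht using w t0 by simp
  have h1: "h \<le> 1 / 500"
  proof -
    have "4 * w * t \<le> (4 / 23) * (1 / 100)" using w t1 t0 by (intro mult_mono) auto
    then show ?thesis unfolding ht by simp
  qed
  have j0: "j > 0" unfolding jt using w t0 by simp
  have j1: "j \<le> 1"
  proof -
    have "3 * w\<^sup>2 * t \<le> 3 * (1 / 23)\<^sup>2 * (1 / 100)" using w t1 t0 by (intro mult_mono power_mono) auto
    also have "\<dots> \<le> 1" by (simp add: power2_eq_square)
    finally show ?thesis unfolding jt .
  qed
  have A: "exp (- t) \<le> 1 - t + t\<^sup>2 / 2"
  proof -
    have e: "1 + t + t\<^sup>2 / 2 \<le> exp t" using t0 by (intro exp_lower_Taylor_quadratic) auto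
    have "(1 - t + t\<^sup>2 / 2) * (1 + t + t\<^sup>2 / 2) = 1 + (t\<^sup>2)\<^sup>2 / 4" by (simp add: power2_eq_square algebra_simps)
    then have "1 \<le> (1 - t + t\<^sup>2 / 2) * (1 + t + t\<^sup>2 / 2)" by simp
    also have "\<dots> \<le> (1 - t + t\<^sup>2 / 2) * exp t" using e t1 t0 by (intro mult_left_mono) auto
    finally show ?thesis by (simp add: exp_minus field_simps)
  qed
  have eqB: "y ^ 4 / (y ^ 4 - 4 * c) = 1 / (1 - h)"
  proof -
    have "4 * c = h * y ^ 4" using yw(2) y by (simp add: field_simps)
    then have "y ^ 4 - 4 * c = y ^ 4 * (1 - h)" by (simp add: algebra_simps)
    then show ?thesis using y by simp
  qed
  have Y0: "0 \<le> y ^ 4 / (y ^ 4 - 4 * c)" unfolding eqB using h1 by simp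
  have B: "y ^ 4 / (y ^ 4 - 4 * c) \<le> 1 + h + 11 / 10 * h\<^sup>2"
  proof -
    have "y ^ 4 / (y ^ 4 - 4 * c) = 1 / (1 - h)" by (rule eqB)
    also have "\<dots> \<le> 1 + h + 11 / 10 * h\<^sup>2"
    proof -
      have "(1 + h + 11 / 10 * h\<^sup>2) * (1 - h) = 1 + h\<^sup>2 * (1 / 10 - 11 / 10 * h)"
        by (simp add: power2_eq_square field_simps)
      moreover have "h\<^sup>2 * (1 / 10 - 11 / 10 * h) \<ge> 0" using h1 by (intro mult_nonneg_nonneg) auto
      ultimately have "1 \<le> (1 + h + 11 / 10 * h\<^sup>2) * (1 - h)" by linarith
      then show ?thesis using h1 by (simp add: pos_divide_le_eq)
    qed
    finally show ?thesis .
  qed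
  have AB: "(1 - t + t\<^sup>2 / 2) * (1 + h + 11 / 10 * h\<^sup>2) \<le> 1 - t + h + t\<^sup>2 / 2"
  proof -
    have s: "1 - t + t\<^sup>2 / 2 \<le> 1"
    proof -
      have "t * t \<le> t * 1" using t0 t1 by (intro mult_left_mono) auto
      then show ?thesis using t0 by (simp add: power2_eq_square)
    qed
    have "(1 - t + t\<^sup>2 / 2) * (1 + h + 11 / 10 * h\<^sup>2)
        = 1 - t + h + t\<^sup>2 / 2 - h * (t - t\<^sup>2 / 2) + (1 - t + t\<^sup>2 / 2) * (11 / 10 * h\<^sup>2)"
      by (simp add: algebra_simps)
    also have "(1 - t + t\<^sup>2 / 2) * (11 / 10 * h\<^sup>2) \<le> 1 * (11 / 10 * h\<^sup>2)" using s by (intro mult_right_mono) auto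
    also have "1 * (11 / 10 * h\<^sup>2) \<le> h * (t - t\<^sup>2 / 2)"
    proof -
      have "44 / 10 * w \<le> 1 / 2" using w by simp
      then have "44 / 10 * w * t \<le> 1 / 2 * t" using t0 by (intro mult_right_mono) auto
      also have "1 / 2 * t \<le> t - t\<^sup>2 / 2"
      proof -
        have "t * t \<le> t * 1" using t0 t1 by (intro mult_left_mono) auto
        then show ?thesis by (simp add: power2_eq_square)
      qed
      finally have "h * (44 / 10 * w * t) \<le> h * (t - t\<^sup>2 / 2)" using h0 by (intro mult_left_mono) auto
      then show ?thesis by (simp add: ht power2_eq_square mult_ac)
    qed
    finally show ?thesis by simp
  qed
  have "exp (- t) * (1 - j) * (y ^ 4 / (y ^ 4 - 4 * c)) \<le> (1 - t + t\<^sup>2 / 2) * (1 - j) * (1 + h + 11 / 10 * h\<^sup>2)"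
  proof (rule mult_mono[OF mult_right_mono[OF A] B _ Y0])
    show "0 \<le> (1 - t + t\<^sup>2 / 2) * (1 - j)" using j1 t1 by (intro mult_nonneg_nonneg) auto
  qed (use j1 in simp)
  also have "\<dots> = (1 - t + t\<^sup>2 / 2) * (1 + h + 11 / 10 * h\<^sup>2) * (1 - j)" by simp
  also have "\<dots> \<le> (1 - t + h + t\<^sup>2 / 2) * (1 - j)" using AB j1 by (intro mult_right_mono) auto
  also have "\<dots> \<le> 1 - t + h + t\<^sup>2 / 2 - j + j * t"
    using j0 h0 by (simp add: algebra_simps)
  finally have main: "exp (- t) * (1 - j) * (y ^ 4 / (y ^ 4 - 4 * c)) \<le> 1 - t + h + t\<^sup>2 / 2 - j + j * t" .
  have "t\<^sup>2 / 2 + j * t \<le> 60 * w ^ 6"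
  proof -
    have "t\<^sup>2 / 2 + j * t = c\<^sup>2 * w ^ 6 * (1 / 2 + 3 * w\<^sup>2)" unfolding jt t_def by (simp add: eval_nat_numeral algebra_simps)
    also have "\<dots> \<le> (1083 / 100)\<^sup>2 * w ^ 6 * (1 / 2 + 3 * (1 / 23)\<^sup>2)"
      using c w by (intro mult_mono power_mono add_left_mono) auto
    also have "\<dots> \<le> 60 * w ^ 6" using w by (simp add: power2_eq_square)
    finally show ?thesis .
  qed
  then show ?thesis using main unfolding yw by linarith
qed

lemma mu_sq: "n \<ge> 1 \<Longrightarrow> (mu n)\<^sup>2 = pi\<^sup>2 / 36 * (24 * real n - 1)"
  by (simp add: mu_def power_mult_distrib power_divide)

lemma mu_pos: "n \<ge> 1 \<Longrightarrow> mu n > 0"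
  by (simp add: mu_def)

lemma mu_triple:
  assumes "n \<ge> 2"
  shows "(mu (n - 1))\<^sup>2 = (mu n)\<^sup>2 - 2 * pi\<^sup>2 / 3" "(mu (n + 1))\<^sup>2 = (mu n)\<^sup>2 + 2 * pi\<^sup>2 / 3"
  using assms by (simp_all add: mu_sq of_nat_diff field_simps)

lemma pi_square_bounds: "9869 / 1000 \<le> pi\<^sup>2" "pi\<^sup>2 \<le> 9870 / 1000"
proof -
  have "(31415 / 10000)\<^sup>2 \<le> pi\<^sup>2" "pi\<^sup>2 \<le> (31416 / 10000)\<^sup>2" using pi_approx by (intro power_mono; simp)+
  then show "9869 / 1000 \<le> pi\<^sup>2" "pi\<^sup>2 \<le> 9870 / 1000" by (simp_all add: power2_eq_square)
qed

lemma f_le_g: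
  fixes x y z :: real
  assumes "2 \<le> x" "2 \<le> y" "2 \<le> z"
  shows "exp (x - 2 * y + z) * (((x ^ 10 - x ^ 9 - 1) * y ^ 24 * (z ^ 10 - z ^ 9 - 1)) /
        (x ^ 12 * (y ^ 10 - y ^ 9 + 1)\<^sup>2 * z ^ 12)) \<le> g_fun x y z"
proof -
  have e: "u ^ 10 - u ^ 9 = u ^ 9 * (u - 1)" for u :: real by (simp add: eval_nat_numeral algebra_simps)
  have p: "u ^ 9 * (u - 1) \<ge> 1" if "2 \<le> u" for u :: real
  proof -
    have "(1::real) * 1 \<le> u ^ 9 * (u - 1)" using that by (intro mult_mono) (auto intro: one_le_power)
    then show ?thesis by simp
  qed
  have "((x ^ 10 - x ^ 9 - 1) * y ^ 24 * (z ^ 10 - z ^ 9 - 1)) / (x ^ 12 * (y ^ 10 - y ^ 9 + 1)\<^sup>2 * z ^ 12)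
      \<le> ((x ^ 9 * (x - 1)) * y ^ 24 * (z ^ 9 * (z - 1))) / (x ^ 12 * (y ^ 9 * (y - 1))\<^sup>2 * z ^ 12)"
    unfolding e
  proof (rule frac_le)
    show "(x ^ 9 * (x - 1) - 1) * y ^ 24 * (z ^ 9 * (z - 1) - 1) \<le> x ^ 9 * (x - 1) * y ^ 24 * (z ^ 9 * (z - 1))"
      using p[of x] p[of z] assms by (intro mult_mono mult_nonneg_nonneg) auto
    show "0 \<le> x ^ 9 * (x - 1) * y ^ 24 * (z ^ 9 * (z - 1))"
      using assms by (intro mult_nonneg_nonneg) auto
    show "0 < x ^ 12 * (y ^ 9 * (y - 1))\<^sup>2 * z ^ 12" using assms by auto
    show "x ^ 12 * (y ^ 9 * (y - 1))\<^sup>2 * z ^ 12 \<le> x ^ 12 * (y ^ 9 * (y - 1) + 1)\<^sup>2 * z ^ 12"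
      using p[of y] assms by (intro mult_right_mono mult_left_mono power_mono) auto
  qed
  also have "\<dots> = (x - 1) * (z - 1) * y ^ 6 / (x ^ 3 * z ^ 3 * (y - 1)\<^sup>2)"
  proof -
    have q: "x ^ 12 = x ^ 9 * x ^ 3" "z ^ 12 = z ^ 9 * z ^ 3" "y ^ 24 = (y ^ 9)\<^sup>2 * y ^ 6"
      using power_add[of x 9 3] power_add[of z 9 3] power_add[of y 18 6] by (simp_all add: power_mult[symmetric])
    have gen: "(X * (x - 1)) * (Y\<^sup>2 * y ^ 6) * (Z * (z - 1)) / (X * x ^ 3 * (Y * (y - 1))\<^sup>2 * (Z * z ^ 3))
        = (x - 1) * (z - 1) * y ^ 6 / (x ^ 3 * z ^ 3 * (y - 1)\<^sup>2)" if "X > 0" "Y > 0" "Z > 0" for X Y Z :: real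
      using that assms by (simp add: divide_simps power_mult_distrib)
    show ?thesis unfolding q by (rule gen) (use assms in auto)
  qed
  finally show ?thesis unfolding g_fun_def by (intro mult_left_mono) auto
qed

lemma g_decomp:
  fixes x y z :: real
  assumes "1 < x" "1 < y" "1 < z"
  shows "g_fun x y z = exp (x - 2 * y + z) * ((x - 1) * (z - 1) * y\<^sup>2 / ((y - 1)\<^sup>2 * (x * z))) * (y ^ 4 / (x * z)\<^sup>2)"
  using assms unfolding g_fun_def by (simp add: divide_simps) (simp add: eval_nat_numeral algebra_simps)

context
  fixes x y z b :: real
  assumes x1: "1 < x" and pos: "0 < y" "0 < z" and b: "0 < b" "b \<le> y" and x2: "x\<^sup>2 = y\<^sup>2 - b" and z2: "z\<^sup>2 = y\<^sup>2 + b"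
    and y: "y \<ge> 236 / 10" and c: "10 \<le> b\<^sup>2 / 4" "b\<^sup>2 / 4 \<le> 1083 / 100"
begin

lemma x0: "0 < x" using x1 by simp

lemmas xyz = xyz_order[OF x0 pos b(1) x2 z2] second_difference_bounds[OF x0 pos b(1) x2 z2]
  one_minus_inverse_product[OF x0 pos b(1) x2 z2 _ b(2)]

lemma xz_sq: "(x * z)\<^sup>2 = y ^ 4 - b\<^sup>2"
  unfolding power_mult_distrib x2 z2 by (simp add: power2_eq_square eval_nat_numeral algebra_simps)

lemma g_upper:
  "g_fun x y z \<le> 1 - b\<^sup>2 / 4 / y ^ 3 + 4 * (b\<^sup>2 / 4) / y ^ 4 - 3 * (b\<^sup>2 / 4) / y ^ 5 + 60 / y ^ 6"
proof -
  have yz: "1 < y" "1 < z" using y xyz(2) by auto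
  have "(x - 1) * (z - 1) * y\<^sup>2 / ((y - 1)\<^sup>2 * (x * z)) \<le> 1 - 3 * (b\<^sup>2 / 4) / y ^ 5"
    using xyz(7) y yz x1 by (simp add: pos_divide_le_eq mult_ac)
  moreover have "exp (x - 2 * y + z) \<le> exp (- (b\<^sup>2 / 4 / y ^ 3))" using xyz(5) by simp
  ultimately have "exp (x - 2 * y + z) * ((x - 1) * (z - 1) * y\<^sup>2 / ((y - 1)\<^sup>2 * (x * z)))
      \<le> exp (- (b\<^sup>2 / 4 / y ^ 3)) * (1 - 3 * (b\<^sup>2 / 4) / y ^ 5)"
    using yz x1 by (intro mult_mono) auto
  then have "g_fun x y z \<le> exp (- (b\<^sup>2 / 4 / y ^ 3)) * (1 - 3 * (b\<^sup>2 / 4) / y ^ 5) * (y ^ 4 / (x * z)\<^sup>2)"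
    unfolding g_decomp[OF x1 yz] by (intro mult_right_mono) auto
  also have "y ^ 4 / (x * z)\<^sup>2 = y ^ 4 / (y ^ 4 - 4 * (b\<^sup>2 / 4))" by (simp add: xz_sq)
  also note g_poly_bound[OF y c]
  finally show ?thesis .
qed

text \<open>A crude bound suffices: for large \<open>n\<close> it keeps the bound \<open>S\<close>
  for \<open>1 - u_ratio n\<close> below \<open>1/36\<close>. The exponential is estimated by
  \<open>1 + a <= exp a\<close>, the quotient of the terms \<open>1 - 1/x\<close>,
  \<open>1 - 1/z\<close>, \<open>(1 - 1/y)^2\<close> by \<open>1 - 1/x\<close>, and
  \<open>y^4 / (x * z)^2\<close> by 1.\<close>

lemma g_lower: "g_fun x y z \<ge> (1 - b\<^sup>2 / 4 / x ^ 3) * (1 - 1 / x)"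
proof (cases "1 - b\<^sup>2 / 4 / x ^ 3 \<ge> 0")
  case True
  have yz: "1 < y" "1 < z" using y xyz(2) by auto
  have "1 - b\<^sup>2 / 4 / x ^ 3 \<le> exp (x - 2 * y + z)"
    using xyz(6) exp_ge_add_one_self[of "x - 2 * y + z"] by linarith
  moreover have "1 - 1 / x \<le> (x - 1) * (z - 1) * y\<^sup>2 / ((y - 1)\<^sup>2 * (x * z))"
  proof -
    have r: "(x - 1) * (z - 1) * y\<^sup>2 / ((y - 1)\<^sup>2 * (x * z)) = (1 - 1 / x) * ((1 - 1 / z) / ((1 - 1 / y) * (1 - 1 / y)))"
      using x1 yz by (simp add: divide_simps power2_eq_square)
    have "1 - 1 / y \<le> 1 - 1 / z" using xyz(2) yz by (simp add: frac_le)
    moreover have "0 < 1 - 1 / y" "1 - 1 / y \<le> 1" using yz by auto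
    ultimately have "(1 - 1 / y) * (1 - 1 / y) \<le> (1 - 1 / z) * 1" by (intro mult_mono) auto
    then have "1 \<le> (1 - 1 / z) / ((1 - 1 / y) * (1 - 1 / y))" using \<open>0 < 1 - 1 / y\<close> by (simp add: pos_le_divide_eq)
    then have "(1 - 1 / x) * 1 \<le> (1 - 1 / x) * ((1 - 1 / z) / ((1 - 1 / y) * (1 - 1 / y)))"
      using x1 by (intro mult_left_mono) auto
    then show ?thesis unfolding r by simp
  qed
  ultimately have p1: "(1 - b\<^sup>2 / 4 / x ^ 3) * (1 - 1 / x) \<le> exp (x - 2 * y + z) * ((x - 1) * (z - 1) * y\<^sup>2 / ((y - 1)\<^sup>2 * (x * z)))"
    using True x1 by (intro mult_mono) auto
  have p2: "1 \<le> y ^ 4 / (x * z)\<^sup>2"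
  proof -
    have "0 < (x * z)\<^sup>2" using x1 pos by simp
    moreover have "(x * z)\<^sup>2 \<le> y ^ 4" by (simp add: xz_sq)
    ultimately show ?thesis by simp
  qed
  have "(1 - b\<^sup>2 / 4 / x ^ 3) * (1 - 1 / x) * 1 \<le> g_fun x y z"
    unfolding g_decomp[OF x1 yz] by (rule mult_mono[OF p1 p2]) (use yz x1 in auto)
  then show ?thesis by simp
next
  case False
  then have "(1 - b\<^sup>2 / 4 / x ^ 3) * (1 - 1 / x) \<le> 0" using x1 by (intro mult_nonpos_nonneg) auto
  also have "0 \<le> g_fun x y z" unfolding g_fun_def using x1 y xyz(2) by (intro mult_nonneg_nonneg divide_nonneg_nonneg) auto
  finally show ?thesis .
qed

end

text \<open>With \<open>e = b / y^2\<close> one needs \<open>(1 - e)^(-5/2) <= 1 + 2.56 * e\<close>,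
  slightly more than the first order \<open>2.5 * e\<close>; squaring makes this a polynomial
  inequality on \<open>e <= 12/1000\<close>. The constant 80 covers
  \<open>110 * 2.56 * b / y\<close>.\<close>

lemma inverse_fifth_bound:
  fixes x y b :: real
  assumes x: "0 < x" and y: "y \<ge> 236 / 10" and b: "0 < b" "b \<le> 658 / 100" and x2: "x\<^sup>2 = y\<^sup>2 - b"
  shows "110 / x ^ 5 \<le> 110 / y ^ 5 + 80 / y ^ 6"
proof -
  define e where "e = b / y\<^sup>2"
  have y0: "y > 0" using y by simp
  have e0: "0 < e" using b y0 by (simp add: e_def)
  have e1: "e \<le> 12 / 1000"
  proof -
    have "(236 / 10)\<^sup>2 \<le> y\<^sup>2" using y by (intro power_mono) auto
    then have "b / y\<^sup>2 \<le> (658 / 100) / (236 / 10)\<^sup>2" using b by (intro frac_le) auto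
    then show ?thesis by (simp add: e_def power2_eq_square)
  qed
  have x2': "x\<^sup>2 = y\<^sup>2 * (1 - e)" using x2 y0 by (simp add: e_def right_diff_distrib)
  have poly: "1 \<le> (1 + 256 / 100 * e)\<^sup>2 * (1 - e) ^ 5"
  proof -
    have a: "(1 - e) ^ 5 \<ge> 1 - 5 * e + 10 * e\<^sup>2 - 10 * e ^ 3"
    proof -
      have "(1 - e) ^ 5 = 1 - 5 * e + 10 * e\<^sup>2 - 10 * e ^ 3 + e ^ 4 * (5 - e)"
        by (simp add: eval_nat_numeral algebra_simps)
      moreover have "e ^ 4 * (5 - e) \<ge> 0" using e0 e1 by (intro mult_nonneg_nonneg) auto
      ultimately show ?thesis by linarith
    qed
    have "(1 + 256 / 100 * e)\<^sup>2 * (1 - 5 * e + 10 * e\<^sup>2 - 10 * e ^ 3)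
        = 1 + e * (12 / 100 - 90464 / 10000 * e + e\<^sup>2 * (8432 / 1000 + 14336 / 1000 * e - 65536 / 1000 * e\<^sup>2))"
      by (simp add: eval_nat_numeral field_simps)
    moreover have "e * (12 / 100 - 90464 / 10000 * e + e\<^sup>2 * (8432 / 1000 + 14336 / 1000 * e - 65536 / 1000 * e\<^sup>2)) \<ge> 0"
    proof (intro mult_nonneg_nonneg add_nonneg_nonneg)
      have "e\<^sup>2 \<le> (12 / 1000)\<^sup>2" using e0 e1 by (intro power_mono) auto
      then show "0 \<le> 8432 / 1000 + 14336 / 1000 * e - 65536 / 1000 * e\<^sup>2" using e0 by (simp add: power2_eq_square)
    qed (use e0 e1 in auto)
    ultimately have "1 \<le> (1 + 256 / 100 * e)\<^sup>2 * (1 - 5 * e + 10 * e\<^sup>2 - 10 * e ^ 3)" by linarith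
    also have "\<dots> \<le> (1 + 256 / 100 * e)\<^sup>2 * (1 - e) ^ 5" using a by (intro mult_left_mono) auto
    finally show ?thesis .
  qed
  have "(y ^ 5)\<^sup>2 \<le> ((1 + 256 / 100 * e) * x ^ 5)\<^sup>2"
  proof -
    have "((1 + 256 / 100 * e) * x ^ 5)\<^sup>2 = (1 + 256 / 100 * e)\<^sup>2 * (x\<^sup>2) ^ 5"
      by (simp add: power_mult_distrib power_mult[symmetric] mult.commute)
    also have "\<dots> = (y ^ 5)\<^sup>2 * ((1 + 256 / 100 * e)\<^sup>2 * (1 - e) ^ 5)"
      unfolding x2' by (simp add: power_mult_distrib power_mult[symmetric] mult_ac)
    finally show ?thesis using poly by (simp add: mult_le_cancel_left1)
  qed
  then have "y ^ 5 \<le> (1 + 256 / 100 * e) * x ^ 5" by (rule power2_le_imp_le) (use e0 x in auto)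
  then have "110 / x ^ 5 \<le> 110 * (1 + 256 / 100 * e) / y ^ 5" using x y0 by (simp add: field_simps)
  also have "\<dots> = 110 / y ^ 5 + (281.6 * e * y) / y ^ 6"
    using y0 by (simp add: field_simps eval_nat_numeral)
  also have "(281.6 * e * y) / y ^ 6 \<le> 80 / y ^ 6"
  proof (rule divide_right_mono)
    have "281.6 * e * y = 281.6 * b / y" using y0 by (simp add: e_def power2_eq_square)
    also have "\<dots> \<le> 281.6 * (658 / 100) / (236 / 10)" using b y by (intro frac_le) auto
    also have "\<dots> \<le> 80" by simp
    finally show "281.6 * e * y \<le> 80" .
  qed (use y0 in simp)
  finally show ?thesis by simp
qed

lemma mu_ge_85:
  assumes "n \<ge> 85" shows "mu n \<ge> 236 / 10"
proof -
  have "451 / 10 \<le> sqrt (24 * real n - 1)" by (rule real_le_rsqrt) (use assms in \<open>simp add: power2_eq_square\<close>)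
  moreover have "pi / 6 \<ge> 5235 / 10000" using pi_approx by simp
  ultimately have "5235 / 10000 * (451 / 10) \<le> pi / 6 * sqrt (24 * real n - 1)" by (intro mult_mono) auto
  then show ?thesis by (simp add: mu_def)
qed

lemma b_const_bounds:
  defines "b \<equiv> 2 * pi\<^sup>2 / 3"
  shows "0 < b" "b \<le> 658 / 100" "10 \<le> b\<^sup>2 / 4" "b\<^sup>2 / 4 \<le> 1083 / 100" "10821 / 1000 \<le> b\<^sup>2 / 4"
proof -
  show "0 < b" by (simp add: b_def)
  have 1: "65793 / 10000 \<le> b" using pi_square_bounds by (simp add: b_def)
  show 2: "b \<le> 658 / 100" using pi_square_bounds by (simp add: b_def)
  have "(65793 / 10000)\<^sup>2 \<le> b\<^sup>2" using 1 by (intro power_mono) auto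
  then show "10 \<le> b\<^sup>2 / 4" "10821 / 1000 \<le> b\<^sup>2 / 4" by (simp_all add: power2_eq_square)
  have "b\<^sup>2 \<le> (658 / 100)\<^sup>2" using 2 \<open>0 < b\<close> by (intro power_mono) auto
  then show "b\<^sup>2 / 4 \<le> 1083 / 100" by (simp add: power2_eq_square)
qed

lemma mu_mono: "1 \<le> k \<Longrightarrow> k \<le> n \<Longrightarrow> mu k \<le> mu n"
  by (simp add: mu_def)

lemma mu_pred_ge:
  assumes "n \<ge> 85" shows "mu (n - 1) \<ge> 2"
proof -
  have "sqrt 81 \<le> sqrt (24 * real (n - 1) - 1)"
    by (intro real_sqrt_le_mono) (use assms in \<open>simp add: of_nat_diff\<close>)
  moreover have "sqrt 81 = (9::real)" by (rule real_sqrt_unique) auto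
  ultimately have "pi / 6 * 9 \<le> pi / 6 * sqrt (24 * real (n - 1) - 1)" by (intro mult_left_mono) auto
  moreover have "2 \<le> pi / 6 * 9" using pi_gt3 by simp
  ultimately show ?thesis unfolding mu_def by linarith
qed

lemma f_fun_le_g:
  assumes "n \<ge> 85"
  shows "f_fun n \<le> g_fun (mu (n - 1)) (mu n) (mu (n + 1))"
proof -
  have "2 \<le> mu (n - 1)" by (rule mu_pred_ge[OF assms])
  moreover have "mu (n - 1) \<le> mu n" "mu n \<le> mu (n + 1)" using assms by (auto intro!: mu_mono)
  ultimately show ?thesis unfolding f_fun_def Let_def by (intro f_le_g) auto
qed

lemma g_mu_bounds:
  assumes n: "n \<ge> 85"
  defines "x \<equiv> mu (n - 1)" and "y \<equiv> mu n" and "z \<equiv> mu (n + 1)" and "c \<equiv> (2 * pi\<^sup>2 / 3)\<^sup>2 / 4"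
  shows "g_fun x y z \<le> 1 - c / y ^ 3 + 4 * c / y ^ 4 - 3 * c / y ^ 5 + 60 / y ^ 6"
    and "g_fun x y z \<ge> (1 - c / x ^ 3) * (1 - 1 / x)"
proof -
  have x: "1 < x" using mu_pred_ge[OF n] by (simp add: x_def)
  have y: "y \<ge> 236 / 10" unfolding y_def by (rule mu_ge_85[OF n])
  have z: "z > 0" unfolding z_def by (rule mu_pos) simp
  have b: "2 * pi\<^sup>2 / 3 \<le> y" using b_const_bounds(2) y by linarith
  have y0: "0 < y" using y by simp
  have sq: "x\<^sup>2 = y\<^sup>2 - 2 * pi\<^sup>2 / 3" "z\<^sup>2 = y\<^sup>2 + 2 * pi\<^sup>2 / 3"
    using mu_triple[of n] n by (simp_all add: x_def y_def z_def)
  show "g_fun x y z \<le> 1 - c / y ^ 3 + 4 * c / y ^ 4 - 3 * c / y ^ 5 + 60 / y ^ 6"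
    unfolding c_def by (rule g_upper[OF x y0 z b_const_bounds(1) b sq y b_const_bounds(3,4)])
  show "g_fun x y z \<ge> (1 - c / x ^ 3) * (1 - 1 / x)"
    unfolding c_def by (rule g_lower[OF x y0 z b_const_bounds(1) b sq y b_const_bounds(3,4)])
qed

text \<open>One \<open>e\<close>, taken at the smallest argument \<open>x\<close>, bounds the
  relative error of all three partition numbers, and their main terms combine to
  \<open>g_fun\<close>. The hypothesis \<open>n >= 801\<close> makes the asymptotics available at
  \<open>n - 1\<close>.\<close>

lemma u_ratio_bounds:
  assumes n: "n \<ge> 801"
  defines "x \<equiv> mu (n - 1)" and "y \<equiv> mu n" and "z \<equiv> mu (n + 1)"
  defines "e \<equiv> 55 / x ^ 5"
  shows "g_fun x y z * (1 - 4 * e) \<le> u_ratio n" "u_ratio n \<le> g_fun x y z * (1 + 5 * e)" "0 < u_ratio n"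
proof -
  have x: "x \<ge> 145 / 2" unfolding x_def by (rule mu_ge_800) (use n in simp)
  have xy: "x \<le> y" "y \<le> z" using n by (auto simp: x_def y_def z_def intro!: mu_mono)
  have x5: "x ^ 5 \<ge> (145 / 2) ^ 5" using x by (intro power_mono) auto
  have x0: "x > 0" using x by simp
  have "55 / x ^ 5 \<le> 55 / (145 / 2) ^ 5" by (rule divide_left_mono[OF x5]) (use x0 in auto)
  also have "\<dots> \<le> 1 / 1000" by (simp add: power_divide)
  finally have e: "0 < e" "e \<le> 1 / 1000" using x0 by (simp_all only: e_def) simp
  have bd: "(1 - e) * part_main (mu k) \<le> real (partition_p k)" "real (partition_p k) \<le> (1 + e) * part_main (mu k)"
    if k: "k \<ge> 800" and xk: "x \<le> mu k" for k
  proof -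
    have "55 / mu k ^ 5 \<le> e" unfolding e_def using xk x by (intro divide_left_mono power_mono) auto
    moreover have p: "part_main (mu k) > 0" using xk x by (intro part_main_pos) auto
    ultimately have "55 / mu k ^ 5 * part_main (mu k) \<le> e * part_main (mu k)" by (intro mult_right_mono) auto
    with partition_relative_error[OF k] have "\<bar>real (partition_p k) - part_main (mu k)\<bar> \<le> e * part_main (mu k)" by linarith
    then show "(1 - e) * part_main (mu k) \<le> real (partition_p k)" "real (partition_p k) \<le> (1 + e) * part_main (mu k)"
      by (auto simp: algebra_simps)
  qed
  define A B C where "A = part_main x" and "B = part_main y" and "C = part_main z"
  have P: "A > 0" "B > 0" "C > 0" using x xy by (auto simp: A_def B_def C_def intro!: part_main_pos)
  define p q r where "p = real (partition_p (n - 1))" and "q = real (partition_p n)" and "r = real (partition_p (n + 1))"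
  have bp: "(1 - e) * A \<le> p" "p \<le> (1 + e) * A" using bd[of "n - 1"] n by (auto simp: A_def p_def x_def)
  have bq: "(1 - e) * B \<le> q" "q \<le> (1 + e) * B" using bd[of n] n xy by (auto simp: B_def q_def y_def)
  have br: "(1 - e) * C \<le> r" "r \<le> (1 + e) * C" using bd[of "n + 1"] n xy by (auto simp: C_def r_def z_def)
  have "0 < (1 - e) * A" "0 < (1 - e) * B" "0 < (1 - e) * C" using P e by auto
  then have pqr: "p > 0" "q > 0" "r > 0" using bp bq br by linarith+
  have u: "u_ratio n = r * p / q\<^sup>2" by (simp add: u_ratio_def p_def q_def r_def)
  show "0 < u_ratio n" unfolding u using pqr by simp
  have g: "g_fun x y z = C * A / B\<^sup>2"
  proof -
    have ex: "exp (x - 2 * y + z) = exp x * exp z / (exp y)\<^sup>2"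
      by (simp add: exp_add exp_diff exp_double)
    have "K * ((z - 1) * ez / z ^ 3) * (K * ((x - 1) * ex / x ^ 3)) / (K * ((y - 1) * ey / y ^ 3))\<^sup>2
        = ex * ez / ey\<^sup>2 * ((x - 1) * (z - 1) * y ^ 6 / (x ^ 3 * z ^ 3 * (y - 1)\<^sup>2))"
      if "K > 0" "ey > 0" for K ex ey ez :: real
      using that x xy by (simp add: divide_simps power_mult_distrib power_mult[symmetric]) (simp add: power2_eq_square mult_ac)
    from this[of "pi\<^sup>2 * sqrt 12 / 36" "exp y" "exp z" "exp x"]
    show ?thesis unfolding g_fun_def A_def B_def C_def part_main_def ex by simp
  qed
  have g0: "C * A / B\<^sup>2 > 0" using P by simp
  have "((1 - e) * C) * ((1 - e) * A) / ((1 + e) * B)\<^sup>2 \<le> r * p / q\<^sup>2"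
    using bp bq br P e pqr by (intro frac_le mult_mono power_mono) auto
  moreover have "((1 - e) * C) * ((1 - e) * A) / ((1 + e) * B)\<^sup>2 = C * A / B\<^sup>2 * ((1 - e)\<^sup>2 / (1 + e)\<^sup>2)"
    by (simp add: power_mult_distrib power2_eq_square mult_ac)
  moreover have "1 - 4 * e \<le> (1 - e)\<^sup>2 / (1 + e)\<^sup>2"
  proof -
    have "(1 - 4 * e) * (1 + e)\<^sup>2 = (1 - e)\<^sup>2 - (8 * e\<^sup>2 + 4 * (e\<^sup>2 * e))" by (simp add: power2_eq_square algebra_simps)
    also have "\<dots> \<le> (1 - e)\<^sup>2" using mult_nonneg_nonneg[of "e\<^sup>2" e] e zero_le_power2[of e] by linarith
    finally show ?thesis using e by (simp add: pos_le_divide_eq)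
  qed
  then have "C * A / B\<^sup>2 * (1 - 4 * e) \<le> C * A / B\<^sup>2 * ((1 - e)\<^sup>2 / (1 + e)\<^sup>2)" using g0 by (intro mult_left_mono) auto
  ultimately show "g_fun x y z * (1 - 4 * e) \<le> u_ratio n" unfolding g u by linarith
  have "r * p / q\<^sup>2 \<le> ((1 + e) * C) * ((1 + e) * A) / ((1 - e) * B)\<^sup>2"
    using bp bq br P e pqr by (intro frac_le mult_mono power_mono) auto
  moreover have "((1 + e) * C) * ((1 + e) * A) / ((1 - e) * B)\<^sup>2 = C * A / B\<^sup>2 * ((1 + e)\<^sup>2 / (1 - e)\<^sup>2)"
    by (simp add: power_mult_distrib power2_eq_square mult_ac)
  moreover have "(1 + e)\<^sup>2 / (1 - e)\<^sup>2 \<le> 1 + 5 * e"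
  proof -
    have "(1 + 5 * e) * (1 - e)\<^sup>2 = (1 + e)\<^sup>2 + (e * (1 - 10 * e) + 5 * (e\<^sup>2 * e))" by (simp add: power2_eq_square algebra_simps)
    moreover have "e * (1 - 10 * e) \<ge> 0" "e\<^sup>2 * e \<ge> 0" using e by auto
    ultimately have "(1 + e)\<^sup>2 \<le> (1 + 5 * e) * (1 - e)\<^sup>2" by linarith
    then show ?thesis using e by (simp add: pos_divide_le_eq)
  qed
  then have "C * A / B\<^sup>2 * ((1 + e)\<^sup>2 / (1 - e)\<^sup>2) \<le> C * A / B\<^sup>2 * (1 + 5 * e)" using g0 by (intro mult_left_mono) auto
  ultimately show "u_ratio n \<le> g_fun x y z * (1 + 5 * e)" unfolding g u by linarith
qed

text \<open>The bound \<open>S\<close> for \<open>1 - u_ratio n\<close> exceeds \<tau> by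
  \<open>330 / x^5\<close>: \<open>220 / x^5\<close> from the partition numbers and
  \<open>110 / x^5\<close> from the claim. Since \<open>S >= 10 / y^3\<close>, one has
  \<open>S * sqrt S > 220 / x^5\<close>. As \<open>sqrt S <= 1/6\<close>, the term
  \<open>3 * S^2\<close> costs at most a quarter of the gain \<open>2 * S * sqrt S\<close>, and the
  other three quarters exceed \<open>330 / x^5\<close>.\<close>

lemma theorem_large:
  assumes n: "n \<ge> 801"
  shows "f_fun n + 110 / mu (n - 1) ^ 5 < Q_fun (u_ratio n)"
proof -
  define x y z where "x = mu (n - 1)" and "y = mu n" and "z = mu (n + 1)"
  define c where "c = (2 * pi\<^sup>2 / 3)\<^sup>2 / 4"
  define g where "g = g_fun x y z"
  define e where "e = 55 / x ^ 5"
  have n85: "n \<ge> 85" using n by simp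
  have x: "x \<ge> 145 / 2" unfolding x_def by (rule mu_ge_800) (use n in simp)
  have xy: "x \<le> y" using n by (auto simp: x_def y_def intro!: mu_mono)
  have y: "y \<ge> 145 / 2" using x xy by simp
  have c: "10821 / 1000 \<le> c" "c \<le> 1083 / 100" using b_const_bounds by (auto simp: c_def)
  have e0: "e > 0" using x by (simp add: e_def)
  have yp: "10 / y ^ 3 > 0" and xp: "330 / x ^ 5 > 0" using x y by (auto intro!: divide_pos_pos)
  note gb = g_mu_bounds[OF n85, folded x_def y_def z_def c_def, folded g_def]
  note ub = u_ratio_bounds[OF n, folded x_def y_def z_def, folded e_def g_def]
  have g_up: "g \<le> 1 - 10 / y ^ 3"
  proof -
    have "c / y ^ 3 - 4 * c / y ^ 4 + 3 * c / y ^ 5 - 60 / y ^ 6 = (c - 4 * c / y + 3 * c / y\<^sup>2 - 60 / y ^ 3) / y ^ 3"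
      using y by (simp add: field_simps eval_nat_numeral)
    moreover have "c - 4 * c / y + 3 * c / y\<^sup>2 - 60 / y ^ 3 \<ge> 10"
    proof -
      have "4 * c / y \<le> 4 * (1083 / 100) / (145 / 2)" using c y by (intro frac_le) auto
      also have "\<dots> \<le> 6 / 10" by simp
      finally have 1: "4 * c / y \<le> 6 / 10" .
      have "60 / y ^ 3 \<le> 60 / (145 / 2) ^ 3" using y by (intro divide_left_mono power_mono) auto
      also have "\<dots> \<le> 1 / 1000" by (simp add: power_divide)
      finally have 2: "60 / y ^ 3 \<le> 1 / 1000" .
      have "3 * c / y\<^sup>2 \<ge> 0" using c by simp
      then show ?thesis using c 1 2 by linarith
    qed
    then have "10 / y ^ 3 \<le> (c - 4 * c / y + 3 * c / y\<^sup>2 - 60 / y ^ 3) / y ^ 3" using y by (intro divide_right_mono) auto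
    ultimately show ?thesis using gb(1) by linarith
  qed
  have g1: "g \<le> 1" using g_up yp by linarith
  have yx: "y ^ 9 \<le> 102 / 100 * x ^ 9"
  proof -
    have "y\<^sup>2 = x\<^sup>2 + 2 * pi\<^sup>2 / 3" using mu_triple[of n] n by (simp add: x_def y_def)
    also have "\<dots> \<le> x\<^sup>2 + x\<^sup>2 * (3 / 1000)"
    proof -
      have "(145 / 2)\<^sup>2 \<le> x\<^sup>2" using x by (intro power_mono) auto
      then show ?thesis using b_const_bounds(2) by (simp add: power2_eq_square)
    qed
    also have "\<dots> \<le> (1002 / 1000 * x)\<^sup>2" by (simp add: power2_eq_square)
    finally have "y \<le> 1002 / 1000 * x" by (rule power2_le_imp_le) (use x in simp)
    then have "y ^ 9 \<le> (1002 / 1000 * x) ^ 9" using y by (intro power_mono) auto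
    also have "\<dots> = (1002 / 1000) ^ 9 * x ^ 9" by (rule power_mult_distrib)
    also have "\<dots> \<le> 102 / 100 * x ^ 9" using x by (intro mult_right_mono) (auto simp: power_divide)
    finally show ?thesis .
  qed
  define S where "S = 1 - g + 4 * e"
  have S10: "S \<ge> 10 / y ^ 3" using g_up e0 by (simp add: S_def)
  have S36: "S \<le> 1 / 36"
  proof -
    have "c / x ^ 3 \<le> (1083 / 100) / (145 / 2) ^ 3" using c x by (intro frac_le power_mono) auto
    also have "\<dots> \<le> 1 / 1000" by (simp add: power_divide)
    finally have a: "c / x ^ 3 \<le> 1 / 1000" .
    have b: "1 / x \<le> 2 / 145" using x by (simp add: field_simps)
    have "(1 - 1 / 1000) * (1 - 2 / 145) \<le> (1 - c / x ^ 3) * (1 - 1 / x)"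
      by (intro mult_mono; use a b in linarith)
    then have "g \<ge> (1 - 1 / 1000) * (1 - 2 / 145)" using gb(2) by linarith
    moreover have "e \<le> 1 / 10000"
    proof -
      have "e \<le> 55 / (145 / 2) ^ 5" unfolding e_def using x by (intro divide_left_mono power_mono) auto
      also have "\<dots> \<le> 1 / 10000" by (simp add: power_divide)
      finally show ?thesis .
    qed
    ultimately show ?thesis unfolding S_def by simp
  qed
  have S0: "S > 0" using S10 yp by linarith
  have sS: "sqrt S \<le> 1 / 6" by (rule real_le_lsqrt) (use S36 S0 in \<open>auto simp: power2_eq_square\<close>)
  have big: "S * sqrt S > 220 / x ^ 5"
  proof (rule power2_less_imp_less)
    have x0: "x > 0" using x by simp
    have "(220 / x ^ 5)\<^sup>2 = 48400 / x ^ 10" by (simp add: power_divide power_mult[symmetric])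
    \<comment> \<open>By \<open>yx\<close> this needs \<open>48400 * 102/100 < 1000 * x\<close>,
      true from about \<open>x = 50\<close> on.\<close>
    also have "\<dots> < 1000 / y ^ 9"
    proof -
      have "48400 * y ^ 9 \<le> 48400 * (102 / 100 * x ^ 9)" using yx by simp
      also have "\<dots> < 1000 * (x * x ^ 9)" using x by simp
      also have "x * x ^ 9 = x ^ 10" using power_Suc[of x 9] by simp
      finally show ?thesis using x0 y by (simp add: divide_simps mult_ac)
    qed
    also have "\<dots> = (10 / y ^ 3) ^ 3" by (simp add: power_divide power_mult[symmetric])
    also have "\<dots> \<le> S ^ 3" using S10 y by (intro power_mono) auto
    also have "S ^ 3 = (S * sqrt S)\<^sup>2" using S0 by (simp add: power_mult_distrib power3_eq_cube power2_eq_square)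
    finally show "(220 / x ^ 5)\<^sup>2 < (S * sqrt S)\<^sup>2" .
    show "0 \<le> S * sqrt S" using S0 by simp
  qed
  define \<tau> where "\<tau> = 1 - g - 110 / x ^ 5"
  have \<tau>: "S - \<tau> = 330 / x ^ 5" by (simp add: S_def \<tau>_def e_def)
  show ?thesis
  proof (rule Q_criterion[where S = S and \<tau> = \<tau>])
    show "0 < u_ratio n" by (rule ub(3))
    show "u_ratio n \<le> 1"
    proof -
      have "g * (1 + 5 * e) = g + g * (5 * e)" by (simp add: algebra_simps)
      moreover have "g * (5 * e) \<le> 1 * (5 * e)" using g1 e0 by (intro mult_right_mono) auto
      ultimately have "u_ratio n \<le> g + 5 * e" using ub(2) by linarith
      moreover have "5 * e \<le> 10 / y ^ 3"
      proof -
        have "275 * y ^ 3 \<le> 10 * x ^ 5"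
        proof -
          have "y \<le> 2 * x"
          proof (rule ccontr)
            assume "\<not> y \<le> 2 * x"
            then have "(2 * x) ^ 9 < y ^ 9" using x by (intro power_strict_mono) auto
            moreover have "102 / 100 * x ^ 9 \<le> (2 * x) ^ 9" using x by (simp add: power_mult_distrib)
            ultimately show False using yx by linarith
          qed
          then have "y ^ 3 \<le> (2 * x) ^ 3" using y by (intro power_mono) auto
          then have "275 * y ^ 3 \<le> 2200 * x ^ 3" by (simp add: power_mult_distrib)
          also have "\<dots> \<le> 10 * x\<^sup>2 * x ^ 3"
          proof (rule mult_right_mono)
            have "(145 / 2)\<^sup>2 \<le> x\<^sup>2" using x by (intro power_mono) auto
            then show "2200 \<le> 10 * x\<^sup>2" by (simp add: power2_eq_square)
          qed (use x in simp)
          also have "\<dots> = 10 * x ^ 5" using power_add[of x 2 3] by simp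
          finally show ?thesis .
        qed
        then show ?thesis using x y by (simp add: e_def divide_simps mult_ac)
      qed
      ultimately show ?thesis using g_up by linarith
    qed
    show "1 - u_ratio n \<le> S"
    proof -
      have "g * (1 - 4 * e) = g - g * (4 * e)" by (simp add: algebra_simps)
      moreover have "g * (4 * e) \<le> 1 * (4 * e)" using g1 e0 by (intro mult_right_mono) auto
      ultimately show ?thesis using ub(1) unfolding S_def by linarith
    qed
    show "S \<le> 1 / 9" using S36 by simp
    show "f_fun n + 110 / mu (n - 1) ^ 5 \<le> 1 - \<tau>"
      using f_fun_le_g[OF n85] by (simp add: \<tau>_def g_def x_def y_def z_def)
    show "S + S\<^sup>2 < 2 * S * sqrt S + \<tau> * (1 - 2 * S)"
    proof -
      have \<tau>S: "\<tau> \<le> S" using \<tau> xp by linarith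
      have "2 * S * \<tau> \<le> 2 * S * S" using \<tau>S S0 by (intro mult_left_mono) auto
      then have 1: "S + S\<^sup>2 - \<tau> * (1 - 2 * S) \<le> 330 / x ^ 5 + 3 * S\<^sup>2"
        using \<tau> by (simp add: power2_eq_square algebra_simps)
      have "S\<^sup>2 = (S * sqrt S) * sqrt S" using S0 by (simp add: power2_eq_square)
      also have "\<dots> \<le> (S * sqrt S) * (1 / 6)" using sS S0 by (intro mult_left_mono) auto
      finally have "3 * S\<^sup>2 \<le> S * sqrt S / 2" by simp
      then show ?thesis using 1 big by simp
    qed
  qed
qed

section \<open>Arguments up to 800\<close>

text \<open>
  Both functions scan the list \<open>p(n-1), \<dots>, p(0)\<close> for the entries at the pentagonal offsets: \<open>c\<close> entries
  remain to be skipped, and \<open>s\<close>, \<open>d\<close> are the next two gaps. The accumulators change roles, under a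
  negation, after every pair, which realises the alternating signs.
\<close>

function (sequential) pent_first :: "nat \<Rightarrow> nat \<Rightarrow> nat \<Rightarrow> int \<Rightarrow> int \<Rightarrow> int list \<Rightarrow> int"
  and pent_second :: "nat \<Rightarrow> nat \<Rightarrow> nat \<Rightarrow> int \<Rightarrow> int \<Rightarrow> int list \<Rightarrow> int" where
  "pent_first c s d P M [] = P - M"
| "pent_first (Suc c) s d P M (x # xs) = pent_first c s d P M xs"
| "pent_first 0 s d P M (x # xs) = pent_second s s d (P + x) M xs"
| "pent_second c s d P M [] = P - M"
| "pent_second (Suc c) s d P M (x # xs) = pent_second c s d P M xs"
| "pent_second 0 s d P M (x # xs) = - pent_first (Suc (Suc d)) (Suc s) (Suc (Suc d)) M (P + x) xs"
  by pat_completeness auto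
termination
  by (relation "Wellfounded.measure (\<lambda>x. case x of Inl (c,s,d,P,M,xs) \<Rightarrow> length xs | Inr (c,s,d,P,M,xs) \<Rightarrow> length xs)") auto

definition pent_next :: "int list \<Rightarrow> int" where
  "pent_next xs = pent_first 0 0 0 0 0 xs"

lemma pent_first_unfold:
  "pent_first c s d P M xs = (if c < length xs then pent_second s s d (P + xs ! c) M (drop (Suc c) xs) else P - M)"
proof (induction c arbitrary: xs)
  case 0
  then show ?case by (cases xs) auto
next
  case (Suc c)
  then show ?case by (cases xs) auto
qed

lemma pent_second_unfold:
  "pent_second c s d P M xs = (if c < length xs then - pent_first (Suc (Suc d)) (Suc s) (Suc (Suc d)) M (P + xs ! c) (drop (Suc c) xs) else P - M)"
proof (induction c arbitrary: xs)
  case 0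
  then show ?case by (cases xs) auto
next
  case (Suc c)
  then show ?case by (cases xs) auto
qed

text \<open>The gaps between successive pentagonal numbers are \<open>2 * s + 1\<close> and
  \<open>s + 1\<close>; the scan skips one entry less each time, since the entry it reads is
  consumed as well.\<close>

lemma pent_offsets:
  "s * (3 * s + 1) div 2 + 2 * s + 1 = Suc s * (3 * Suc s - 1) div 2"
  "Suc s * (3 * Suc s - 1) div 2 + s + 1 = Suc s * (3 * Suc s + 1) div 2"
proof -
  have "Suc s * (3 * Suc s - 1) = s * (3 * s + 1) + (2 * s + 1) * 2" by (simp add: algebra_simps)
  then show "s * (3 * s + 1) div 2 + 2 * s + 1 = Suc s * (3 * Suc s - 1) div 2"
    by (simp only: div_mult_self3) simp
  have "Suc s * (3 * Suc s + 1) = Suc s * (3 * Suc s - 1) + (s + 1) * 2" by (simp add: algebra_simps)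
  then show "Suc s * (3 * Suc s - 1) div 2 + s + 1 = Suc s * (3 * Suc s + 1) div 2"
    by (simp only: div_mult_self3) simp
qed

text \<open>The default 0 beyond the list realises the convention that \<open>p\<close> vanishes at
  negative arguments.\<close>

definition nth0 :: "int list \<Rightarrow> nat \<Rightarrow> int" where
  "nth0 xs j = (if j < length xs then xs ! j else 0)"

definition pent_term :: "int list \<Rightarrow> nat \<Rightarrow> int" where
  "pent_term xs r = nth0 xs (r * (3 * r - 1) div 2 - 1) + nth0 xs (r * (3 * r + 1) div 2 - 1)"

lemma pent_mono: "(r::nat) \<le> r' \<Longrightarrow> r * (3 * r - 1) div 2 \<le> r' * (3 * r' - 1) div 2"
  by (intro div_le_mono mult_le_mono) auto

lemma pent_le: "(r::nat) * (3 * r - 1) div 2 \<le> r * (3 * r + 1) div 2"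
  by (intro div_le_mono mult_le_mono) auto

lemma pent_term_zero:
  assumes "length xs < s * (3 * s - 1) div 2" "s \<le> r"
  shows "pent_term xs r = 0"
proof -
  have a: "length xs < r * (3 * r - 1) div 2" by (rule less_le_trans[OF assms(1) pent_mono[OF assms(2)]])
  have b: "length xs < r * (3 * r + 1) div 2" by (rule less_le_trans[OF a pent_le])
  have "\<not> r * (3 * r - 1) div 2 - 1 < length xs" "\<not> r * (3 * r + 1) div 2 - 1 < length xs"
    using a b by linarith+
  then show ?thesis by (simp only: pent_term_def nth0_def if_False add_0)
qed

text \<open>Generalised over the stage for the induction: after \<open>s\<close> pairs the scan has
  consumed \<open>s * (3 * s + 1) div 2\<close> entries and has to skip \<open>2 * s\<close> more.
  \<open>R\<close> is any stage after which the next pentagonal offset lies beyond the list.\<close>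

lemma pent_first_sum:
  assumes "length xs < Suc R * (3 * Suc R - 1) div 2" "s \<le> R"
  shows "pent_first (2 * s) s (2 * s) P M (drop (s * (3 * s + 1) div 2) xs)
     = P - M + (\<Sum>r=Suc s..R. (-1) ^ (r - Suc s) * pent_term xs r)"
  using assms(2)
proof (induction "R - s" arbitrary: s P M)
  case 0
  then have s: "s = R" by simp
  have "\<not> 2 * s < length (drop (s * (3 * s + 1) div 2) xs)"
    using assms(1) pent_offsets(1)[of s] unfolding s by simp
  then show ?case unfolding pent_first_unfold by (simp add: s)
next
  case (Suc k)
  then have sR: "s < R" by simp
  define g g1 g2 where "g = s * (3 * s + 1) div 2" and "g1 = Suc s * (3 * Suc s - 1) div 2"
    and "g2 = Suc s * (3 * Suc s + 1) div 2"
  have off: "g + 2 * s + 1 = g1" "g1 + s + 1 = g2"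
    using pent_offsets[of s] by (simp_all only: g_def g1_def g2_def)
  have split: "(\<Sum>r=Suc s..R. (-1) ^ (r - Suc s) * pent_term xs r)
      = pent_term xs (Suc s) - (\<Sum>r=Suc (Suc s)..R. (-1) ^ (r - Suc (Suc s)) * pent_term xs r)"
  proof -
    have "(\<Sum>r=Suc s..R. (-1) ^ (r - Suc s) * pent_term xs r)
      = pent_term xs (Suc s) + (\<Sum>r=Suc (Suc s)..R. (-1) ^ (r - Suc s) * pent_term xs r)"
      using sR by (subst sum.atLeast_Suc_atMost) auto
    also have "(\<Sum>r=Suc (Suc s)..R. (-1) ^ (r - Suc s) * pent_term xs r)
       = (\<Sum>r=Suc (Suc s)..R. - ((-1) ^ (r - Suc (Suc s)) * pent_term xs r))"
    proof (rule sum.cong[OF refl])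
      fix r assume "r \<in> {Suc (Suc s)..R}"
      then have "r - Suc s = Suc (r - Suc (Suc s))" by auto
      then show "(-1) ^ (r - Suc s) * pent_term xs r = - ((-1) ^ (r - Suc (Suc s)) * pent_term xs r)" by simp
    qed
    finally show ?thesis by (simp add: sum_negf)
  qed
  have pt: "pent_term xs (Suc s) = nth0 xs (g1 - 1) + nth0 xs (g2 - 1)"
    by (simp only: pent_term_def g1_def g2_def)
  have zero: "(\<Sum>r=Suc (Suc s)..R. (-1) ^ (r - Suc (Suc s)) * pent_term xs r) = 0" if "length xs < g2"
  proof (rule sum.neutral, rule ballI)
    fix r assume "r \<in> {Suc (Suc s)..R}"
    then have r: "Suc (Suc s) \<le> r" by simp
    have "g2 + 2 * Suc s + 1 = Suc (Suc s) * (3 * Suc (Suc s) - 1) div 2"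
      unfolding g2_def by (rule pent_offsets(1))
    then have "length xs < Suc (Suc s) * (3 * Suc (Suc s) - 1) div 2" using that by linarith
    from pent_term_zero[OF this r] show "(-1) ^ (r - Suc (Suc s)) * pent_term xs r = 0" by simp
  qed
  have A: "pent_first (2 * s) s (2 * s) P M (drop g xs)
     = (if g1 \<le> length xs then pent_second s s (2 * s) (P + nth0 xs (g1 - 1)) M (drop g1 xs) else P - M)"
    unfolding pent_first_unfold using off by (auto simp: nth0_def add.commute)
  have B: "pent_second s s (2 * s) P' M (drop g1 xs)
     = (if g2 \<le> length xs then - pent_first (2 * Suc s) (Suc s) (2 * Suc s) M (P' + nth0 xs (g2 - 1)) (drop g2 xs) else P' - M)" for P'
    unfolding pent_second_unfold using off by (auto simp: nth0_def add.commute)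
  show ?case
  proof (cases "g1 \<le> length xs")
    case False
    then have "length xs < g2" using off by simp
    moreover have "nth0 xs (g1 - 1) = 0" "nth0 xs (g2 - 1) = 0" using False off by (auto simp: nth0_def)
    ultimately show ?thesis unfolding split g_def[symmetric] A pt using False zero by simp
  next
    case g1: True
    show ?thesis
    proof (cases "g2 \<le> length xs")
      case False
      then have "nth0 xs (g2 - 1) = 0" by (auto simp: nth0_def)
      then show ?thesis unfolding split g_def[symmetric] A B pt using g1 False zero by simp
    next
      case True
      have "k = R - Suc s" "Suc s \<le> R" using Suc.hyps(2) by auto
      from Suc.hyps(1)[OF this, of M "P + nth0 xs (g1 - 1) + nth0 xs (g2 - 1)", folded g2_def]
      show ?thesis unfolding split g_def[symmetric] A B pt using g1 True by simp
    qed
  qed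
qed

definition partition_list :: "nat \<Rightarrow> int list" where
  "partition_list n = map (\<lambda>j. int (partition_p (n - 1 - j))) [0..<n]"

lemma partition_list_Suc: "partition_list (Suc n) = int (partition_p n) # partition_list n"
  unfolding partition_list_def by (simp add: upt_conv_Cons map_Suc_upt[symmetric] o_def del: upt_Suc)

lemma nth0_partition_list:
  assumes "g \<ge> 1"
  shows "nth0 (partition_list n) (g - 1) = (if g \<le> n then int (partition_p (n - g)) else 0)"
  using assms by (auto simp: nth0_def partition_list_def)

lemma pent_next_partition_list:
  assumes n: "n \<ge> 1"
  shows "pent_next (partition_list n) = int (partition_p n)"
proof -
  have len: "length (partition_list n) = n" by (simp add: partition_list_def)
  have "n < Suc n * (3 * Suc n - 1) div 2"
  proof -
    have "2 * Suc n \<le> Suc n * (3 * Suc n - 1)" using n by simp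
    from div_le_mono[OF this, of 2] show ?thesis by simp
  qed
  then have "pent_next (partition_list n) = (\<Sum>r=1..n. (-1) ^ (r - 1) * pent_term (partition_list n) r)"
    using pent_first_sum[of "partition_list n" n 0 0 0] by (simp add: pent_next_def len)
  also have "\<dots> = (\<Sum>s=1..n. (-1)^(s+1) *
     ((if s*(3 * s-1) div 2 \<le> n then int (partition_p (n - s*(3 * s-1) div 2)) else 0)
      + (if s*(3 * s+1) div 2 \<le> n then int (partition_p (n - s*(3 * s+1) div 2)) else 0)))"
  proof (rule sum.cong[OF refl])
    fix s assume "s \<in> {1..n}"
    then obtain k where s: "s = Suc k" by (cases s) auto
    have g: "s * (3 * s - 1) div 2 \<ge> 1" "s * (3 * s + 1) div 2 \<ge> 1"
      using pent_offsets[of k] unfolding s by linarith+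
    have "(-1) ^ (s - 1) = ((-1) ^ (s + 1) :: int)" by (simp add: s)
    then show "(-1) ^ (s - 1) * pent_term (partition_list n) s = (-1)^(s+1) *
     ((if s*(3 * s-1) div 2 \<le> n then int (partition_p (n - s*(3 * s-1) div 2)) else 0)
      + (if s*(3 * s+1) div 2 \<le> n then int (partition_p (n - s*(3 * s+1) div 2)) else 0))"
      unfolding pent_term_def nth0_partition_list[OF g(1)] nth0_partition_list[OF g(2)] by simp
  qed
  also have "\<dots> = int (partition_p n)" using partition_pentagonal[of n] n by simp
  finally show ?thesis .
qed

text \<open>Substituting \<open>y = pi * sqrt N / 6\<close> leaves \<open>pi\<close> and
  \<open>sqrt N\<close> as the only irrational quantities. Unlike the estimate of
  \<open>p(n)\<close>, this bound is available from \<open>n = 85\<close> on.\<close>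

lemma tau_bound:
  assumes n: "n \<ge> 85"
  defines "N \<equiv> 24 * real n - 1"
  shows "f_fun n + 110 / mu (n - 1) ^ 5
     \<le> 1 - (24 * pi / (N * sqrt N) - 576 / N\<^sup>2 - 1971 / (N\<^sup>2 * sqrt N) - 6800 / N ^ 3)"
proof -
  define x y z where "x = mu (n - 1)" and "y = mu n" and "z = mu (n + 1)"
  define R where "R = sqrt N"
  define c where "c = (2 * pi\<^sup>2 / 3)\<^sup>2 / 4"
  have N0: "N > 0" using n by (simp add: N_def)
  have R: "R > 0" "N = R\<^sup>2" using N0 by (simp_all add: R_def)
  have y: "y = pi * R / 6" by (simp add: y_def mu_def R_def N_def)
  have c: "c = pi ^ 4 / 9" by (simp add: c_def power2_eq_square eval_nat_numeral)
  have y236: "y \<ge> 236 / 10" unfolding y_def by (rule mu_ge_85[OF n])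
  have x0: "x > 0" using mu_pred_ge[OF n] by (simp add: x_def)
  have x2: "x\<^sup>2 = y\<^sup>2 - 2 * pi\<^sup>2 / 3" using mu_triple[of n] n by (simp add: x_def y_def)
  have 1: "g_fun x y z \<le> 1 - c / y ^ 3 + 4 * c / y ^ 4 - 3 * c / y ^ 5 + 60 / y ^ 6"
    using g_mu_bounds(1)[OF n] by (simp only: x_def y_def z_def c_def)
  have 2: "110 / x ^ 5 \<le> 110 / y ^ 5 + 80 / y ^ 6"
    by (rule inverse_fifth_bound[OF x0 y236 b_const_bounds(1,2) x2])
  have 3: "c / y ^ 3 = 24 * pi / (N * R)"
    unfolding c y R(2) using R(1) by (simp add: divide_simps power_mult_distrib power_divide) (simp add: eval_nat_numeral)
  have 4: "4 * c / y ^ 4 = 576 / N\<^sup>2"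
    unfolding c y R(2) using R(1) by (simp add: divide_simps power_mult_distrib power_divide)
  have p2: "pi\<^sup>2 \<ge> 9869 / 1000" by (rule pi_square_bounds)
  have "(pi\<^sup>2)\<^sup>2 \<ge> (9869 / 1000)\<^sup>2" using p2 by (intro power_mono) auto
  then have p4: "pi ^ 4 \<ge> 97397 / 1000" by (simp add: power_mult[symmetric] power2_eq_square[of "9869 / 1000"])
  have "(pi\<^sup>2) ^ 3 \<ge> (9869 / 1000) ^ 3" using p2 by (intro power_mono) auto
  then have p6: "pi ^ 6 \<ge> 9612 / 10" by (simp add: power_mult[symmetric] power_divide)
  have p5: "pi ^ 5 \<ge> 305972 / 1000"
  proof -
    have "31415 / 10000 * (97397 / 1000) \<le> pi * pi ^ 4" using p4 pi_approx by (intro mult_mono) auto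
    then show ?thesis by (simp add: eval_nat_numeral)
  qed
  \<comment> \<open>The numerator \<open>(110 - pi^4 / 3) * 7776 / pi^5\<close> is about
    1970.\<close>
  have 5: "(110 - 3 * c) / y ^ 5 \<le> 1971 / (N\<^sup>2 * R)"
  proof -
    have "(110 - 3 * c) / y ^ 5 = ((110 - pi ^ 4 / 3) * 7776 / pi ^ 5) / (N\<^sup>2 * R)"
      unfolding c y R(2) using R(1) by (simp add: divide_simps power_mult_distrib power_divide) (simp add: eval_nat_numeral)
    also have "\<dots> \<le> 1971 / (N\<^sup>2 * R)"
    proof (rule divide_right_mono)
      have "(110 - pi ^ 4 / 3) * 7776 \<le> 1971 * pi ^ 5" using p4 p5 by simp
      then show "(110 - pi ^ 4 / 3) * 7776 / pi ^ 5 \<le> 1971" by (simp add: pos_divide_le_eq)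
    qed (use R in simp)
    finally show ?thesis .
  qed
  \<comment> \<open>The 140 joins the 60 of the expansion of \<open>g_fun\<close> and the 80 of
    \<open>inverse_fifth_bound\<close>; \<open>140 * 46656 / pi^6\<close> is about 6794.\<close>
  have 6: "140 / y ^ 6 \<le> 6800 / N ^ 3"
  proof -
    have "140 / y ^ 6 = (140 * 46656 / pi ^ 6) / N ^ 3"
      unfolding y R(2) using R(1) by (simp add: divide_simps power_mult_distrib power_divide power_mult[symmetric])
    also have "\<dots> \<le> 6800 / N ^ 3"
    proof (rule divide_right_mono)
      show "140 * 46656 / pi ^ 6 \<le> 6800" using p6 by (simp add: pos_divide_le_eq)
    qed (use N0 in simp)
    finally show ?thesis .
  qed
  have "(110 - 3 * c) / y ^ 5 = 110 / y ^ 5 - 3 * c / y ^ 5" "140 / y ^ 6 = 60 / y ^ 6 + 80 / y ^ 6"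
    by (simp_all add: diff_divide_distrib)
  then have "g_fun x y z + 110 / x ^ 5 \<le> 1 - (24 * pi / (N * R) - 576 / N\<^sup>2 - 1971 / (N\<^sup>2 * R) - 6800 / N ^ 3)"
    using 1 2 3 4 5 6 by linarith
  then show ?thesis using f_fun_le_g[OF n] by (simp add: x_def y_def z_def R_def)
qed

text \<open>The inequality of arithmetic and geometric means,
  \<open>2 * i * sqrt s <= 1 + i^2 * s\<close>, turned into a rational lower bound for the
  root.\<close>

lemma sqrt_ge_ratio:
  assumes "0 \<le> s" "0 < (i :: real)"
  shows "2 * s * i / (1 + i\<^sup>2 * s) \<le> sqrt s"
proof -
  have "0 \<le> (1 - i * sqrt s)\<^sup>2" by simp
  then have "2 * (i * sqrt s) \<le> 1 + i\<^sup>2 * s" using assms by (simp add: power2_eq_square algebra_simps)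
  then have "sqrt s * (2 * (i * sqrt s)) \<le> sqrt s * (1 + i\<^sup>2 * s)" using assms by (intro mult_left_mono) auto
  moreover have "sqrt s * (2 * (i * sqrt s)) = 2 * s * i" using assms by simp
  moreover have "0 < 1 + i\<^sup>2 * s" using assms by (simp add: add_pos_nonneg)
  ultimately show ?thesis by (simp add: pos_divide_le_eq)
qed

text \<open>
  With \<open>S = D/B\<close> the last inequality is \<open>S + S\<^sup>2 < 4 S\<^sup>2 i/(1 + i\<^sup>2 S) + \<tau> (1 - 2 S)\<close>, where \<open>\<tau>\<close> is the bound of
  \<open>tau_bound\<close> with \<open>24 \<pi> \<ge> 603/8\<close> and \<open>\<surd>N \<ge> 2 N r/(r\<^sup>2 + N)\<close>. The latter and the corresponding bound for \<open>\<surd>S\<close> hold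
  for arbitrary \<open>r, i > 0\<close>; they are sharp for \<open>r\<close> near \<open>\<surd>N\<close> and \<open>i\<close> near \<open>1/\<surd>S\<close>.
\<close>

definition final_check :: "int \<Rightarrow> int \<Rightarrow> int \<Rightarrow> int \<Rightarrow> int \<Rightarrow> bool" where
  "final_check B D N r i \<longleftrightarrow> 0 < B \<and> 9 * D \<le> B \<and>
     D * (8 * N * N * N * (r * r + N)) * ((B + D) * (B + i * i * D) - 4 * D * i * B)
       < (2 * N * r * (603 * N - 15768) - 8 * (r * r + N) * (576 * N + 6800)) * (B - 2 * D) * (B * (B + i * i * D))"

lemma final_check_sound:
  assumes n: "n \<ge> 85" and N: "N = 24 * int n - 1" and r: "r > 0" and i: "i > 0"
    and u: "0 < u_ratio n" "u_ratio n \<le> 1" and D: "0 \<le> D" and s: "1 - u_ratio n \<le> of_int D / of_int B"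
    and chk: "final_check B D N r i"
  shows "f_fun n + 110 / mu (n - 1) ^ 5 < Q_fun (u_ratio n)"
proof -
  define N' r' i' B' D' where "N' = real_of_int N" and "r' = real_of_int r" and "i' = real_of_int i"
    and "B' = real_of_int B" and "D' = real_of_int D"
  define S where "S = D' / B'"
  define E where "E = B' + i' * i' * D'"
  have B: "B' > 0" and D9: "9 * D' \<le> B'"
    using chk unfolding final_check_def B'_def D'_def by (simp, metis of_int_le_iff of_int_mult of_int_numeral)
  have D0: "D' \<ge> 0" using D by (simp add: D'_def)
  have i0: "i' > 0" and r0: "r' > 0" using i r by (simp_all add: i'_def r'_def)
  have N': "N' = 24 * real n - 1" unfolding N'_def N by simp
  have N2039: "N' \<ge> 2039" using n by (simp add: N')
  have E0: "E > 0" unfolding E_def using B D0 i0 by (simp add: add_pos_nonneg)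
  \<comment> \<open>\<open>tn / td\<close> is the lower bound for the bracket of
    \<open>tau_bound\<close>, with denominators cleared: \<open>15768 = 8 * 1971\<close>, and
    \<open>603 / 8 = 75.375\<close> lies just below \<open>24 * pi\<close>.\<close>
  define tn td where "tn = 2 * N' * r' * (603 * N' - 15768) - 8 * (r' * r' + N') * (576 * N' + 6800)"
    and "td = 8 * N' * N' * N' * (r' * r' + N')"
  have td0: "td > 0" unfolding td_def using N2039 r0 by (simp add: add_pos_pos)
  have "real_of_int (D * (8 * N * N * N * (r * r + N)) * ((B + D) * (B + i * i * D) - 4 * D * i * B))
     < real_of_int ((2 * N * r * (603 * N - 15768) - 8 * (r * r + N) * (576 * N + 6800)) * (B - 2 * D) * (B * (B + i * i * D)))"
    using chk unfolding final_check_def of_int_less_iff by blast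
  then have ineq: "D' * td * ((B' + D') * E - 4 * D' * i' * B') < tn * (B' - 2 * D') * (B' * E)"
    by (simp add: td_def tn_def E_def N'_def r'_def i'_def B'_def D'_def)
  define \<tau> where "\<tau> = tn / td"
  have S0: "S \<ge> 0" using B D0 by (simp add: S_def)
  have "S + S\<^sup>2 < 4 * S\<^sup>2 * i' / (1 + i'\<^sup>2 * S) + \<tau> * (1 - 2 * S)"
  proof -
    have e1: "1 + i'\<^sup>2 * S = E / B'" using B by (simp add: S_def E_def power2_eq_square field_simps)
    have "D' * td * ((B' + D') * E - 4 * D' * i' * B') / (td * (B' * B' * E)) < tn * (B' - 2 * D') * (B' * E) / (td * (B' * B' * E))"
      using ineq td0 B E0 by (intro divide_strict_right_mono) auto
    moreover have "D' * td * ((B' + D') * E - 4 * D' * i' * B') / (td * (B' * B' * E)) = S + S\<^sup>2 - 4 * S\<^sup>2 * i' / (E / B')"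
      using td0 B E0 by (simp add: S_def divide_simps power2_eq_square) (simp add: algebra_simps)
    moreover have "tn * (B' - 2 * D') * (B' * E) / (td * (B' * B' * E)) = \<tau> * (1 - 2 * S)"
      using td0 B E0 by (simp add: S_def \<tau>_def divide_simps)
    ultimately show ?thesis unfolding e1 by linarith
  qed
  also have "4 * S\<^sup>2 * i' / (1 + i'\<^sup>2 * S) = 2 * S * (2 * S * i' / (1 + i'\<^sup>2 * S))" by (simp add: power2_eq_square)
  finally have cond0: "S + S\<^sup>2 < 2 * S * (2 * S * i' / (1 + i'\<^sup>2 * S)) + \<tau> * (1 - 2 * S)" .
  have "2 * S * (2 * S * i' / (1 + i'\<^sup>2 * S)) \<le> 2 * S * sqrt S"
    using sqrt_ge_ratio[OF S0 i0] S0 by (intro mult_left_mono) auto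
  with cond0 have cond: "S + S\<^sup>2 < 2 * S * sqrt S + \<tau> * (1 - 2 * S)" by linarith
  have \<tau>le: "\<tau> \<le> 24 * pi / (N' * sqrt N') - 576 / N'\<^sup>2 - 1971 / (N'\<^sup>2 * sqrt N') - 6800 / N' ^ 3"
  proof -
    define R where "R = sqrt N'"
    have R: "R > 0" "N' = R * R" using N2039 by (simp_all add: R_def)
    define l where "l = 2 * N' * r' / (r' * r' + N')"
    have lR: "l \<le> R"
    proof -
      have "0 \<le> (r' - R)\<^sup>2" by simp
      then have "2 * (r' * R) \<le> r' * r' + N'" unfolding R(2) by (simp add: power2_eq_square algebra_simps)
      then have "R * (2 * (r' * R)) \<le> R * (r' * r' + N')" using R by (intro mult_left_mono) auto
      moreover have "R * (2 * (r' * R)) = 2 * N' * r'" unfolding R(2) by simp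
      moreover have "0 < r' * r' + N'" using r0 N2039 by (simp add: add_pos_pos)
      ultimately show ?thesis by (simp add: l_def pos_divide_le_eq)
    qed
    have "\<tau> = (l * (603 * N' / 8 - 1971) - 576 * N' - 6800) / (N' * N' * N')"
    proof -
      have q: "r' * r' + N' > 0" using r0 N2039 by (simp add: add_pos_pos)
      have "tn / (8 * q * M) = (2 * N' * r' / q * (603 * N' / 8 - 1971) - 576 * N' - 6800) / M"
        if "q > 0" "M > 0" "tn = 2 * N' * r' * (603 * N' - 15768) - 8 * q * (576 * N' + 6800)" for q M tn :: real
        using that by (simp add: field_simps)
      from this[OF q _ tn_def, of "N' * N' * N'"] show ?thesis using N2039 unfolding \<tau>_def td_def l_def by (simp add: mult_ac)
    qed
    also have "\<dots> \<le> (R * (24 * pi * N' - 1971) - 576 * N' - 6800) / (N' * N' * N')"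
    proof (rule divide_right_mono)
      have "603 / 8 \<le> 24 * pi" using pi_approx by simp
      then have "603 / 8 * N' \<le> 24 * pi * N'" using N2039 by (intro mult_right_mono) auto
      then have "l * (603 * N' / 8 - 1971) \<le> R * (24 * pi * N' - 1971)"
        using lR R N2039 by (intro mult_mono) auto
      then show "l * (603 * N' / 8 - 1971) - 576 * N' - 6800 \<le> R * (24 * pi * N' - 1971) - 576 * N' - 6800" by simp
    qed (use N2039 in simp)
    also have "\<dots> = 24 * pi / (N' * R) - 576 / N'\<^sup>2 - 1971 / (N'\<^sup>2 * R) - 6800 / N' ^ 3"
      unfolding R(2) using R(1) by (simp add: divide_simps power2_eq_square power3_eq_cube) (simp add: algebra_simps)
    finally show ?thesis by (simp add: R_def)
  qed
  show ?thesis
  proof (rule Q_criterion[OF u, where S = S and \<tau> = \<tau>])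
    show "1 - u_ratio n \<le> S" using s by (simp add: S_def B'_def D'_def)
    show "S \<le> 1 / 9" using B D9 by (simp add: S_def divide_simps)
    show "f_fun n + 110 / mu (n - 1) ^ 5 \<le> 1 - \<tau>"
      using tau_bound[OF n] \<tau>le unfolding N'[symmetric] by linarith
  qed (rule cond)
qed

section \<open>Integer tests on truncated partition numbers\<close>

definition shr :: "nat \<Rightarrow> int \<Rightarrow> int" where
  "shr n x = x div 2 ^ n"

text \<open>Rules that evaluate the shift on numerals by stripping one binary digit at a time,
  without any division.\<close>

lemma shr_simps:
  "shr 0 x = x" "shr n 0 = 0" "shr (Suc n) (numeral num.One) = 0"
  "shr (Suc n) (numeral (num.Bit0 m)) = shr n (numeral m)"
  "shr (Suc n) (numeral (num.Bit1 m)) = shr n (numeral m)"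
proof -
  have *: "shr (Suc n) x = shr n (x div 2)" for x unfolding shr_def by (simp add: zdiv_zmult2_eq)
  show "shr 0 x = x" "shr n 0 = 0" by (simp_all add: shr_def)
  show "shr (Suc n) (numeral num.One) = 0" unfolding * by (simp add: shr_def)
  show "shr (Suc n) (numeral (num.Bit0 m)) = shr n (numeral m)"
    "shr (Suc n) (numeral (num.Bit1 m)) = shr n (numeral m)" unfolding * by simp_all
qed

lemma shr_bounds: "shr n x * 2 ^ n \<le> x" "x < (shr n x + 1) * 2 ^ n"
proof -
  have "x = shr n x * 2 ^ n + x mod 2 ^ n" unfolding shr_def by (simp add: mult.commute)
  moreover have "0 \<le> x mod 2 ^ n" "x mod 2 ^ n < 2 ^ n" by simp_all
  ultimately show "shr n x * 2 ^ n \<le> x" "x < (shr n x + 1) * 2 ^ n"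
    unfolding distrib_right mult_1 by linarith+
qed

lemma shr_nonneg: "0 \<le> x \<Longrightarrow> 0 \<le> shr n x"
  by (simp add: shr_def pos_imp_zdiv_nonneg_iff)

text \<open>Every rounding goes to the safe side. If the true values lie between \<open>a\<close>,
  \<open>b\<close>, \<open>c\<close> and \<open>a + 1\<close>, \<open>b + 1\<close>,
  \<open>c + 1\<close> in a common unit, the first conjunct certifies \<open>u <= 1\<close>, and
  \<open>1 - u\<close> is at most \<open>((b + 1)^2 - a * c) / (b + 1)^2\<close>. The second shift
  rounds the numerator of this fraction up and its denominator down.\<close>

definition trunc_check :: "int \<Rightarrow> int \<Rightarrow> int \<Rightarrow> int \<Rightarrow> nat \<Rightarrow> int \<Rightarrow> int \<Rightarrow> bool" where
  "trunc_check a b c N k r i \<longleftrightarrow> (c + 1) * (a + 1) < b * b \<and>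
     final_check (shr k ((b + 1) * (b + 1))) (shr k ((b + 1) * (b + 1) - a * c) + 1) N r i"

text \<open>
  The numbers \<open>h\<close> and \<open>k\<close> of discarded bits affect the precision only, not the soundness of the test.
\<close>

definition check :: "int \<Rightarrow> nat \<Rightarrow> nat \<Rightarrow> int \<Rightarrow> int \<Rightarrow> int \<Rightarrow> int \<Rightarrow> int \<Rightarrow> bool" where
  "check N h k r i a b c = (if N < 2039 then True else trunc_check (shr h a) (shr h b) (shr h c) N k r i)"

lemma partition_p_pos: "partition_p n > 0"
proof -
  have "replicate_mset n 1 \<in> partitions n" by (simp add: partitions_def)
  then show ?thesis unfolding partition_p_def using finite_partitions by (auto simp: card_gt_0_iff)
qed

text \<open>The ratio \<open>u_ratio n\<close> is homogeneous of degree 0 in the three partition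
  numbers, so the unit \<open>H = 2^h\<close> of the truncation cancels. For \<open>n >= 85\<close>
  one has \<open>N >= 2039\<close>, hence the test is really carried out.\<close>

lemma check_sound:
  assumes n: "n \<ge> 85" and r: "r > 0" and i: "i > 0"
    and chk: "check (24 * int n - 1) h k r i (int (partition_p (n - 1))) (int (partition_p n)) (int (partition_p (n + 1)))"
  shows "f_fun n + 110 / mu (n - 1) ^ 5 < Q_fun (u_ratio n)"
proof -
  define a b c where "a = int (partition_p (n - 1))" and "b = int (partition_p n)" and "c = int (partition_p (n + 1))"
  define a' b' c' where "a' = shr h a" and "b' = shr h b" and "c' = shr h c"
  define H :: int where "H = 2 ^ h"
  define B0 D0 where "B0 = (b' + 1) * (b' + 1)" and "D0 = B0 - a' * c'"
  define B D where "B = shr k B0" and "D = shr k D0 + 1"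
  have pos: "a > 0" "b > 0" "c > 0" using partition_p_pos by (simp_all add: a_def b_def c_def)
  have H0: "H > 0" by (simp add: H_def)
  have nn: "0 \<le> a'" "0 \<le> b'" "0 \<le> c'" using pos by (simp_all add: a'_def b'_def c'_def shr_nonneg)
  have bd: "a' * H \<le> a" "a < (a' + 1) * H" "b' * H \<le> b" "b < (b' + 1) * H" "c' * H \<le> c" "c < (c' + 1) * H"
    unfolding a'_def b'_def c'_def H_def by (rule shr_bounds)+
  have tc: "trunc_check a' b' c' (24 * int n - 1) k r i"
    using chk n by (simp add: check_def a_def b_def c_def a'_def b'_def c'_def)
  then have lt: "(c' + 1) * (a' + 1) < b' * b'" and fc: "final_check B D (24 * int n - 1) r i"
    by (simp_all add: trunc_check_def B_def D_def B0_def D0_def)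
  have B: "B > 0" using fc by (simp add: final_check_def)
  have "c * a \<le> ((c' + 1) * H) * ((a' + 1) * H)" using bd pos nn H0 by (intro mult_mono) auto
  also have "\<dots> = ((c' + 1) * (a' + 1)) * (H * H)" by (simp add: mult_ac)
  also have "\<dots> \<le> (b' * b') * (H * H)" using lt H0 by (intro mult_right_mono) auto
  also have "\<dots> = (b' * H) * (b' * H)" by (simp add: mult_ac)
  also have "\<dots> \<le> b * b" using bd nn H0 pos by (intro mult_mono) auto
  finally have ca: "c * a \<le> b * b" .
  have u: "u_ratio n = of_int (c * a) / of_int (b * b)"
    by (simp add: u_ratio_def a_def b_def c_def power2_eq_square)
  have bb: "(0::real) < of_int (b * b)" using pos by simp
  have u1: "u_ratio n \<le> 1" unfolding u using ca bb by (simp only: divide_le_eq_1_pos of_int_le_iff)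
  have u0: "0 < u_ratio n" unfolding u using pos by simp
  have B0: "B0 > 0" using nn by (simp add: B0_def)
  have D0: "D0 \<ge> 0"
  proof -
    have "a' * c' \<le> (c' + 1) * (a' + 1)" using nn by (simp add: algebra_simps)
    also have "\<dots> \<le> b' * b'" using lt by simp
    also have "\<dots> \<le> B0" unfolding B0_def using nn by (intro mult_mono) auto
    finally show ?thesis by (simp add: D0_def)
  qed
  have Dpos: "D \<ge> 0" using shr_nonneg[OF D0, of k] by (simp add: D_def)
  have s1: "1 - u_ratio n \<le> of_int D0 / of_int B0"
  proof -
    have "(a' * c') * (b * b) \<le> (a' * c') * (((b' + 1) * H) * ((b' + 1) * H))"
      using bd pos nn H0 by (intro mult_left_mono mult_mono) auto
    also have "\<dots> = ((c' * H) * (a' * H)) * B0" by (simp add: B0_def mult_ac)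
    also have "\<dots> \<le> (c * a) * B0" using bd nn H0 B0 pos by (intro mult_right_mono mult_mono) auto
    finally have "real_of_int ((a' * c') * (b * b)) \<le> of_int ((c * a) * B0)" by (simp only: of_int_le_iff)
    then have "of_int (a' * c') / real_of_int B0 \<le> u_ratio n"
      unfolding u using bb B0 by (simp add: divide_simps mult_ac)
    moreover have "real_of_int D0 / of_int B0 = 1 - of_int (a' * c') / of_int B0"
      using B0 by (simp add: D0_def diff_divide_distrib)
    ultimately show ?thesis by linarith
  qed
  also have "real_of_int D0 / of_int B0 \<le> of_int (D * 2 ^ k) / of_int (B * 2 ^ k)"
  proof (rule frac_le)
    show "0 \<le> real_of_int (D * 2 ^ k)" using Dpos by simp
    show "real_of_int D0 \<le> of_int (D * 2 ^ k)" using shr_bounds(2)[of D0 k] by (simp only: D_def of_int_le_iff)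
    show "0 < real_of_int (B * 2 ^ k)" using B by simp
    show "real_of_int (B * 2 ^ k) \<le> of_int B0" using shr_bounds(1)[of k B0] by (simp only: B_def of_int_le_iff)
  qed
  also have "real_of_int (D * 2 ^ k) / of_int (B * 2 ^ k) = of_int D / of_int B" by simp
  finally have s: "1 - u_ratio n \<le> of_int D / of_int B" .
  show ?thesis by (rule final_check_sound[OF n refl r i u0 u1 Dpos s fc])
qed

text \<open>The thresholds here and in \<open>next_k\<close> are \<open>2^36\<close> and
  \<open>2^34\<close>: the shifts grow with \<open>p(n)\<close>, which keeps the compared numbers
  near that size.\<close>

definition next_h :: "nat \<Rightarrow> int \<Rightarrow> nat" where
  "next_h h b = (if 68719476736 \<le> shr h b then Suc h else h)"
definition next_k :: "nat \<Rightarrow> nat \<Rightarrow> int \<Rightarrow> nat" where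
  "next_k h k b = (if 17179869184 \<le> shr k (shr h b * shr h b) then Suc k else k)"
text \<open>In the relevant range \<open>r\<close> follows the integer part of
  \<open>sqrt N\<close>, and \<open>i\<close> that of \<open>r^(3/2) / 8\<close>. The latter is
  close to \<open>1 / sqrt S\<close>, because \<open>S\<close> is about
  \<open>24 * pi / N^(3/2)\<close> and \<open>sqrt (24 * pi)\<close> is about 8.7.\<close>

definition next_r :: "int \<Rightarrow> int \<Rightarrow> int" where
  "next_r N r = (if (r + 1) * (r + 1) \<le> N + 24 then r + 1 else r)"
definition next_i :: "int \<Rightarrow> int \<Rightarrow> int" where
  "next_i r i = (if 64 * (i + 1) * (i + 1) \<le> r * r * r then i + 1 else i)"

text \<open>The list is \<open>p(n), ..., p(0)\<close> and \<open>N = 24 * n - 1\<close>, so 19199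
  belongs to \<open>n = 800\<close>. The other arguments are hints: soundness asks only that
  \<open>r\<close> and \<open>i\<close> be positive.\<close>

function run :: "int \<Rightarrow> nat \<Rightarrow> nat \<Rightarrow> int \<Rightarrow> int \<Rightarrow> int list \<Rightarrow> bool" where
  "run N h k r i xs = (if 19199 < N then True else (case xs of b # a # ys \<Rightarrow>
     check N h k r i a b (pent_next xs) \<and>
     run (N + 24) (next_h h b) (next_k h k b) (next_r N r) (next_i (next_r N r) i) (pent_next xs # xs)
   | _ \<Rightarrow> False))"
  by pat_completeness auto
termination by (relation "Wellfounded.measure (\<lambda>(N, _). nat (19200 - N))") auto
declare run.simps [simp del]

lemma run_sound:
  assumes "run (24 * int n - 1) h k r i (partition_list (Suc n))" "n \<ge> 1" "r > 0" "i > 0"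
    and "n \<le> m" "m \<le> 800" "85 \<le> m"
  shows "f_fun m + 110 / mu (m - 1) ^ 5 < Q_fun (u_ratio m)"
  using assms
proof (induction "m - n" arbitrary: n h k r i)
  case (0 n h k r i)
  then have m: "m = n" by simp
  obtain l where l: "n = Suc l" using \<open>n \<ge> 1\<close> by (cases n) auto
  have xs: "partition_list (Suc n) = int (partition_p n) # int (partition_p (n - 1)) # partition_list l"
    by (simp add: partition_list_Suc l)
  have nx: "pent_next (partition_list (Suc n)) = int (partition_p (n + 1))" using pent_next_partition_list[of "Suc n"] by simp
  have "\<not> 19199 < 24 * int n - 1" using 0 m by simp
  with 0(2) have "check (24 * int n - 1) h k r i (int (partition_p (n - 1))) (int (partition_p n)) (pent_next (partition_list (Suc n)))"
    by (subst (asm) run.simps) (simp add: xs)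
  then show ?case unfolding nx m using 0 m by (intro check_sound) auto
next
  case (Suc d n h k r i)
  obtain l where l: "n = Suc l" using \<open>n \<ge> 1\<close> by (cases n) auto
  have xs: "partition_list (Suc n) = int (partition_p n) # int (partition_p (n - 1)) # partition_list l"
    by (simp add: partition_list_Suc l)
  have nx: "pent_next (partition_list (Suc n)) # partition_list (Suc n) = partition_list (Suc (Suc n))"
    using pent_next_partition_list[of "Suc n"] by (simp add: partition_list_Suc)
  have "\<not> 19199 < 24 * int n - 1" using Suc by simp
  with Suc.prems(1) have "run (24 * int n - 1 + 24) (next_h h (int (partition_p n))) (next_k h k (int (partition_p n)))
      (next_r (24 * int n - 1) r) (next_i (next_r (24 * int n - 1) r) i) (partition_list (Suc (Suc n)))"
    unfolding nx[symmetric] by (subst (asm) run.simps) (simp add: xs)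
  moreover have "24 * int n - 1 + 24 = 24 * int (Suc n) - 1" by simp
  ultimately have "run (24 * int (Suc n) - 1) (next_h h (int (partition_p n))) (next_k h k (int (partition_p n)))
      (next_r (24 * int n - 1) r) (next_i (next_r (24 * int n - 1) r) i) (partition_list (Suc (Suc n)))" by (simp only:)
  moreover have "next_r (24 * int n - 1) r > 0" using Suc.prems by (simp add: next_r_def)
  moreover have "next_i (next_r (24 * int n - 1) r) i > 0" using Suc.prems by (simp add: next_i_def)
  moreover have "d = m - Suc n" "Suc n \<le> m" using Suc.hyps(2) by auto
  ultimately show ?case using Suc.hyps(1)[of "Suc n"] Suc.prems by simp
qed

text \<open>Here and in the next three definitions a value still under evaluation gets an argument
  position of its own: an accumulator, the new partition number, or the outcome of a test. It can
  thus be normalised before the next equation fires.\<close>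

definition pent_first_add :: "int \<Rightarrow> nat \<Rightarrow> nat \<Rightarrow> nat \<Rightarrow> int \<Rightarrow> int list \<Rightarrow> int" where
  "pent_first_add P c s d M xs = pent_first c s d M P xs"
definition pent_second_add :: "int \<Rightarrow> nat \<Rightarrow> nat \<Rightarrow> nat \<Rightarrow> int \<Rightarrow> int list \<Rightarrow> int" where
  "pent_second_add P c s d M xs = pent_second c s d P M xs"
definition run_step :: "int \<Rightarrow> int \<Rightarrow> nat \<Rightarrow> nat \<Rightarrow> int \<Rightarrow> int \<Rightarrow> int list \<Rightarrow> bool" where
  "run_step c N h k r i xs = (case xs of b # a # ys \<Rightarrow> check N h k r i a b c \<and>
     run (N + 24) (next_h h b) (next_k h k b) (next_r N r) (next_i (next_r N r) i) (c # xs) | _ \<Rightarrow> False)"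
definition run_cont :: "bool \<Rightarrow> int \<Rightarrow> nat \<Rightarrow> nat \<Rightarrow> int \<Rightarrow> int \<Rightarrow> int \<Rightarrow> int list \<Rightarrow> bool" where
  "run_cont p N h k r i c xs \<longleftrightarrow> p \<and> run N h k r i (c # xs)"

lemma run_rules:
  "pent_first 0 s d P M (x # xs) = pent_second_add (P + x) s s d M xs"
  "pent_second 0 s d P M (x # xs) = - pent_first_add (P + x) (Suc (Suc d)) (Suc s) (Suc (Suc d)) M xs"
  "run N h k r i xs = (if 19199 < N then True else run_step (pent_next xs) N h k r i xs)"
  "run_step c N h k r i (b # a # ys) = run_cont (check N h k r i a b c) (N + 24) (next_h h b) (next_k h k b)
      (next_r N r) (next_i (next_r N r) i) c (b # a # ys)"
  "run_cont True N h k r i c xs = run N h k r i (c # xs)"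
  by (simp_all add: pent_first_add_def pent_second_add_def run_cont_def run_step_def run.simps[of N])

text \<open>
  These congruences keep the simplifier from traversing the list of partition numbers, which is
  already in normal form, after every single rewrite step.
\<close>

lemma run_congs:
  "pent_first c s d P M xs = pent_first c s d P M xs"
  "pent_second c s d P M xs = pent_second c s d P M xs"
  "P = P' \<Longrightarrow> pent_first_add P c s d M xs = pent_first_add P' c s d M xs"
  "P = P' \<Longrightarrow> pent_second_add P c s d M xs = pent_second_add P' c s d M xs"
  "pent_next xs = pent_next xs"
  "run N h k r i xs = run N h k r i xs"
  "P = P' \<Longrightarrow> run_step P N h k r i xs = run_step P' N h k r i xs"
  "p = p' \<Longrightarrow> N = N' \<Longrightarrow> h = h' \<Longrightarrow> k = k' \<Longrightarrow> r = r' \<Longrightarrow> i = i' \<Longrightarrow>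
    run_cont p N h k r i P xs = run_cont p' N' h' k' r' i' P xs"
  by simp_all

text \<open>Eight skipped entries in one rewrite step, for the long gaps.\<close>

lemma skip8:
  "pent_first (Suc (Suc (Suc (Suc (Suc (Suc (Suc (Suc c)))))))) s d P M (x1 # x2 # x3 # x4 # x5 # x6 # x7 # x8 # xs) = pent_first c s d P M xs"
  "pent_second (Suc (Suc (Suc (Suc (Suc (Suc (Suc (Suc c)))))))) s d P M (x1 # x2 # x3 # x4 # x5 # x6 # x7 # x8 # xs) = pent_second c s d P M xs"
  by simp_all

text \<open>The run starts at \<open>n = 1\<close> with the list of \<open>p(1)\<close> and
  \<open>p(0)\<close>, since the recurrence needs all earlier values. The initial shift 16 suits
  \<open>n = 85\<close>, where it leaves 34 bits of \<open>p(85)^2\<close>. Numbers appear with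
  \<open>Suc\<close> and \<open>num.One\<close> because the rewrite rules match these forms.\<close>

lemma run_800: "run 23 0 (Suc (Suc (Suc (Suc (Suc (Suc (Suc (Suc (Suc (Suc (Suc (Suc (Suc (Suc (Suc (Suc 0)))))))))))))))) 4 (numeral num.One) [numeral num.One, numeral num.One]"
  by (simp only: run_rules pent_first.simps(1,2) pent_second.simps(1,2) skip8 pent_first_add_def pent_second_add_def pent_next_def
      check_def trunc_check_def final_check_def shr_simps next_h_def next_k_def next_r_def next_i_def
      numeral_One[symmetric] arith_simps rel_simps minus_minus if_True if_False simp_thms
      cong: run_congs if_weak_cong)

theorem theorem4p1:
  fixes n :: nat
  assumes "n \<ge> 85"
  shows "f_fun n + 110 / mu (n - 1) ^ 5 < Q_fun (u_ratio n)"
proof (cases "n \<le> 800")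
  case True
  have "pent_next (partition_list 1) = int (partition_p 1)" by (rule pent_next_partition_list) simp
  moreover have "partition_list (Suc 0) = [1]" by (simp add: partition_list_def partition_p_0)
  ultimately have "partition_p 1 = 1" by (simp add: pent_next_def)
  then have "partition_list (Suc 1) = [1, 1]" by (simp add: partition_list_Suc partition_list_def partition_p_0)
  then have "run (24 * int 1 - 1) 0 (Suc (Suc (Suc (Suc (Suc (Suc (Suc (Suc (Suc (Suc (Suc (Suc (Suc (Suc (Suc (Suc 0)))))))))))))))) 4 1 (partition_list (Suc 1))" using run_800 by simp
  then show ?thesis by (rule run_sound) (use assms True in auto)
next
  case False
  then show ?thesis by (intro theorem_large) simp
qed

end
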